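(* Let $p(z_1,z_2)=a_{10}z_1+a_{01}z_2+a_{20}z_1^2+a_{11}z_1z_2+a_{02}z_2^2$ be a complex polynomial, put $p_1(z)=a_{10}+a_{01}z$, $p_2(z)=a_{20}+a_{11}z+a_{02}z^2$, and let $P(z)=M_{p_1}z+M_{p_2}z^2$. The following are equivalent: (i) there is a holomorphic function $q$ on $\mathbb D^2$ with $\partial_1^{i_1}\partial_2^{i_2}q(\boldsymbol 0)=0$ whenever $i_1+i_2\le 2$ and $\sup_{\mathbb D^2}|p+q|\le 1$; (ii) $P$ is in the CF class; (iii) the operator $\mathscr T(M_{p_1},M_{p_2})$ is completely polynomially extendible.
   Context: $\mathbb D$ is the open unit disc, $\mathbb T$ the unit circle. For $\phi\in L^\infty(\mathbb T)$, $M_\phi$ is multiplication by $\phi$ on $L^2(\mathbb T)$. CF class: $P(z)=M_{p_1}z+M_{p_2}z^2$ is in the CF class if there exist one-variable polynomials $p_k$, $k\ge3$, with $\deg p_k\le k$, and a holomorphic function $f:\mathbb D\to\mathcal B(L^2(\mathbb T))$ with $f(0)=0$, $f^{(k)}(0)/k!=M_{p_k}$ for all $k\ge1$, and $\sup_{z\in\mathbb D}\|f(z)\|\le1$. For operators $A_1,\dots,A_n$ on a Hilbert space $\mathbb H$, $\mathscr T(A_1,\dots,A_n)$ is the $n\times n$ block upper triangular Toeplitz operator on $\mathbb H\otimes\mathbb C^n$ whose $(i,j)$ block is $A_{j-i+1}$ for $j\ge i$ and $0$ for $j<i$. Let $p_1,\dots,p_k$ be one-variable polynomials with $\deg p_j\le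 j$. The operator $\mathscr T(M_{p_1},\dots,M_{p_k})$ is $m$-polynomially extendible ($m\geq k$) if $\|\mathscr T(M_{p_1},\dots,M_{p_k})\|\le1$ and there are polynomials $p_{k+1},\dots,p_m$ with $\deg p_l\le l$ such that $\|\mathscr T(M_{p_1},\dots,M_{p_m})\|\le1$. It is completely polynomially extendible if it is $m$-polynomially extendible for all $m\ge k$. *)

theory Defs
  imports "HOL-Analysis.Analysis" "HOL-Computational_Algebra.Polynomial"
begin

class scaleC =
  fixes scaleC :: "complex \<Rightarrow> 'a \<Rightarrow> 'a" (infixr "*\<^sub>C" 75)

class complex_normed_vector = real_normed_vector + scaleC +
  assumes scaleC_add_right: "a *\<^sub>C (x + y) = a *\<^sub>C x + a *\<^sub>C y"
    and scaleC_add_left: "(a + b) *\<^sub>C x = a *\<^sub>C x + b *\<^sub>C x"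
    and scaleC_scaleC: "a *\<^sub>C b *\<^sub>C x = (a * b) *\<^sub>C x"
    and scaleC_of_real: "complex_of_real r *\<^sub>C x = r *\<^sub>R x"
    and norm_scaleC: "norm (a *\<^sub>C x) = cmod a * norm x"

lemma scaleC_one: "(1::complex) *\<^sub>C (x :: 'a :: complex_normed_vector) = x"
  using scaleC_of_real[of 1 x] by simp

lemma bounded_linear_scaleC:
  "bounded_linear (\<lambda>x :: 'a :: complex_normed_vector. a *\<^sub>C x)"
proof (rule bounded_linear_intro[where K = "cmod a"])
  show "a *\<^sub>C (r *\<^sub>R x) = r *\<^sub>R (a *\<^sub>C x)" for r and x :: 'a
    by (simp only: scaleC_of_real[symmetric] scaleC_scaleC mult.commute)
qed (simp_all add: scaleC_add_right norm_scaleC mult.commute)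

text \<open>The bounded \<^emph>\<open>real\<close>-linear maps into a complex normed space form a complex normed space;
  the bounded complex-linear operators are the subspace singled out by \<open>clinear_op\<close>.\<close>

instantiation blinfun :: (real_normed_vector, complex_normed_vector) complex_normed_vector
begin

lift_definition scaleC_blinfun :: "complex \<Rightarrow> ('a \<Rightarrow>\<^sub>L 'b) \<Rightarrow> ('a \<Rightarrow>\<^sub>L 'b)"
  is "\<lambda>a f x. a *\<^sub>C f x"
  by (rule bounded_linear_compose[OF bounded_linear_scaleC])

instance
proof
  fix a b :: complex and r :: real and x y :: "'a \<Rightarrow>\<^sub>L 'b"
  show "a *\<^sub>C (x + y) = a *\<^sub>C x + a *\<^sub>C y"
    by transfer (simp add: scaleC_add_right)
  show "(a + b) *\<^sub>C x = a *\<^sub>C x + b *\<^sub>C x"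
    by transfer (simp add: scaleC_add_left)
  show "a *\<^sub>C b *\<^sub>C x = (a * b) *\<^sub>C x"
    by transfer (simp add: scaleC_scaleC)
  show "complex_of_real r *\<^sub>C x = r *\<^sub>R x"
    by transfer (simp add: scaleC_of_real)
  have le: "norm (c *\<^sub>C z) \<le> cmod c * norm z" for c and z :: "'a \<Rightarrow>\<^sub>L 'b"
  proof (rule norm_blinfun_bound)
    fix v
    have "cmod c * norm (blinfun_apply z v) \<le> cmod c * (norm z * norm v)"
      by (intro mult_left_mono norm_blinfun) auto
    then show "norm (blinfun_apply (c *\<^sub>C z) v) \<le> cmod c * norm z * norm v"
      by (simp add: scaleC_blinfun.rep_eq norm_scaleC mult.assoc)
  qed auto
  show "norm (a *\<^sub>C x) = cmod a * norm x"
  proof (cases "a = 0")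
    case True
    then show ?thesis using le[of a x] by simp
  next
    case False
    have one: "(1::complex) *\<^sub>C x = x"
      by transfer (simp add: scaleC_one)
    have "inverse a *\<^sub>C a *\<^sub>C x = (inverse a * a) *\<^sub>C x"
      by transfer (simp add: scaleC_scaleC)
    then have "norm x \<le> cmod (inverse a) * norm (a *\<^sub>C x)"
      using le[of "inverse a" "a *\<^sub>C x"] False one by (simp del: inverse_eq_divide)
    then have "cmod a * norm x \<le> norm (a *\<^sub>C x)"
      using False by (simp add: norm_divide field_simps)
    with le[of a x] show ?thesis by simp
  qed
qed

end

definition clinear_op ::
  "('a :: complex_normed_vector \<Rightarrow>\<^sub>L 'b :: complex_normed_vector) \<Rightarrow> bool" where
  "clinear_op A \<longleftrightarrow> (\<forall>c x. blinfun_apply A (c *\<^sub>C x) = c *\<^sub>C blinfun_apply A x)"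

definition has_vec_cderiv ::
  "(complex \<Rightarrow> 'a :: complex_normed_vector) \<Rightarrow> 'a \<Rightarrow> complex \<Rightarrow> bool" where
  "has_vec_cderiv f D z \<longleftrightarrow> ((\<lambda>w. inverse (w - z) *\<^sub>C (f w - f z)) \<longlongrightarrow> D) (at z)"

definition vec_cderiv ::
  "(complex \<Rightarrow> 'a :: complex_normed_vector) \<Rightarrow> complex \<Rightarrow> 'a" where
  "vec_cderiv f z = (THE D. has_vec_cderiv f D z)"

text \<open>Meant for open sets \<open>S\<close> only.\<close>

definition vec_holomorphic_on ::
  "(complex \<Rightarrow> 'a :: complex_normed_vector) \<Rightarrow> complex set \<Rightarrow> bool" where
  "vec_holomorphic_on f S \<longleftrightarrow> (\<forall>z\<in>S. \<exists>D. has_vec_cderiv f D z)"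

definition holomorphic2_on :: "(complex \<times> complex \<Rightarrow> complex) \<Rightarrow> (complex \<times> complex) set \<Rightarrow> bool" where
  "holomorphic2_on q S \<longleftrightarrow>
     (\<forall>z\<in>S. \<exists>a b. (q has_derivative (\<lambda>(h, k). a * h + b * k)) (at z))"

definition partial1 :: "(complex \<times> complex \<Rightarrow> complex) \<Rightarrow> complex \<times> complex \<Rightarrow> complex" where
  "partial1 q = (\<lambda>(z, w). deriv (\<lambda>u. q (u, w)) z)"

definition partial2 :: "(complex \<times> complex \<Rightarrow> complex) \<Rightarrow> complex \<times> complex \<Rightarrow> complex" where
  "partial2 q = (\<lambda>(z, w). deriv (\<lambda>u. q (z, u)) w)"

abbreviation unit_disc :: "complex set" where
  "unit_disc \<equiv> ball 0 1"

text \<open>Normalised arc length; the space of this measure is the unit circle.\<close>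

definition circle_measure :: "complex measure" where
  "circle_measure =
     distr (uniform_measure lborel {0..2 * pi}) (restrict_space borel (sphere 0 1)) cis"

lemma measurable_cis_sphere: "cis \<in> uniform_measure lborel A \<rightarrow>\<^sub>M restrict_space borel (sphere 0 1)"
proof -
  have "cis \<in> borel_measurable borel"
    by (intro borel_measurable_continuous_onI continuous_intros)
  then have "cis \<in> borel \<rightarrow>\<^sub>M restrict_space borel (sphere 0 1)"
    by (intro measurable_restrict_space2) auto
  then show ?thesis
    by (subst measurable_cong_sets[OF _ refl, where M' = borel]) auto
qed

lemma emeasure_circle_measure: "emeasure circle_measure (sphere 0 1) = 1"
proof -
  have "cis -` sphere 0 1 = UNIV" by auto
  then have "emeasure circle_measure (sphere 0 1) = emeasure (uniform_measure lborel {0..2 * pi}) UNIV"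
    unfolding circle_measure_def
    by (subst emeasure_distr[OF measurable_cis_sphere])
      (auto simp: sets_restrict_space)
  also have "\<dots> = 1" by (subst emeasure_uniform_measure) (auto simp: divide_ennreal)
  finally show ?thesis .
qed

definition sq_integrable :: "(complex \<Rightarrow> complex) \<Rightarrow> bool" where
  "sq_integrable f \<longleftrightarrow> f \<in> borel_measurable circle_measure \<and>
     integrable circle_measure (\<lambda>t. (cmod (f t))\<^sup>2)"

lemma sq_integrable_add:
  assumes "sq_integrable f" "sq_integrable g"
  shows "sq_integrable (\<lambda>t. f t + g t)"
proof -
  have [measurable]: "f \<in> borel_measurable circle_measure" "g \<in> borel_measurable circle_measure"
    using assms by (auto simp: sq_integrable_def)
  have "integrable circle_measure (\<lambda>t. (cmod (f t + g t))\<^sup>2)"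
  proof (rule Bochner_Integration.integrable_bound)
    show "integrable circle_measure (\<lambda>t. 2 * (cmod (f t))\<^sup>2 + 2 * (cmod (g t))\<^sup>2)"
      using assms by (auto simp: sq_integrable_def)
    have "(cmod (x + y))\<^sup>2 \<le> 2 * (cmod x)\<^sup>2 + 2 * (cmod y)\<^sup>2" for x y
    proof -
      have "(cmod (x + y))\<^sup>2 \<le> (cmod x + cmod y)\<^sup>2"
        by (intro power_mono norm_triangle_ineq) auto
      also have "\<dots> \<le> 2 * (cmod x)\<^sup>2 + 2 * (cmod y)\<^sup>2"
        using sum_squares_bound[of "cmod x" "cmod y"] by (simp add: power2_sum)
      finally show ?thesis .
    qed
    then show "AE t in circle_measure. norm ((cmod (f t + g t))\<^sup>2)
        \<le> norm (2 * (cmod (f t))\<^sup>2 + 2 * (cmod (g t))\<^sup>2)"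
      by auto
  qed auto
  then show ?thesis by (auto simp: sq_integrable_def)
qed

definition Linfty_circle :: "(complex \<Rightarrow> complex) set" where
  "Linfty_circle = {\<phi>. \<phi> \<in> borel_measurable circle_measure \<and>
     (\<exists>C. AE t in circle_measure. cmod (\<phi> t) \<le> C)}"

lemma sq_integrable_mult:
  assumes "\<phi> \<in> Linfty_circle" "sq_integrable f"
  shows "sq_integrable (\<lambda>t. \<phi> t * f t)"
proof -
  have [measurable]: "f \<in> borel_measurable circle_measure" "\<phi> \<in> borel_measurable circle_measure"
    using assms by (auto simp: sq_integrable_def Linfty_circle_def)
  obtain C where C: "AE t in circle_measure. cmod (\<phi> t) \<le> C"
    using assms by (auto simp: Linfty_circle_def)
  have "integrable circle_measure (\<lambda>t. (cmod (\<phi> t * f t))\<^sup>2)"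
  proof (rule Bochner_Integration.integrable_bound)
    show "integrable circle_measure (\<lambda>t. C\<^sup>2 * (cmod (f t))\<^sup>2)"
      using assms by (auto simp: sq_integrable_def)
    show "AE t in circle_measure. norm ((cmod (\<phi> t * f t))\<^sup>2) \<le> norm (C\<^sup>2 * (cmod (f t))\<^sup>2)"
      using C by eventually_elim
        (auto simp: norm_mult power_mult_distrib intro!: mult_right_mono power_mono)
  qed auto
  then show ?thesis by (auto simp: sq_integrable_def)
qed

lemma const_Linfty_circle: "(\<lambda>_. c) \<in> Linfty_circle"
  by (auto simp: Linfty_circle_def)

lemma sq_integrable_cmult: "sq_integrable f \<Longrightarrow> sq_integrable (\<lambda>t. c * f t)"
  by (rule sq_integrable_mult[OF const_Linfty_circle])

lemma sq_integrable_0: "sq_integrable (\<lambda>_. 0)"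
  by (simp add: sq_integrable_def)

lemma sq_integrable_uminus: "sq_integrable f \<Longrightarrow> sq_integrable (\<lambda>t. - f t)"
  using sq_integrable_cmult[of f "-1"] by simp

lemma sq_integrable_diff:
  "sq_integrable f \<Longrightarrow> sq_integrable g \<Longrightarrow> sq_integrable (\<lambda>t. f t - g t)"
  using sq_integrable_add[OF _ sq_integrable_uminus] by simp

lemma sq_integrable_inner:
  assumes "sq_integrable f" "sq_integrable g"
  shows "integrable circle_measure (\<lambda>t. f t \<bullet> g t)"
proof (rule Bochner_Integration.integrable_bound)
  have [measurable]: "f \<in> borel_measurable circle_measure" "g \<in> borel_measurable circle_measure"
    using assms by (auto simp: sq_integrable_def)
  show "integrable circle_measure (\<lambda>t. (cmod (f t))\<^sup>2 + (cmod (g t))\<^sup>2)"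
    using assms by (auto simp: sq_integrable_def)
  show "(\<lambda>t. f t \<bullet> g t) \<in> borel_measurable circle_measure" by measurable
  have "norm (x \<bullet> y) \<le> norm ((cmod x)\<^sup>2 + (cmod y)\<^sup>2)" for x y
  proof -
    have "\<bar>x \<bullet> y\<bar> \<le> cmod x * cmod y" by (rule Cauchy_Schwarz_ineq2)
    also have "\<dots> \<le> 2 * cmod x * cmod y" by simp
    also have "\<dots> \<le> (cmod x)\<^sup>2 + (cmod y)\<^sup>2" by (rule sum_squares_bound)
    finally show ?thesis by simp
  qed
  then show "AE t in circle_measure. norm (f t \<bullet> g t)
      \<le> norm ((cmod (f t))\<^sup>2 + (cmod (g t))\<^sup>2)" by blast
qed

definition L2_rel :: "(complex \<Rightarrow> complex) \<Rightarrow> (complex \<Rightarrow> complex) \<Rightarrow> bool" where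
  "L2_rel f g \<longleftrightarrow> sq_integrable f \<and> sq_integrable g \<and> (AE t in circle_measure. f t = g t)"

lemma part_equivp_L2_rel: "part_equivp L2_rel"
proof (rule part_equivpI)
  show "\<exists>f. L2_rel f f" using sq_integrable_0 by (auto simp: L2_rel_def)
  show "symp L2_rel" by (rule sympI) (auto simp: L2_rel_def)
  show "transp L2_rel"
  proof (rule transpI)
    fix f g h assume *: "L2_rel f g" "L2_rel g h"
    then have "AE t in circle_measure. f t = g t" "AE t in circle_measure. g t = h t"
      by (auto simp: L2_rel_def)
    then have "AE t in circle_measure. f t = h t" by eventually_elim simp
    with * show "L2_rel f h" by (auto simp: L2_rel_def)
  qed
qed

quotient_type L2_circle = "complex \<Rightarrow> complex" / partial: L2_rel
  by (rule part_equivp_L2_rel)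

instantiation L2_circle :: real_inner
begin

lift_definition zero_L2_circle :: L2_circle is "\<lambda>_. 0"
  by (simp add: L2_rel_def sq_integrable_0)

lift_definition plus_L2_circle :: "L2_circle \<Rightarrow> L2_circle \<Rightarrow> L2_circle" is "\<lambda>f g t. f t + g t"
  by (auto simp: L2_rel_def intro: sq_integrable_add)

lift_definition minus_L2_circle :: "L2_circle \<Rightarrow> L2_circle \<Rightarrow> L2_circle" is "\<lambda>f g t. f t - g t"
  by (auto simp: L2_rel_def intro: sq_integrable_diff)

lift_definition uminus_L2_circle :: "L2_circle \<Rightarrow> L2_circle" is "\<lambda>f t. - f t"
  by (auto simp: L2_rel_def intro: sq_integrable_uminus)

lift_definition scaleR_L2_circle :: "real \<Rightarrow> L2_circle \<Rightarrow> L2_circle" is "\<lambda>r f t. of_real r * f t"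
  by (auto simp: L2_rel_def intro: sq_integrable_cmult)

text \<open>The real part of the usual Hermitian inner product.\<close>

lift_definition inner_L2_circle :: "L2_circle \<Rightarrow> L2_circle \<Rightarrow> real"
  is "\<lambda>f g. \<integral>t. f t \<bullet> g t \<partial>circle_measure"
proof -
  fix f f' g g' assume *: "L2_rel f f'" "L2_rel g g'"
  then have [measurable]: "f \<in> borel_measurable circle_measure" "g \<in> borel_measurable circle_measure"
    "f' \<in> borel_measurable circle_measure" "g' \<in> borel_measurable circle_measure"
    by (auto simp: L2_rel_def sq_integrable_def)
  from * have "AE t in circle_measure. f t = f' t" "AE t in circle_measure. g t = g' t"
    by (auto simp: L2_rel_def)
  then have "AE t in circle_measure. f t \<bullet> g t = f' t \<bullet> g' t" by eventually_elim simp
  then show "(\<integral>t. f t \<bullet> g t \<partial>circle_measure) = (\<integral>t. f' t \<bullet> g' t \<partial>circle_measure)"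
    by (intro integral_cong_AE) auto
qed

definition norm_L2_circle :: "L2_circle \<Rightarrow> real" where
  "norm_L2_circle x = sqrt (x \<bullet> x)"

definition sgn_L2_circle :: "L2_circle \<Rightarrow> L2_circle" where
  "sgn_L2_circle x = inverse (norm x) *\<^sub>R x"

definition dist_L2_circle :: "L2_circle \<Rightarrow> L2_circle \<Rightarrow> real" where
  "dist_L2_circle x y = norm (x - y)"

definition uniformity_L2_circle :: "(L2_circle \<times> L2_circle) filter" where
  "uniformity_L2_circle = (INF e\<in>{0 <..}. principal {(x, y). dist x y < e})"

definition open_L2_circle :: "L2_circle set \<Rightarrow> bool" where
  "open_L2_circle S = (\<forall>x\<in>S. \<forall>\<^sub>F (x', y) in uniformity. x' = x \<longrightarrow> y \<in> S)"

instance
proof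
  fix x y z :: L2_circle and r s :: real
  show "x + y + z = x + (y + z)"
    by transfer (auto simp: L2_rel_def add.assoc intro!: sq_integrable_add)
  show "x + y = y + x"
    by transfer (auto simp: L2_rel_def add.commute intro!: sq_integrable_add)
  show "0 + x = x" by transfer (auto simp: L2_rel_def)
  show "- x + x = 0" by transfer (auto simp: L2_rel_def sq_integrable_0)
  show "x - y = x + - y"
    by transfer (auto simp: L2_rel_def intro!: sq_integrable_diff)
  show "r *\<^sub>R (x + y) = r *\<^sub>R x + r *\<^sub>R y"
    by transfer (auto simp: L2_rel_def distrib_left
      intro!: sq_integrable_add sq_integrable_cmult)
  show "(r + s) *\<^sub>R x = r *\<^sub>R x + s *\<^sub>R x"
    by transfer (auto simp: L2_rel_def distrib_right
      intro!: sq_integrable_add sq_integrable_cmult)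
  show "r *\<^sub>R s *\<^sub>R x = (r * s) *\<^sub>R x"
    by transfer (auto simp: L2_rel_def mult.assoc intro: sq_integrable_cmult)
  show "1 *\<^sub>R x = x" by transfer (auto simp: L2_rel_def)
  show "dist x y = norm (x - y)" by (rule dist_L2_circle_def)
  show "sgn x = inverse (norm x) *\<^sub>R x" by (rule sgn_L2_circle_def)
  show "uniformity = (INF e\<in>{0 <..}. principal {(x, y :: L2_circle). dist x y < e})"
    by (rule uniformity_L2_circle_def)
  show "open S = (\<forall>x\<in>S. \<forall>\<^sub>F (x', y) in uniformity. x' = x \<longrightarrow> y \<in> S)" for S :: "L2_circle set"
    by (rule open_L2_circle_def)
  show "norm x = sqrt (x \<bullet> x)" by (rule norm_L2_circle_def)
  show "x \<bullet> y = y \<bullet> x" by transfer (simp add: inner_commute)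
  show "(x + y) \<bullet> z = x \<bullet> z + y \<bullet> z"
    by transfer (simp add: L2_rel_def inner_add_left sq_integrable_inner)
  show "r *\<^sub>R x \<bullet> y = r * (x \<bullet> y)"
    by transfer (simp flip: scaleR_conv_of_real)
  show "0 \<le> x \<bullet> x" by transfer simp
  show "(x \<bullet> x = 0) = (x = 0)"
  proof transfer
    fix f assume "L2_rel f f"
    then have "sq_integrable f" by (simp add: L2_rel_def)
    then have "((\<integral>t. f t \<bullet> f t \<partial>circle_measure) = 0) \<longleftrightarrow>
        (AE t in circle_measure. f t \<bullet> f t = 0)"
      by (intro integral_nonneg_eq_0_iff_AE sq_integrable_inner) auto
    with \<open>sq_integrable f\<close>
    show "((\<integral>t. f t \<bullet> f t \<partial>circle_measure) = 0) = L2_rel f (\<lambda>_. 0)"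
      by (simp add: L2_rel_def sq_integrable_0)
  qed
qed

end

instantiation L2_circle :: complex_normed_vector
begin

lift_definition scaleC_L2_circle :: "complex \<Rightarrow> L2_circle \<Rightarrow> L2_circle" is "\<lambda>c f t. c * f t"
  by (auto simp: L2_rel_def intro: sq_integrable_cmult)

instance
proof
  fix a b :: complex and r :: real and x y :: L2_circle
  show "a *\<^sub>C (x + y) = a *\<^sub>C x + a *\<^sub>C y"
    by transfer (auto simp: L2_rel_def distrib_left
      intro!: sq_integrable_add sq_integrable_cmult)
  show "(a + b) *\<^sub>C x = a *\<^sub>C x + b *\<^sub>C x"
    by transfer (auto simp: L2_rel_def distrib_right
      intro!: sq_integrable_add sq_integrable_cmult)
  show "a *\<^sub>C b *\<^sub>C x = (a * b) *\<^sub>C x"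
    by transfer (auto simp: L2_rel_def mult.assoc intro: sq_integrable_cmult)
  show "complex_of_real r *\<^sub>C x = r *\<^sub>R x"
    by transfer (auto simp: L2_rel_def intro: sq_integrable_cmult)
  have "(a *\<^sub>C x) \<bullet> (a *\<^sub>C x) = (cmod a)\<^sup>2 * (x \<bullet> x)"
    by transfer (simp add: dot_square_norm norm_mult power_mult_distrib)
  then show "norm (a *\<^sub>C x) = cmod a * norm x"
    by (simp add: norm_eq_sqrt_inner real_sqrt_mult)
qed

end

lift_definition mult_L2 :: "(complex \<Rightarrow> complex) \<Rightarrow> L2_circle \<Rightarrow> L2_circle"
  is "\<lambda>\<phi> f t. if \<phi> \<in> Linfty_circle then \<phi> t * f t else 0"
  subgoal for \<phi>
    by (cases "\<phi> \<in> Linfty_circle") (auto simp: L2_rel_def sq_integrable_mult sq_integrable_0)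
  done

text \<open>The value is \<open>0\<close> if \<open>\<phi>\<close> is not in \<open>L\<^sup>\<infinity>\<close>.\<close>

lift_definition mult_op :: "(complex \<Rightarrow> complex) \<Rightarrow> L2_circle \<Rightarrow>\<^sub>L L2_circle" is mult_L2
proof -
  fix \<phi> :: "complex \<Rightarrow> complex"
  show "bounded_linear (mult_L2 \<phi>)"
  proof (cases "\<phi> \<in> Linfty_circle")
    case False
    then have "mult_L2 \<phi> = (\<lambda>_. 0)"
      by (intro ext, transfer) (auto simp: L2_rel_def sq_integrable_0)
    then show ?thesis by simp
  next
    case True
    then obtain C where C: "AE t in circle_measure. cmod (\<phi> t) \<le> C"
      by (auto simp: Linfty_circle_def)
    have inner_le: "mult_L2 \<phi> x \<bullet> mult_L2 \<phi> x \<le> C\<^sup>2 * (x \<bullet> x)" for x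
      using True C
    proof transfer
      fix \<phi> :: "complex \<Rightarrow> complex" and C f
      assume *: "\<phi> \<in> Linfty_circle" "AE t in circle_measure. cmod (\<phi> t) \<le> C" "L2_rel f f"
      then have f: "sq_integrable f" by (simp add: L2_rel_def)
      have "(\<integral>t. (\<phi> t * f t) \<bullet> (\<phi> t * f t) \<partial>circle_measure)
          \<le> (\<integral>t. C\<^sup>2 * (f t \<bullet> f t) \<partial>circle_measure)"
      proof (rule integral_mono_AE)
        show "integrable circle_measure (\<lambda>t. (\<phi> t * f t) \<bullet> (\<phi> t * f t))"
          using sq_integrable_mult[OF *(1) f] by (intro sq_integrable_inner)
        show "integrable circle_measure (\<lambda>t. C\<^sup>2 * (f t \<bullet> f t))"
          using sq_integrable_inner[OF f f] by simp
        show "AE t in circle_measure. (\<phi> t * f t) \<bullet> (\<phi> t * f t) \<le> C\<^sup>2 * (f t \<bullet> f t)"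
          using *(2) by eventually_elim
            (auto simp: dot_square_norm norm_mult power_mult_distrib
              intro!: mult_right_mono power_mono)
      qed
      then show "(\<integral>t. (if \<phi> \<in> Linfty_circle then \<phi> t * f t else 0) \<bullet>
          (if \<phi> \<in> Linfty_circle then \<phi> t * f t else 0) \<partial>circle_measure)
          \<le> C\<^sup>2 * (\<integral>t. f t \<bullet> f t \<partial>circle_measure)"
        using *(1) by simp
    qed
    show ?thesis
    proof (rule bounded_linear_intro[where K = "\<bar>C\<bar>"])
      fix x y and r :: real
      show "mult_L2 \<phi> (x + y) = mult_L2 \<phi> x + mult_L2 \<phi> y"
        using True by transfer
          (auto simp: L2_rel_def distrib_left intro!: sq_integrable_add sq_integrable_mult)
      show "mult_L2 \<phi> (r *\<^sub>R x) = r *\<^sub>R mult_L2 \<phi> x"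
        using True by transfer
          (auto simp: L2_rel_def intro!: sq_integrable_cmult sq_integrable_mult)
      show "norm (mult_L2 \<phi> x) \<le> norm x * \<bar>C\<bar>"
        using real_sqrt_le_mono[OF inner_le[of x]]
        by (simp add: norm_eq_sqrt_inner real_sqrt_mult mult.commute)
    qed
  qed
qed

lemma poly_Linfty_circle: "poly p \<in> Linfty_circle"
proof -
  have sets: "sets circle_measure = sets (restrict_space borel (sphere 0 1))"
    by (simp add: circle_measure_def)
  have "poly p \<in> borel_measurable borel"
    by (intro borel_measurable_continuous_onI continuous_intros)
  then have "poly p \<in> borel_measurable circle_measure"
    using measurable_cong_sets[OF sets refl] measurable_restrict_space1 by blast
  moreover have "\<exists>C. \<forall>t\<in>sphere 0 1. cmod (poly p t) \<le> C"
  proof -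
    have "compact (poly p ` sphere 0 1)"
      by (intro compact_continuous_image continuous_intros compact_sphere)
    then show ?thesis by (meson bounded_iff compact_imp_bounded imageI)
  qed
  moreover have "space circle_measure = sphere 0 1"
    by (simp add: circle_measure_def space_restrict_space)
  ultimately show ?thesis by (auto simp: Linfty_circle_def intro!: AE_I2)
qed

abbreviation mult_poly :: "complex poly \<Rightarrow> L2_circle \<Rightarrow>\<^sub>L L2_circle" where
  "mult_poly p \<equiv> mult_op (poly p)"

definition CF_class :: "(complex \<Rightarrow> (L2_circle \<Rightarrow>\<^sub>L L2_circle)) set" where
  "CF_class = {P. \<exists>(p :: nat \<Rightarrow> complex poly) f.
     (\<forall>k\<ge>1. degree (p k) \<le> k) \<and>
     P = (\<lambda>z. z *\<^sub>C mult_poly (p 1) + z\<^sup>2 *\<^sub>C mult_poly (p 2)) \<and>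
     (\<forall>z\<in>unit_disc. clinear_op (f z)) \<and> vec_holomorphic_on f unit_disc \<and> f 0 = 0 \<and>
     (\<forall>k\<ge>1. inverse (fact k) *\<^sub>C (vec_cderiv ^^ k) f 0 = mult_poly (p k)) \<and>
     (\<forall>z\<in>unit_disc. norm (f z) \<le> 1)}"

text \<open>Vectors of \<open>H \<otimes> \<complex>\<^sup>n\<close> are functions \<open>nat \<Rightarrow> H\<close> of which only the entries with index \<open>< n\<close>
  matter; the norm is the Hilbert space direct sum norm. An operator on \<open>H \<otimes> \<complex>\<^sup>n\<close> is given by its
  blocks \<open>X i j\<close> with \<open>i, j < n\<close>, and \<open>block_onorm\<close> is its operator norm (compare \<open>onorm\<close>).\<close>

definition block_norm :: "nat \<Rightarrow> (nat \<Rightarrow> 'h :: real_normed_vector) \<Rightarrow> real" where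
  "block_norm n x = L2_set (\<lambda>i. norm (x i)) {..<n}"

definition block_apply ::
  "nat \<Rightarrow> (nat \<Rightarrow> nat \<Rightarrow> ('h :: real_normed_vector \<Rightarrow>\<^sub>L 'h)) \<Rightarrow> (nat \<Rightarrow> 'h) \<Rightarrow> nat \<Rightarrow> 'h" where
  "block_apply n X x i = (\<Sum>j<n. blinfun_apply (X i j) (x j))"

definition block_onorm :: "nat \<Rightarrow> (nat \<Rightarrow> nat \<Rightarrow> ('h :: real_normed_vector \<Rightarrow>\<^sub>L 'h)) \<Rightarrow> real" where
  "block_onorm n X = (SUP x. block_norm n (block_apply n X x) / block_norm n x)"

lemma bdd_above_block_onorm:
  "bdd_above (range (\<lambda>x. block_norm n (block_apply n X x) / block_norm n x))"
proof (rule bdd_aboveI2)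
  fix x :: "nat \<Rightarrow> 'a"
  let ?K = "\<Sum>i<n. \<Sum>j<n. norm (X i j)"
  have K: "0 \<le> ?K" by (intro sum_nonneg) auto
  have n0: "0 \<le> block_norm n x" by (simp add: block_norm_def)
  have "block_norm n (block_apply n X x) \<le> (\<Sum>i<n. norm (block_apply n X x i))"
    unfolding block_norm_def by (rule L2_set_le_sum) auto
  also have "\<dots> \<le> (\<Sum>i<n. \<Sum>j<n. norm (X i j) * block_norm n x)"
  proof (intro sum_mono)
    fix i
    have "norm (block_apply n X x i) \<le> (\<Sum>j<n. norm (blinfun_apply (X i j) (x j)))"
      unfolding block_apply_def by (rule norm_sum)
    also have "\<dots> \<le> (\<Sum>j<n. norm (X i j) * block_norm n x)"
    proof (intro sum_mono)
      fix j assume "j \<in> {..<n}"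
      then have "norm (x j) \<le> block_norm n x"
        unfolding block_norm_def by (intro member_le_L2_set) auto
      then have "norm (X i j) * norm (x j) \<le> norm (X i j) * block_norm n x"
        by (intro mult_left_mono) auto
      then show "norm (blinfun_apply (X i j) (x j)) \<le> norm (X i j) * block_norm n x"
        using norm_blinfun order_trans by blast
    qed
    finally show "norm (block_apply n X x i) \<le> (\<Sum>j<n. norm (X i j) * block_norm n x)" .
  qed
  also have "\<dots> = ?K * block_norm n x" by (simp add: sum_distrib_right)
  finally show "block_norm n (block_apply n X x) / block_norm n x \<le> ?K"
    using K n0 by (cases "block_norm n x = 0") (auto simp: divide_simps)
qed

text \<open>Rows, columns and list positions are counted from \<open>0\<close>, so the block in position \<open>(i, j)\<close>
  with \<open>i \<le> j\<close> is the entry number \<open>j - i + 1\<close> of \<open>[A\<^sub>1, \<dots>, A\<^sub>n]\<close>.\<close>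

definition toeplitz ::
  "('h :: real_normed_vector \<Rightarrow>\<^sub>L 'h) list \<Rightarrow> nat \<Rightarrow> nat \<Rightarrow> ('h \<Rightarrow>\<^sub>L 'h)" where
  "toeplitz As i j = (if i \<le> j then As ! (j - i) else 0)"

definition toeplitz_norm :: "('h :: real_normed_vector \<Rightarrow>\<^sub>L 'h) list \<Rightarrow> real" where
  "toeplitz_norm As = block_onorm (length As) (toeplitz As)"

text \<open>The list \<open>ps = [p\<^sub>1, \<dots>, p\<^sub>k]\<close> stands for the operator \<open>\<T>(M\<^sub>p\<^sub>1, \<dots>, M\<^sub>p\<^sub>k)\<close>; the
  requirement on the degrees covers the given polynomials and the new ones.\<close>

definition poly_extendible :: "nat \<Rightarrow> complex poly list \<Rightarrow> bool" where
  "poly_extendible m ps \<longleftrightarrow>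
     toeplitz_norm (map mult_poly ps) \<le> 1 \<and>
     (\<exists>qs. length (ps @ qs) = m \<and> (\<forall>l<m. degree ((ps @ qs) ! l) \<le> l + 1) \<and>
        toeplitz_norm (map mult_poly (ps @ qs)) \<le> 1)"

definition completely_poly_extendible :: "complex poly list \<Rightarrow> bool" where
  "completely_poly_extendible ps \<longleftrightarrow> (\<forall>m\<ge>length ps. poly_extendible m ps)"

end

theory Submission
  imports Defs "HOL-Complex_Analysis.Complex_Analysis"
begin

text \<open>All three conditions say that \<open>p\<^sub>1, p\<^sub>2\<close> extend to a sequence of polynomials \<open>p\<^sub>k\<close> of degree at
  most \<open>k\<close> such that for every \<open>t\<close> on the unit circle all finite sections of the scalar upper
  triangular Toeplitz matrix with symbol \<open>p\<^sub>1(t), p\<^sub>2(t), \<dots>\<close> are contractions, i.e. such that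
  \<open>\<bar>\<Sum>k\<ge>1. p\<^sub>k(t) z\<^sup>k\<bar> \<le> 1\<close> on the disc. A function on the bidisc is restricted to the discs
  \<open>z \<mapsto> (z, t z)\<close>, where its homogeneous expansion becomes \<open>\<Sum>k. p\<^sub>k(t) z\<^sup>k\<close>. Operator bounds give
  pointwise bounds through approximate eigenvectors of the multiplication operators, normalised
  indicator functions of arcs shrinking to \<open>t\<close>. That the higher derivatives of an operator-valued
  holomorphic function exist at all rests on the completeness of \<open>L\<^sup>2\<close>.\<close>

section \<open>Toeplitz contractions and bounded analytic functions\<close>

text \<open>Finite sections are the pivot because contractivity of a section of fixed size is a
  closed condition on finitely many coefficients. It survives every limit taken below: radii tending
  to 1, approximate eigenvectors, and extensions of growing length. The degree condition comes from
  the bidisc: the homogeneous part of degree k takes the value z^k p_k(t) at (z, t z), where p_k has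
  degree at most k, and every such polynomial arises in this way. The scalar criterion linking
  sections to the sup norm uses no boundary values: Parseval's identity on roots of unity is exact
  for polynomials, and power series are reached by truncation. Position 0 is the diagonal, so
  \<open>c k\<close> stands for p_(k+1)(t), and the function on the disc is z F(z) with F(z) the sum
  of \<open>c k * z ^ k\<close>. By Schwarz's lemma z F and F obey the same bound 1. One direction
  is multiplication by z; in the other the factor z is removed on circles of radius r < 1, where its
  modulus is constant.\<close>

definition toeplitz_contraction_upto :: "nat \<Rightarrow> (nat \<Rightarrow> complex) \<Rightarrow> bool" where
  "toeplitz_contraction_upto n c \<longleftrightarrow>
     (\<forall>x. (\<Sum>i<n. (cmod (\<Sum>j=i..<n. c (j - i) * x j))\<^sup>2) \<le> (\<Sum>j<n. (cmod (x j))\<^sup>2))"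

definition toeplitz_contraction :: "(nat \<Rightarrow> complex) \<Rightarrow> bool" where
  "toeplitz_contraction c \<longleftrightarrow> (\<forall>n. toeplitz_contraction_upto n c)"

lemma toeplitz_contractionD:
  "toeplitz_contraction c \<Longrightarrow>
     (\<Sum>i<n. (cmod (\<Sum>j=i..<n. c (j - i) * x j))\<^sup>2) \<le> (\<Sum>j<n. (cmod (x j))\<^sup>2)"
  unfolding toeplitz_contraction_def toeplitz_contraction_upto_def by blast

lemma toeplitz_contraction_upto_mono:
  assumes c: "toeplitz_contraction_upto n c" and m: "m \<le> n"
  shows "toeplitz_contraction_upto m c"
  unfolding toeplitz_contraction_upto_def
proof
  fix x :: "nat \<Rightarrow> complex"
  \<comment> \<open>Padding with zeros: the leading m by m block is a compression of the n by n
    section.\<close>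
  let ?x = "\<lambda>j. if j < m then x j else 0"
  have "(\<Sum>j=i..<m. c (j - i) * x j) = (\<Sum>j=i..<n. c (j - i) * ?x j)" for i
    using m by (intro sum.mono_neutral_cong_left) auto
  then have "(\<Sum>i<m. (cmod (\<Sum>j=i..<m. c (j - i) * x j))\<^sup>2)
      = (\<Sum>i<m. (cmod (\<Sum>j=i..<n. c (j - i) * ?x j))\<^sup>2)"
    by simp
  also have "\<dots> \<le> (\<Sum>i<n. (cmod (\<Sum>j=i..<n. c (j - i) * ?x j))\<^sup>2)"
    using m by (intro sum_mono2) auto
  also have "\<dots> \<le> (\<Sum>j<n. (cmod (?x j))\<^sup>2)"
    using c unfolding toeplitz_contraction_upto_def by (rule spec)
  also have "\<dots> = (\<Sum>j<m. (cmod (x j))\<^sup>2)"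
    using m by (intro sum.mono_neutral_cong_right) auto
  finally show "(\<Sum>i<m. (cmod (\<Sum>j=i..<m. c (j - i) * x j))\<^sup>2) \<le> (\<Sum>j<m. (cmod (x j))\<^sup>2)" .
qed

section \<open>Parseval's identity on roots of unity and coefficient estimates\<close>

lemma sum_roots_of_unity:
  assumes "k < M" "l < M"
  shows "(\<Sum>m<M. cis (2 * pi * real m / real M) ^ k * cnj (cis (2 * pi * real m / real M) ^ l)) = (if k = l then of_nat M else 0)"
proof -
  \<comment> \<open>The summands are the powers of one M-th root of unity. It differs from 1 for k
    \<noteq> l, because |k - l| < M rules out divisibility by M, and then the geometric sum
    vanishes.\<close>
  define \<rho> where "\<rho> = cis (2 * pi * (real k - real l) / M)"
  have M: "M > 0" using assms by auto
  have eq: "cis (2 * pi * real m / real M) ^ k * cnj (cis (2 * pi * real m / real M) ^ l) = \<rho> ^ m" for m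
  proof -
    have "real k * (2 * pi * real m / M) + - (real l * (2 * pi * real m / M)) = real m * (2 * pi * (real k - real l) / M)"
      by (simp add: field_simps diff_divide_distrib)
    then show ?thesis by (simp only: \<rho>_def Complex.DeMoivre cis_cnj cis_mult)
  qed
  show ?thesis
  proof (cases "k = l")
    case True
    have "\<rho> = 1" using True by (simp add: \<rho>_def)
    then show ?thesis unfolding eq using True by simp
  next
    case False
    have "\<rho> \<noteq> 1"
    proof
      assume "\<rho> = 1"
      then have "cos (2 * pi * (real k - real l) / M) = 1"
        by (auto simp: \<rho>_def complex_eq_iff)
      then obtain n :: int where "2 * pi * (real k - real l) / M = n * 2 * pi"
        by (auto simp: cos_one_2pi_int)
      then have "(2 * pi) * (real k - real l) = (2 * pi) * (n * M)" using M by (simp add: field_simps)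
      then have "real k - real l = n * M" by (subst (asm) mult_left_cancel) auto
      then have "real_of_int (int k - int l) = real_of_int (n * int M)" by simp
      then have "int k - int l = n * int M" by (simp only: of_int_eq_iff)
      moreover have "\<bar>int k - int l\<bar> < int M" using assms by auto
      ultimately have "n = 0"
        using M by (auto simp: abs_mult)
      with \<open>int k - int l = n * int M\<close> False show False by simp
    qed
    moreover have "\<rho> ^ M = 1"
    proof -
      have "real M * (2 * pi * (real k - real l) / M) = 2 * pi * of_int (int k - int l)"
        using M by simp
      then have "\<rho> ^ M = cis (2 * pi * of_int (int k - int l))"
        by (simp only: \<rho>_def Complex.DeMoivre)
      then show ?thesis by (simp only: cis_multiple_2pi Ints_of_int)
    qed
    ultimately show ?thesis
      using False by (simp only: eq) (simp add: geometric_sum)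
  qed
qed

text \<open>Orthogonality of the powers on M equidistant points. Because the degree is below M, the
  discrete mean is exactly the L^2 norm on the circle, so no integration is involved.\<close>

lemma discrete_Parseval:
  assumes "degree p < M"
  shows "(\<Sum>m<M. (cmod (poly p (cis (2 * pi * real m / real M))))\<^sup>2) = M * (\<Sum>k<M. (cmod (coeff p k))\<^sup>2)"
proof -
  let ?w = "\<lambda>m. cis (2 * pi * real m / real M)"
  have "poly p x = (\<Sum>k<M. coeff p k * x ^ k)" for x
    unfolding poly_altdef using assms
    by (intro sum.mono_neutral_left) (auto simp: coeff_eq_0)
  then have "complex_of_real ((cmod (poly p (?w m)))\<^sup>2) =
      (\<Sum>k<M. \<Sum>l<M. (coeff p k * cnj (coeff p l)) * (?w m ^ k * cnj (?w m ^ l)))" for m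
    by (simp add: complex_norm_square sum_product mult_ac del: cis_cnj of_real_power)
  then have "complex_of_real (\<Sum>m<M. (cmod (poly p (?w m)))\<^sup>2) =
      (\<Sum>m<M. \<Sum>k<M. \<Sum>l<M. (coeff p k * cnj (coeff p l)) * (?w m ^ k * cnj (?w m ^ l)))"
    by (simp only: of_real_sum)
  also have "\<dots> = (\<Sum>k<M. \<Sum>m<M. \<Sum>l<M. (coeff p k * cnj (coeff p l)) * (?w m ^ k * cnj (?w m ^ l)))"
    by (rule sum.swap)
  also have "\<dots> = (\<Sum>k<M. \<Sum>l<M. \<Sum>m<M. (coeff p k * cnj (coeff p l)) * (?w m ^ k * cnj (?w m ^ l)))"
    by (intro sum.cong refl sum.swap)
  also have "\<dots> = (\<Sum>k<M. \<Sum>l<M. (coeff p k * cnj (coeff p l)) * (if k = l then of_nat M else 0))"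
    by (simp only: flip: sum_distrib_left) (intro sum.cong refl, subst sum_roots_of_unity, auto)
  also have "\<dots> = (\<Sum>k<M. (coeff p k * cnj (coeff p k)) * of_nat M)"
    by (intro sum.cong refl) (simp add: if_distrib[of "\<lambda>x. _ * x"] cong: if_cong)
  also have "\<dots> = complex_of_real (M * (\<Sum>k<M. (cmod (coeff p k))\<^sup>2))"
    by (simp add: sum_distrib_left complex_norm_square mult_ac flip: complex_norm_square)
  finally show ?thesis by (simp only: of_real_eq_iff)
qed

text \<open>Multiplication by q is bounded in the l^2 norm of coefficients by the sup of |q| on the
  circle: by Parseval both sides become sums over roots of unity, where the estimate is
  pointwise.\<close>

lemma coeff_mult_sq_sum_le:
  fixes q p :: "complex poly"
  assumes "\<And>z. cmod z = 1 \<Longrightarrow> cmod (poly q z) \<le> C" "degree p < n"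
  shows "(\<Sum>k<N. (cmod (coeff (q * p) k))\<^sup>2) \<le> C\<^sup>2 * (\<Sum>k<n. (cmod (coeff p k))\<^sup>2)"
proof -
  \<comment> \<open>Large enough for Parseval to be exact for both \<open>q * p\<close> and
    \<open>p\<close>, and for the sums up to N and n to be covered.\<close>
  define M where "M = Suc (degree (q * p) + degree p + N + n)"
  let ?w = "\<lambda>m. cis (2 * pi * real m / real M)"
  have "M * (\<Sum>k<M. (cmod (coeff (q * p) k))\<^sup>2) = (\<Sum>m<M. (cmod (poly (q * p) (?w m)))\<^sup>2)"
    by (rule discrete_Parseval[symmetric]) (simp add: M_def)
  also have "\<dots> \<le> (\<Sum>m<M. C\<^sup>2 * (cmod (poly p (?w m)))\<^sup>2)"
    by (intro sum_mono) (auto simp: norm_mult power_mult_distrib intro!: mult_right_mono power_mono assms)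
  also have "\<dots> = C\<^sup>2 * (M * (\<Sum>k<M. (cmod (coeff p k))\<^sup>2))"
    by (subst discrete_Parseval[symmetric]) (simp_all add: M_def flip: sum_distrib_left)
  finally have "real M * (\<Sum>k<M. (cmod (coeff (q * p) k))\<^sup>2) \<le> real M * (C\<^sup>2 * (\<Sum>k<M. (cmod (coeff p k))\<^sup>2))"
    by (simp add: mult_ac)
  then have "(\<Sum>k<M. (cmod (coeff (q * p) k))\<^sup>2) \<le> C\<^sup>2 * (\<Sum>k<M. (cmod (coeff p k))\<^sup>2)"
    by (rule mult_left_le_imp_le) (simp add: M_def)
  moreover have "(\<Sum>k<N. (cmod (coeff (q * p) k))\<^sup>2) \<le> (\<Sum>k<M. (cmod (coeff (q * p) k))\<^sup>2)"
    by (intro sum_mono2) (auto simp: M_def)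
  moreover have "(\<Sum>k<n. (cmod (coeff p k))\<^sup>2) = (\<Sum>k<M. (cmod (coeff p k))\<^sup>2)"
    using assms(2) by (intro sum.mono_neutral_left) (auto simp: M_def coeff_eq_0)
  ultimately show ?thesis by simp
qed

lemma coeff_le_sup_circle:
  fixes q :: "complex poly"
  assumes "\<And>z. cmod z = 1 \<Longrightarrow> cmod (poly q z) \<le> C"
  shows "cmod (coeff q k) \<le> C"
proof -
  have C: "0 \<le> C" using order_trans[OF norm_ge_zero assms[of 1]] by simp
  have "(\<Sum>l<Suc k. (cmod (coeff (q * 1) l))\<^sup>2) \<le> C\<^sup>2 * (\<Sum>l<1. (cmod (coeff 1 l))\<^sup>2)"
    by (rule coeff_mult_sq_sum_le) (auto intro: assms)
  moreover have "(cmod (coeff q k))\<^sup>2 \<le> (\<Sum>l<Suc k. (cmod (coeff q l))\<^sup>2)"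
    by (intro member_le_sum) auto
  ultimately have "(cmod (coeff q k))\<^sup>2 \<le> C\<^sup>2" by simp
  then show ?thesis using C by (simp add: power2_le_iff_abs_le)
qed

lemma toeplitz_contraction_upto_bound:
  assumes n: "toeplitz_contraction_upto n c" and k: "k < n"
  shows "cmod (c k) \<le> 1"
proof -
  \<comment> \<open>On the k-th unit vector, row 0 of the section of size k + 1 returns
    \<open>c k\<close>.\<close>
  let ?x = "\<lambda>j. if j = k then 1 else 0 :: complex"
  have "(cmod (\<Sum>j=0..<Suc k. c (j - 0) * ?x j))\<^sup>2
      \<le> (\<Sum>i<Suc k. (cmod (\<Sum>j=i..<Suc k. c (j - i) * ?x j))\<^sup>2)"
    by (intro member_le_sum[of 0 _ "\<lambda>i. (cmod (\<Sum>j=i..<Suc k. c (j - i) * ?x j))\<^sup>2"]) auto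
  also have "\<dots> \<le> (\<Sum>j<Suc k. (cmod (?x j))\<^sup>2)"
    using toeplitz_contraction_upto_mono[OF n Suc_leI[OF k]]
    unfolding toeplitz_contraction_upto_def by (rule spec)
  also have "\<dots> = (\<Sum>j<Suc k. if j = k then 1 else 0)"
    by (intro sum.cong) auto
  also have "\<dots> = 1" by simp
  also have "(\<Sum>j=0..<Suc k. c (j - 0) * ?x j) = c k"
    by (simp add: if_distrib[of "\<lambda>x. _ * x"] cong: if_cong)
  finally show ?thesis by (simp add: power_le_one_iff abs_square_le_1)
qed

lemma toeplitz_contraction_bound:
  "toeplitz_contraction c \<Longrightarrow> cmod (c k) \<le> 1"
  using toeplitz_contraction_upto_bound[of "Suc k" c k] by (simp add: toeplitz_contraction_def)

section \<open>Contractive Toeplitz sections versus power series bounded by 1\<close>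

lemma summable_bounded_powser:
  fixes c :: "nat \<Rightarrow> complex"
  assumes "\<And>k. cmod (c k) \<le> B" "cmod z < 1"
  shows "summable (\<lambda>k. cmod (c k * z ^ k))"
proof (rule summable_comparison_test')
  show "summable (\<lambda>k. B * cmod z ^ k)" using assms by (intro summable_mult summable_geometric) auto
  show "norm (cmod (c k * z ^ k)) \<le> B * cmod z ^ k" for k
    using assms by (auto simp: norm_mult norm_power intro!: mult_right_mono)
qed

lemma sum_sq_norm_power_le:
  assumes "cmod z < 1"
  shows "(\<Sum>j<n. (cmod (z ^ j))\<^sup>2) \<le> 1 / (1 - (cmod z)\<^sup>2)"
proof -
  have q: "(cmod z)\<^sup>2 < 1" using assms by (simp add: power_less_one_iff abs_square_less_1)
  have "(\<Sum>j<n. (cmod (z ^ j))\<^sup>2) = (\<Sum>j<n. ((cmod z)\<^sup>2) ^ j)"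
    by (simp add: norm_power power_mult[symmetric] mult.commute)
  also have "\<dots> \<le> (\<Sum>j. ((cmod z)\<^sup>2) ^ j)"
    using q by (intro sum_le_suminf summable_geometric) auto
  also have "\<dots> = 1 / (1 - (cmod z)\<^sup>2)" using q by (intro suminf_geometric) auto
  finally show ?thesis .
qed

text \<open>Testing the contraction on the geometric vectors \<open>x\<^sub>j = z\<^sup>j\<close>, which are asymptotically
  eigenvectors with eigenvalue \<open>\<Sum>k. c\<^sub>k z\<^sup>k\<close>.\<close>

lemma toeplitz_contraction_imp_Schur:
  assumes c: "toeplitz_contraction c" and z: "cmod z < 1"
  shows "cmod (\<Sum>k. c k * z ^ k) \<le> 1"
proof -
  define F where "F = (\<Sum>k. c k * z ^ k)"
  define S where "S = (\<lambda>n. \<Sum>k<n. c k * z ^ k)"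
  let ?q = "(cmod z)\<^sup>2"
  have q: "?q < 1" using z by (simp add: abs_square_less_1)
  have "summable (\<lambda>k. c k * z ^ k)"
    using summable_bounded_powser[OF toeplitz_contraction_bound[OF c] z] by (rule summable_norm_cancel)
  then have S: "S \<longlonglongrightarrow> F" unfolding S_def F_def by (rule summable_LIMSEQ)
  have "(\<Sum>i<n. (cmod (z ^ i))\<^sup>2 * (cmod (S (n - i)))\<^sup>2) \<le> 1 / (1 - ?q)" for n
  proof -
    have "(\<Sum>j=i..<n. c (j - i) * z ^ j) = z ^ i * S (n - i)" for i
    proof (cases "i \<le> n")
      case True
      then have "(\<Sum>j=i..<n. c (j - i) * z ^ j) = (\<Sum>k=0..<n-i. c (k + i - i) * z ^ (k + i))"
        using sum.shift_bounds_nat_ivl[of "\<lambda>j. c (j - i) * z ^ j" 0 i "n - i"] by simp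
      also have "\<dots> = z ^ i * S (n - i)"
        by (simp add: S_def sum_distrib_left power_add mult_ac atLeast0LessThan)
      finally show ?thesis .
    qed (simp add: S_def)
    then have "(\<Sum>i<n. (cmod (z ^ i))\<^sup>2 * (cmod (S (n - i)))\<^sup>2)
        = (\<Sum>i<n. (cmod (\<Sum>j=i..<n. c (j - i) * z ^ j))\<^sup>2)"
      by (simp add: norm_mult power_mult_distrib)
    also have "\<dots> \<le> (\<Sum>j<n. (cmod (z ^ j))\<^sup>2)"
      by (rule toeplitz_contractionD[OF c])
    also have "\<dots> \<le> 1 / (1 - ?q)" by (rule sum_sq_norm_power_le[OF z])
    finally show ?thesis .
  qed note * = this
  \<comment> \<open>The first N rows are kept while n tends to infinity, so that each
    \<open>S (n - i)\<close> tends to F. Only afterwards does N grow; the left side then contains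
    the full factor 1 / (1 - |z|^2), which cancels.\<close>
  have "(\<Sum>i<N. (cmod (z ^ i))\<^sup>2 * (cmod F)\<^sup>2) \<le> 1 / (1 - ?q)" for N
  proof (rule tendsto_upperbound)
    show "(\<lambda>n. \<Sum>i<N. (cmod (z ^ i))\<^sup>2 * (cmod (S (n - i)))\<^sup>2)
        \<longlonglongrightarrow> (\<Sum>i<N. (cmod (z ^ i))\<^sup>2 * (cmod F)\<^sup>2)"
      by (intro tendsto_intros filterlim_compose[OF S] filterlim_minus_const_nat_at_top)
    show "\<forall>\<^sub>F n in sequentially. (\<Sum>i<N. (cmod (z ^ i))\<^sup>2 * (cmod (S (n - i)))\<^sup>2) \<le> 1 / (1 - ?q)"
      using eventually_ge_at_top[of N]
    proof eventually_elim
      case (elim n)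
      have "(\<Sum>i<N. (cmod (z ^ i))\<^sup>2 * (cmod (S (n - i)))\<^sup>2)
          \<le> (\<Sum>i<n. (cmod (z ^ i))\<^sup>2 * (cmod (S (n - i)))\<^sup>2)"
        using elim by (intro sum_mono2) auto
      with *[of n] show ?case by simp
    qed
  qed auto
  then have "(\<Sum>i<N. ?q ^ i * (cmod F)\<^sup>2) \<le> 1 / (1 - ?q)" for N
    by (simp add: norm_power power_mult[symmetric] mult.commute)
  moreover have "(\<lambda>N. \<Sum>i<N. ?q ^ i * (cmod F)\<^sup>2) \<longlonglongrightarrow> 1 / (1 - ?q) * (cmod F)\<^sup>2"
    using sums_mult2[OF geometric_sums[of ?q]] q by (simp add: sums_def)
  ultimately have "1 / (1 - ?q) * (cmod F)\<^sup>2 \<le> 1 / (1 - ?q)"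
    by (intro tendsto_upperbound[OF _ always_eventually]) auto
  then have "(cmod F)\<^sup>2 \<le> 1" using q by (simp add: divide_simps)
  then show ?thesis by (simp add: F_def abs_square_le_1)
qed

text \<open>For fixed n the inequality involves only \<open>c m 0\<close>, ...,
  \<open>c m (n - 1)\<close> and is preserved by convergence of these. The form with eventually
  admits sequences that are contractive only up to a size growing with m, as finite extensions
  are.\<close>

lemma toeplitz_contraction_limit:
  assumes "\<And>n. \<forall>\<^sub>F m in sequentially. toeplitz_contraction_upto n (c m)" "\<And>k. (\<lambda>m. c m k) \<longlonglongrightarrow> d k"
  shows "toeplitz_contraction d"
  unfolding toeplitz_contraction_def toeplitz_contraction_upto_def
proof (intro allI)
  fix n :: nat and x :: "nat \<Rightarrow> complex"
  have "(\<lambda>m. \<Sum>i<n. (cmod (\<Sum>j=i..<n. c m (j - i) * x j))\<^sup>2)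
      \<longlonglongrightarrow> (\<Sum>i<n. (cmod (\<Sum>j=i..<n. d (j - i) * x j))\<^sup>2)"
    by (intro tendsto_intros assms)
  moreover have "\<forall>\<^sub>F m in sequentially. (\<Sum>i<n. (cmod (\<Sum>j=i..<n. c m (j - i) * x j))\<^sup>2) \<le> (\<Sum>j<n. (cmod (x j))\<^sup>2)"
    using assms(1)[of n] by eventually_elim (simp add: toeplitz_contraction_upto_def)
  ultimately show "(\<Sum>i<n. (cmod (\<Sum>j=i..<n. d (j - i) * x j))\<^sup>2) \<le> (\<Sum>j<n. (cmod (x j))\<^sup>2)"
    by (rule tendsto_upperbound) simp
qed

text \<open>Truncation may push the modulus above 1, but by no more than the tail, which a geometric
  series controls and which vanishes as K grows.\<close>

lemma Schur_partial_sum_le: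
  fixes c :: "nat \<Rightarrow> complex"
  assumes B: "\<And>k. cmod (c k) \<le> B" and z: "cmod z < 1"
    and le1: "cmod (\<Sum>k. c k * z ^ Suc k) \<le> 1"
  shows "cmod (\<Sum>k<K. c k * z ^ Suc k) \<le> 1 + B * cmod z ^ Suc K / (1 - cmod z)"
proof -
  let ?t = "\<lambda>k. c k * z ^ Suc k"
  have sm: "summable (\<lambda>k. cmod (?t k))"
    using summable_mult[OF summable_bounded_powser[of c B z, OF B z], of "cmod z"]
    by (simp add: norm_mult norm_power mult_ac)
  have le: "cmod (?t (k + K)) \<le> B * cmod z ^ Suc K * cmod z ^ k" for k
    using mult_right_mono[OF B[of "k + K"], of "cmod z ^ Suc K * cmod z ^ k"]
    by (simp add: norm_mult norm_power power_add mult_ac)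
  have sg: "summable (\<lambda>k. B * cmod z ^ Suc K * cmod z ^ k)"
    using z by (intro summable_mult summable_geometric) auto
  have "(\<Sum>k. ?t k) = (\<Sum>k. ?t (k + K)) + (\<Sum>k<K. ?t k)"
    by (rule suminf_split_initial_segment[OF summable_norm_cancel[OF sm]])
  then have "(\<Sum>k<K. ?t k) = (\<Sum>k. ?t k) - (\<Sum>k. ?t (k + K))"
    by (simp only: eq_diff_eq add.commute)
  then have "cmod (\<Sum>k<K. ?t k) \<le> cmod (\<Sum>k. ?t k) + cmod (\<Sum>k. ?t (k + K))"
    by (simp only: norm_triangle_ineq4)
  also have "\<dots> \<le> 1 + (\<Sum>k. B * cmod z ^ Suc K * cmod z ^ k)"
    by (intro add_mono le1 norm_suminf_le[OF le sg])
  also have "(\<Sum>k. B * cmod z ^ Suc K * cmod z ^ k) = B * cmod z ^ Suc K / (1 - cmod z)"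
    using z by (subst suminf_mult) (auto simp: suminf_geometric intro!: summable_geometric)
  finally show ?thesis .
qed

text \<open>The Toeplitz section acts as multiplication of polynomials, truncated to low order
  coefficients, so \<open>coeff_mult_sq_sum_le\<close> bounds it by the sup of the truncated symbol
  \<open>Q K\<close> on the circle. That sup is at most 1 up to a tail, and K tends to
  infinity.\<close>

lemma Schur_imp_toeplitz_contraction_radius:
  fixes c :: "nat \<Rightarrow> complex"
  assumes B: "\<And>k. cmod (c k) \<le> B" and r: "0 < r" "r < 1"
    and le1: "\<And>z. cmod z < 1 \<Longrightarrow> cmod (\<Sum>k. c k * z ^ Suc k) \<le> 1"
  shows "toeplitz_contraction (\<lambda>k. c k * of_real r ^ Suc k)"
  unfolding toeplitz_contraction_def toeplitz_contraction_upto_def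
proof (intro allI)
  fix n :: nat and x :: "nat \<Rightarrow> complex"
  \<comment> \<open>The exponent k + 1 comes from evaluating the bounded series at r z: one factor r
    stays in the weights, and the remaining factor z has modulus 1 on the unit circle.\<close>
  define a where "a = (\<lambda>k. c k * complex_of_real r ^ Suc k)"
  define Q where "Q = (\<lambda>K. \<Sum>k<K. monom (a k) k)"
  \<comment> \<open>Reversing x turns upper triangular into convolution: entry i of the Toeplitz
    product becomes coefficient n - 1 - i of \<open>Q K * X\<close>, once K \<ge> n.\<close>
  define X where "X = (\<Sum>j<n. monom (x (n - Suc j)) j)"
  define tail where "tail = (\<lambda>K. B * r ^ Suc K / (1 - r))"
  have cQ: "coeff (Q K) k = (if k < K then a k else 0)" for K k
    by (simp add: Q_def coeff_sum coeff_monom if_distrib cong: if_cong)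
  have cX: "coeff X j = (if j < n then x (n - Suc j) else 0)" for j
    by (simp add: X_def coeff_sum coeff_monom if_distrib cong: if_cong)
  have Qle: "cmod (poly (Q K) z) \<le> 1 + tail K" if z: "cmod z = 1" for z K
  proof -
    have rz: "cmod (of_real r * z) = r" using r z by (simp add: norm_mult)
    have "(\<Sum>k<K. c k * (of_real r * z) ^ Suc k) = z * poly (Q K) z"
      by (simp add: Q_def a_def poly_sum poly_monom sum_distrib_left power_mult_distrib mult_ac)
    then have "cmod (z * poly (Q K) z) \<le> 1 + tail K"
      using Schur_partial_sum_le[OF B _ le1, of "of_real r * z" K] r(2)
      by (simp add: rz tail_def del: power_Suc)
    then show ?thesis using z by (simp add: norm_mult)
  qed
  have "(\<Sum>i<n. (cmod (\<Sum>j=i..<n. a (j - i) * x j))\<^sup>2) \<le> (1 + tail K)\<^sup>2 * (\<Sum>j<n. (cmod (x j))\<^sup>2)"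
    if K: "K \<ge> n" for K
  proof (cases "n = 0")
    case False
    have "coeff (Q K * X) (n - Suc i) = (\<Sum>j=i..<n. a (j - i) * x j)" if "i < n" for i
    proof -
      have "coeff (Q K * X) (n - Suc i) = (\<Sum>l\<le>n - Suc i. a l * x (l + i))"
        unfolding coeff_mult using that K by (intro sum.cong) (auto simp: cQ cX add.commute)
      also have "\<dots> = (\<Sum>j=i..n - 1. a (j - i) * x j)"
        using sum.shift_bounds_cl_nat_ivl[of "\<lambda>j. a (j - i) * x j" 0 i "n - Suc i"] that
        by (simp add: atLeast0AtMost)
      also have "{i..n - 1} = {i..<n}" using that by auto
      finally show ?thesis .
    qed
    then have "(\<Sum>i<n. (cmod (\<Sum>j=i..<n. a (j - i) * x j))\<^sup>2)
        = (\<Sum>i<n. (cmod (coeff (Q K * X) (n - Suc i)))\<^sup>2)"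
      by simp
    also have "\<dots> = (\<Sum>k<n. (cmod (coeff (Q K * X) k))\<^sup>2)"
      by (rule sum.nat_diff_reindex)
    also have "\<dots> \<le> (1 + tail K)\<^sup>2 * (\<Sum>k<n. (cmod (coeff X k))\<^sup>2)"
    proof (rule coeff_mult_sq_sum_le[OF Qle])
      have "degree X \<le> n - 1" by (rule degree_le) (auto simp: cX)
      then show "degree X < n" using False by simp
    qed
    also have "(\<Sum>k<n. (cmod (coeff X k))\<^sup>2) = (\<Sum>k<n. (cmod (x (n - Suc k)))\<^sup>2)"
      by (intro sum.cong) (auto simp: cX)
    also have "\<dots> = (\<Sum>k<n. (cmod (x k))\<^sup>2)"
      by (rule sum.nat_diff_reindex)
    finally show ?thesis .
  qed simp
  moreover have "(\<lambda>K. (1 + tail K)\<^sup>2 * (\<Sum>j<n. (cmod (x j))\<^sup>2)) \<longlonglongrightarrow> (1 + B * 0 / (1 - r))\<^sup>2 * (\<Sum>j<n. (cmod (x j))\<^sup>2)"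
    unfolding tail_def using r
    by (intro tendsto_intros LIMSEQ_power_zero[THEN LIMSEQ_Suc]) auto
  ultimately have "(\<Sum>i<n. (cmod (\<Sum>j=i..<n. a (j - i) * x j))\<^sup>2) \<le> (1 + B * 0 / (1 - r))\<^sup>2 * (\<Sum>j<n. (cmod (x j))\<^sup>2)"
    by (intro tendsto_lowerbound[where F = sequentially]) (auto simp: eventually_at_top_linorder)
  then show "(\<Sum>i<n. (cmod (\<Sum>j=i..<n. c (j - i) * of_real r ^ Suc (j - i) * x j))\<^sup>2) \<le> (\<Sum>j<n. (cmod (x j))\<^sup>2)"
    by (simp add: a_def)
qed

text \<open>The weights r^(k+1) tend to 1 along r = 1 - 1/(m + 2), and contractivity passes to the
  coefficientwise limit.\<close>

lemma Schur_imp_toeplitz_contraction: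
  fixes c :: "nat \<Rightarrow> complex"
  assumes "\<And>k. cmod (c k) \<le> B" "\<And>z. cmod z < 1 \<Longrightarrow> cmod (\<Sum>k. c k * z ^ Suc k) \<le> 1"
  shows "toeplitz_contraction c"
proof (rule toeplitz_contraction_limit)
  define r where "r = (\<lambda>m. 1 - 1 / real (Suc (Suc m)))"
  have "toeplitz_contraction (\<lambda>k. c k * of_real (r m) ^ Suc k)" for m
    by (rule Schur_imp_toeplitz_contraction_radius[OF assms(1) _ _ assms(2)]) (auto simp: r_def)
  then show "\<forall>\<^sub>F m in sequentially. toeplitz_contraction_upto n (\<lambda>k. c k * of_real (r m) ^ Suc k)" for n
    by (simp add: toeplitz_contraction_def)
  have "r \<longlonglongrightarrow> 1 - 0"
    unfolding r_def by (intro tendsto_diff tendsto_const LIMSEQ_Suc[OF LIMSEQ_Suc[OF lim_1_over_n]])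
  then have "(\<lambda>m. c k * of_real (r m) ^ Suc k) \<longlonglongrightarrow> c k * of_real (1 - 0) ^ Suc k" for k
    by (intro tendsto_intros)
  then show "(\<lambda>m. c k * of_real (r m) ^ Suc k) \<longlonglongrightarrow> c k" for k by simp
qed

section \<open>Completeness of the Hilbert space on the circle\<close>

lemma space_circle_measure: "space circle_measure = sphere 0 1"
  by (simp add: circle_measure_def space_restrict_space)

lemma sets_circle_measure: "sets circle_measure = sets (restrict_space borel (sphere 0 1))"
  by (simp add: circle_measure_def)

lemma finite_measure_circle_measure: "finite_measure circle_measure"
  by (rule finite_measureI) (simp add: space_circle_measure emeasure_circle_measure)

lemma L2_rel_refl: "L2_rel f f \<longleftrightarrow> sq_integrable f"
  by (simp add: L2_rel_def)

lemma L2_circle_cases: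
  obtains f where "sq_integrable f" "x = abs_L2_circle f"
proof
  show "sq_integrable (rep_L2_circle x)"
    using Quotient_rep_reflp[OF Quotient_L2_circle, of x] by (simp add: L2_rel_refl)
  show "x = abs_L2_circle (rep_L2_circle x)"
    by (rule Quotient_abs_rep[OF Quotient_L2_circle, symmetric])
qed

lemma power2_norm_abs_L2_circle:
  assumes "sq_integrable f"
  shows "(norm (abs_L2_circle f))\<^sup>2 = (\<integral>t. (cmod (f t))\<^sup>2 \<partial>circle_measure)"
proof -
  have "(norm (abs_L2_circle f))\<^sup>2 = abs_L2_circle f \<bullet> abs_L2_circle f"
    by (rule power2_norm_eq_inner)
  also have "\<dots> = (\<integral>t. f t \<bullet> f t \<partial>circle_measure)"
    using assms by (intro inner_L2_circle.abs_eq) (auto simp only: L2_rel_refl)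
  finally show ?thesis by (simp only: power2_norm_eq_inner)
qed

lemma abs_L2_circle_diff:
  "sq_integrable f \<Longrightarrow> sq_integrable g \<Longrightarrow>
     abs_L2_circle f - abs_L2_circle g = abs_L2_circle (\<lambda>t. f t - g t)"
  by (simp add: minus_L2_circle.abs_eq L2_rel_refl)

lemma abs_L2_circle_scaleC:
  "sq_integrable f \<Longrightarrow> c *\<^sub>C abs_L2_circle f = abs_L2_circle (\<lambda>t. c * f t)"
  by (simp add: scaleC_L2_circle.abs_eq L2_rel_refl)

lemma sq_integrable_sum:
  "finite I \<Longrightarrow> (\<And>i. i \<in> I \<Longrightarrow> sq_integrable (f i)) \<Longrightarrow> sq_integrable (\<lambda>t. \<Sum>i\<in>I. f i t)"
  by (induction I rule: finite_induct) (auto intro: sq_integrable_0 sq_integrable_add)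

lemma abs_L2_circle_sum:
  "finite I \<Longrightarrow> (\<And>i. i \<in> I \<Longrightarrow> sq_integrable (f i)) \<Longrightarrow>
     (\<Sum>i\<in>I. abs_L2_circle (f i)) = abs_L2_circle (\<lambda>t. \<Sum>i\<in>I. f i t)"
  by (induction I rule: finite_induct)
    (auto simp: zero_L2_circle_def plus_L2_circle.abs_eq L2_rel_refl sq_integrable_sum)

lemma mult_op_abs_L2_circle:
  "\<phi> \<in> Linfty_circle \<Longrightarrow> sq_integrable f \<Longrightarrow>
     mult_op \<phi> (abs_L2_circle f) = abs_L2_circle (\<lambda>t. \<phi> t * f t)"
  by (simp add: mult_op.rep_eq mult_L2.abs_eq L2_rel_refl)

text \<open>The total mass is finite, so fast decay of the increments in L^2 gives summability in
  L^1. Hence the sum of the moduli of the increments is integrable and finite almost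
  everywhere.\<close>

lemma AE_convergent_of_fast_L2_Cauchy:
  fixes f :: "nat \<Rightarrow> complex \<Rightarrow> complex"
  assumes f: "\<And>k. sq_integrable (f k)"
    and fast: "\<And>k. (\<integral>t. (cmod (f (Suc k) t - f k t))\<^sup>2 \<partial>circle_measure) \<le> ((1/4) ^ k)\<^sup>2"
  shows "AE t in circle_measure. convergent (\<lambda>k. f k t)"
proof -
  interpret finite_measure circle_measure by (rule finite_measure_circle_measure)
  define g where "g = (\<lambda>k t. f (Suc k) t - f k t)"
  have g: "sq_integrable (g k)" for k
    unfolding g_def by (intro sq_integrable_diff f)
  have gm [measurable]: "g k \<in> borel_measurable circle_measure" for k
    using g[of k] by (simp add: sq_integrable_def)
  have le: "(\<integral>\<^sup>+t. ennreal (cmod (g k t)) \<partial>circle_measure) \<le> ennreal ((1/4) ^ k)" for k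
  proof -
    \<comment> \<open>The arithmetic-geometric mean inequality for 2^k |g| and 2^(-k). With these
      weights both terms contribute at most (1/4)^k to the integral, as 4^k (1/16)^k = (1/4)^k and
      the measure has mass 1.\<close>
    let ?h = "\<lambda>t. (4 ^ k * (cmod (g k t))\<^sup>2 + (1/4) ^ k) / 2"
    have int: "integrable circle_measure (\<lambda>t. (cmod (g k t))\<^sup>2)"
      using g[of k] by (simp add: sq_integrable_def)
    have "cmod x \<le> (4 ^ k * (cmod x)\<^sup>2 + (1/4) ^ k) / 2" for x
    proof -
      have "2 * (2 ^ k * cmod x) * (1/2) ^ k \<le> (2 ^ k * cmod x)\<^sup>2 + ((1/2) ^ k)\<^sup>2"
        by (rule sum_squares_bound)
      moreover have "2 * (2 ^ k * cmod x) * (1/2) ^ k = 2 * cmod x"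
        by (simp add: power_one_over)
      moreover have "(2 ^ k * cmod x)\<^sup>2 = 4 ^ k * (cmod x)\<^sup>2" "((1/2) ^ k)\<^sup>2 = (1/4 :: real) ^ k"
        by (simp_all add: power_mult_distrib power2_eq_square flip: power_mult_distrib)
      ultimately show ?thesis by simp
    qed
    then have "(\<integral>\<^sup>+t. ennreal (cmod (g k t)) \<partial>circle_measure) \<le> (\<integral>\<^sup>+t. ennreal (?h t) \<partial>circle_measure)"
      by (intro nn_integral_mono ennreal_leI) auto
    also have "\<dots> = ennreal (\<integral>t. ?h t \<partial>circle_measure)"
      using int by (intro nn_integral_eq_integral) auto
    also have "(\<integral>t. ?h t \<partial>circle_measure)
        = (4 ^ k * (\<integral>t. (cmod (g k t))\<^sup>2 \<partial>circle_measure) + (1/4) ^ k) / 2"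
      using int by (simp add: measure_def space_circle_measure emeasure_circle_measure)
    also have "\<dots> \<le> (4 ^ k * ((1/4) ^ k)\<^sup>2 + (1/4) ^ k) / 2"
      using fast[of k] by (intro divide_right_mono add_right_mono mult_left_mono) (auto simp: g_def)
    also have "\<dots> = (1/4) ^ k"
      by (simp add: power2_eq_square power_one_over)
    finally show ?thesis by (simp add: ennreal_leI)
  qed
  have "(\<integral>\<^sup>+t. (\<Sum>k. ennreal (cmod (g k t))) \<partial>circle_measure)
      = (\<Sum>k. \<integral>\<^sup>+t. ennreal (cmod (g k t)) \<partial>circle_measure)"
    by (rule nn_integral_suminf) auto
  also have "\<dots> \<le> (\<Sum>k. ennreal ((1/4) ^ k))"
    by (intro suminf_le le) auto
  also have "\<dots> < \<infinity>"
    by (subst suminf_ennreal2) (auto intro!: summable_geometric)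
  finally have "AE t in circle_measure. (\<Sum>k. ennreal (cmod (g k t))) \<noteq> \<infinity>"
    by (intro nn_integral_PInf_AE) auto
  then show ?thesis
  proof eventually_elim
    case (elim t)
    then have "summable (\<lambda>k. cmod (g k t))"
      by (intro summable_suminf_not_top) auto
    then have "summable (\<lambda>k. g k t)" by (rule summable_norm_cancel)
    then have "convergent (\<lambda>n. f 0 t + (\<Sum>k<n. g k t))"
      by (intro convergent_add convergent_const) (simp add: summable_iff_convergent)
    also have "(\<lambda>n. f 0 t + (\<Sum>k<n. g k t)) = (\<lambda>n. f n t)"
      by (simp add: g_def sum_lessThan_telescope[of "\<lambda>k. f k t"])
    finally show ?case .
  qed
qed

text \<open>The Riesz-Fischer argument: Fatou's lemma, applied as m tends to infinity, carries the
  estimate of f m - f n over to F - f n. This shows at once that F is square integrable and that it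
  is the limit.\<close>

lemma fast_Cauchy_L2_circle_convergent:
  fixes X :: "nat \<Rightarrow> L2_circle"
  assumes fast: "\<And>m n. n \<le> m \<Longrightarrow> norm (X m - X n) \<le> (1/4) ^ n"
  shows "convergent X"
proof -
  have "\<exists>f. sq_integrable f \<and> X k = abs_L2_circle f" for k by (meson L2_circle_cases)
  then obtain f where f: "\<And>k. sq_integrable (f k)" and X: "\<And>k. X k = abs_L2_circle (f k)"
    by metis
  have fm [measurable]: "f k \<in> borel_measurable circle_measure" for k
    using f[of k] by (simp add: sq_integrable_def)
  have fast': "(\<integral>t. (cmod (f m t - f n t))\<^sup>2 \<partial>circle_measure) \<le> ((1/4) ^ n)\<^sup>2" if "n \<le> m" for m n
    using power_mono[OF fast[OF that], of 2]
    by (simp add: X abs_L2_circle_diff f power2_norm_abs_L2_circle sq_integrable_diff)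
  have conv: "AE t in circle_measure. convergent (\<lambda>k. f k t)"
    by (intro AE_convergent_of_fast_L2_Cauchy f fast') auto
  \<comment> \<open>Where the sequence diverges this is an unspecified value; by \<open>conv\<close>
    that happens only on a null set.\<close>
  define F where "F = (\<lambda>t. lim (\<lambda>k. f k t))"
  have Fm [measurable]: "F \<in> borel_measurable circle_measure"
    unfolding F_def by (rule borel_measurable_lim_metric) auto
  have nn: "(\<integral>\<^sup>+t. ennreal ((cmod (F t - f n t))\<^sup>2) \<partial>circle_measure) \<le> ennreal (((1/4) ^ n)\<^sup>2)" for n
  proof -
    have "AE t in circle_measure. ennreal ((cmod (F t - f n t))\<^sup>2)
        = liminf (\<lambda>m. ennreal ((cmod (f m t - f n t))\<^sup>2))"
      using conv
    proof eventually_elim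
      case (elim t)
      then have "(\<lambda>m. f m t) \<longlonglongrightarrow> F t" unfolding F_def by (simp add: convergent_LIMSEQ_iff)
      then have "(\<lambda>m. ennreal ((cmod (f m t - f n t))\<^sup>2)) \<longlonglongrightarrow> ennreal ((cmod (F t - f n t))\<^sup>2)"
        by (intro tendsto_ennrealI tendsto_intros)
      then show ?case by (intro lim_imp_Liminf[symmetric]) auto
    qed
    then have "(\<integral>\<^sup>+t. ennreal ((cmod (F t - f n t))\<^sup>2) \<partial>circle_measure)
        = (\<integral>\<^sup>+t. liminf (\<lambda>m. ennreal ((cmod (f m t - f n t))\<^sup>2)) \<partial>circle_measure)"
      by (rule nn_integral_cong_AE)
    also have "\<dots> \<le> liminf (\<lambda>m. \<integral>\<^sup>+t. ennreal ((cmod (f m t - f n t))\<^sup>2) \<partial>circle_measure)"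
      by (intro nn_integral_liminf) auto
    also have "\<dots> \<le> liminf (\<lambda>m. ennreal (((1/4) ^ n)\<^sup>2))"
    proof (rule Liminf_mono)
      show "\<forall>\<^sub>F m in sequentially. (\<integral>\<^sup>+t. ennreal ((cmod (f m t - f n t))\<^sup>2) \<partial>circle_measure)
          \<le> ennreal (((1/4) ^ n)\<^sup>2)"
        using eventually_ge_at_top[of n]
      proof eventually_elim
        case (elim m)
        have "(\<integral>\<^sup>+t. ennreal ((cmod (f m t - f n t))\<^sup>2) \<partial>circle_measure)
            = ennreal (\<integral>t. (cmod (f m t - f n t))\<^sup>2 \<partial>circle_measure)"
          using sq_integrable_diff[OF f[of m] f[of n]]
          by (intro nn_integral_eq_integral) (auto simp: sq_integrable_def)
        with fast'[OF elim] show ?case by (simp add: ennreal_leI)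
      qed
    qed
    also have "\<dots> = ennreal (((1/4) ^ n)\<^sup>2)" by (simp add: Liminf_const)
    finally show ?thesis .
  qed
  have sqd: "sq_integrable (\<lambda>t. F t - f n t)" for n
    unfolding sq_integrable_def
  proof
    show "integrable circle_measure (\<lambda>t. (cmod (F t - f n t))\<^sup>2)"
      using le_less_trans[OF nn[of n]] by (intro integrableI_nonneg) auto
  qed measurable
  have F: "sq_integrable F"
    using sq_integrable_add[OF sqd[of 0] f[of 0]] by simp
  have "norm (X n - abs_L2_circle F) \<le> (1/4) ^ n" for n
  proof -
    have "(norm (abs_L2_circle F - X n))\<^sup>2 = (\<integral>t. (cmod (F t - f n t))\<^sup>2 \<partial>circle_measure)"
      by (simp add: X abs_L2_circle_diff F f power2_norm_abs_L2_circle sqd)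
    also have "ennreal \<dots> \<le> ennreal (((1/4) ^ n)\<^sup>2)"
      using nn[of n] sqd[of n]
      by (subst nn_integral_eq_integral[symmetric]) (auto simp: sq_integrable_def)
    then have "(\<integral>t. (cmod (F t - f n t))\<^sup>2 \<partial>circle_measure) \<le> ((1/4) ^ n)\<^sup>2"
      by (simp add: ennreal_le_iff)
    finally have "norm (abs_L2_circle F - X n) \<le> (1/4) ^ n"
      by (rule power2_le_imp_le) simp
    then show ?thesis by (simp add: norm_minus_commute)
  qed
  moreover have "(\<lambda>n. (1/4 :: real) ^ n) \<longlonglongrightarrow> 0"
    by (rule LIMSEQ_power_zero) simp
  ultimately have "(\<lambda>n. X n - abs_L2_circle F) \<longlonglongrightarrow> 0"
    by (rule Lim_null_comparison[OF always_eventually[OF allI]])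
  then have "X \<longlonglongrightarrow> abs_L2_circle F" by (rule LIM_zero_cancel)
  then show ?thesis by (rule convergentI)
qed

instance L2_circle :: complete_space
proof
  fix X :: "nat \<Rightarrow> L2_circle" assume "Cauchy X"
  then have "\<exists>M. \<forall>m\<ge>M. \<forall>n\<ge>M. norm (X m - X n) < (1/4) ^ k" for k :: nat
    by (intro CauchyD) auto
  then obtain M where M: "\<And>k m n. M k \<le> m \<Longrightarrow> M k \<le> n \<Longrightarrow> norm (X m - X n) < (1/4) ^ k"
    by metis
  \<comment> \<open>The sum over all i \<le> k dominates \<open>M k\<close> and is monotone; the
    summand k makes r strictly increasing.\<close>
  define r where "r = (\<lambda>k. (\<Sum>i\<le>k. M i) + k)"
  have r: "strict_mono r" by (rule strict_monoI_Suc) (simp add: r_def)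
  have Mr: "M k \<le> r k" for k
    unfolding r_def by (rule trans_le_add1) (rule member_le_sum, auto)
  have "convergent (X \<circ> r)"
  proof (rule fast_Cauchy_L2_circle_convergent)
    fix m n :: nat assume "n \<le> m"
    then have "r n \<le> r m" using r by (simp add: strict_mono_less_eq)
    then show "norm ((X \<circ> r) m - (X \<circ> r) n) \<le> (1/4) ^ n"
      using M[of n "r m" "r n"] Mr[of n] by simp
  qed
  then obtain l where "(X \<circ> r) \<longlonglongrightarrow> l" by (auto simp: convergent_def)
  with \<open>Cauchy X\<close> r have "X \<longlonglongrightarrow> l" by (rule Cauchy_converges_subseq)
  then show "convergent X" by (rule convergentI)
qed

instance L2_circle :: banach ..

section \<open>Multiplication operators and their block Toeplitz operators\<close>

lemma block_norm_0_iff: "block_norm n x = 0 \<longleftrightarrow> (\<forall>j<n. x j = 0)"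
  unfolding block_norm_def by (subst L2_set_eq_0_iff) auto

lemma block_norm_nonneg: "0 \<le> block_norm n x"
  by (simp add: block_norm_def)

lemma block_norm_power2: "(block_norm n x)\<^sup>2 = (\<Sum>i<n. (norm (x i))\<^sup>2)"
  by (simp add: block_norm_def L2_set_def sum_nonneg)

text \<open>The quotient in the supremum is 0 by convention where the denominator vanishes, so there
  the bound has to come from the vanishing of the relevant entries.\<close>

lemma block_norm_apply_le: "block_norm n (block_apply n X x) \<le> block_onorm n X * block_norm n x"
proof (cases "block_norm n x = 0")
  case True
  then have "\<forall>j<n. x j = 0" by (simp only: block_norm_0_iff)
  then have "block_norm n (block_apply n X x) = 0"
    by (simp add: block_norm_0_iff block_apply_def)
  with True show ?thesis by simp
next
  case False
  then have "0 < block_norm n x" using block_norm_nonneg[of n x] by linarith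
  moreover have "block_norm n (block_apply n X x) / block_norm n x \<le> block_onorm n X"
    unfolding block_onorm_def by (rule cSUP_upper[OF UNIV_I bdd_above_block_onorm])
  ultimately show ?thesis by (simp add: divide_le_eq)
qed

lemma block_onorm_le_1I:
  assumes "\<And>x. block_norm n (block_apply n X x) \<le> block_norm n x"
  shows "block_onorm n X \<le> 1"
  unfolding block_onorm_def
proof (rule cSUP_least)
  fix x
  show "block_norm n (block_apply n X x) / block_norm n x \<le> 1"
    using assms[of x] block_norm_nonneg[of n x]
    by (cases "block_norm n x = 0") (auto simp: divide_le_eq)
qed simp

lemma block_apply_toeplitz:
  assumes "i < length As"
  shows "block_apply (length As) (toeplitz As) x i = (\<Sum>j=i..<length As. blinfun_apply (As ! (j - i)) (x j))"
proof -
  have "block_apply (length As) (toeplitz As) x i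
      = (\<Sum>j\<in>{..<length As}. if j \<in> {i..} then blinfun_apply (As ! (j - i)) (x j) else 0)"
    unfolding block_apply_def toeplitz_def by (intro sum.cong) auto
  also have "\<dots> = (\<Sum>j\<in>{..<length As} \<inter> {i..}. blinfun_apply (As ! (j - i)) (x j))"
    by (rule sum.inter_restrict[symmetric]) simp
  also have "{..<length As} \<inter> {i..} = {i..<length As}" by auto
  finally show ?thesis .
qed

lemma mult_poly_abs_L2_circle:
  "sq_integrable f \<Longrightarrow> blinfun_apply (mult_poly p) (abs_L2_circle f) = abs_L2_circle (\<lambda>t. poly p t * f t)"
  by (rule mult_op_abs_L2_circle[OF poly_Linfty_circle])

lemma sq_integrable_poly_mult: "sq_integrable f \<Longrightarrow> sq_integrable (\<lambda>t. poly p t * f t)"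
  by (rule sq_integrable_mult[OF poly_Linfty_circle])

lemma mult_poly_add: "mult_poly (p + q) = mult_poly p + mult_poly q"
proof (rule blinfun_eqI)
  fix x
  obtain f where f: "sq_integrable f" "x = abs_L2_circle f" by (rule L2_circle_cases)
  then show "blinfun_apply (mult_poly (p + q)) x = blinfun_apply (mult_poly p + mult_poly q) x"
    by (simp add: mult_poly_abs_L2_circle blinfun.add_left plus_L2_circle.abs_eq L2_rel_refl
        sq_integrable_poly_mult distrib_right)
qed

lemma mult_poly_smult: "mult_poly (Polynomial.smult c p) = c *\<^sub>C mult_poly p"
proof (rule blinfun_eqI)
  fix x
  obtain f where f: "sq_integrable f" "x = abs_L2_circle f" by (rule L2_circle_cases)
  then show "blinfun_apply (mult_poly (Polynomial.smult c p)) x = blinfun_apply (c *\<^sub>C mult_poly p) x"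
    by (simp add: mult_poly_abs_L2_circle scaleC_blinfun.rep_eq abs_L2_circle_scaleC
        sq_integrable_poly_mult mult.assoc)
qed

lemma mult_poly_0: "mult_poly 0 = 0"
  using mult_poly_add[of 0 0] by simp

lemma mult_poly_sum: "finite I \<Longrightarrow> mult_poly (\<Sum>i\<in>I. p i) = (\<Sum>i\<in>I. mult_poly (p i))"
  by (induction I rule: finite_induct) (simp_all add: mult_poly_0 mult_poly_add del: poly_0 poly_add)

lemma clinear_op_mult_poly: "clinear_op (mult_poly p)"
  unfolding clinear_op_def
proof (intro allI)
  fix c x
  obtain f where f: "sq_integrable f" "x = abs_L2_circle f" by (rule L2_circle_cases)
  then show "blinfun_apply (mult_poly p) (c *\<^sub>C x) = c *\<^sub>C blinfun_apply (mult_poly p) x"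
    by (simp add: mult_poly_abs_L2_circle abs_L2_circle_scaleC sq_integrable_cmult
        sq_integrable_poly_mult mult.left_commute)
qed

text \<open>The block operator acts fibrewise: a vector of n functions is a function with values in
  \<complex>^n, on which the operator is the scalar Toeplitz matrix at each t. The hypothesis is
  integrated over the circle.\<close>

lemma toeplitz_norm_mult_poly_le_1:
  assumes "\<And>t x. cmod t = 1 \<Longrightarrow>
    (\<Sum>i<length ps. (cmod (\<Sum>j=i..<length ps. poly (ps ! (j - i)) t * x j))\<^sup>2)
      \<le> (\<Sum>j<length ps. (cmod (x j))\<^sup>2)"
  shows "toeplitz_norm (map mult_poly ps) \<le> 1"
  unfolding toeplitz_norm_def
proof (rule block_onorm_le_1I)
  fix x :: "nat \<Rightarrow> L2_circle"
  let ?n = "length ps" and ?As = "map mult_poly ps"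
  have "\<exists>f. sq_integrable f \<and> x j = abs_L2_circle f" for j by (meson L2_circle_cases)
  then obtain f where f: "\<And>j. sq_integrable (f j)" and x: "\<And>j. x j = abs_L2_circle (f j)"
    by metis
  define g where "g = (\<lambda>i t. \<Sum>j=i..<?n. poly (ps ! (j - i)) t * f j t)"
  have g: "sq_integrable (g i)" for i
    unfolding g_def by (intro sq_integrable_sum sq_integrable_poly_mult f) auto
  have ap: "block_apply ?n (toeplitz ?As) x i = abs_L2_circle (g i)" if i: "i < ?n" for i
  proof -
    have "block_apply ?n (toeplitz ?As) x i = (\<Sum>j=i..<?n. blinfun_apply (?As ! (j - i)) (x j))"
      using block_apply_toeplitz[of i ?As x] i by simp
    also have "\<dots> = (\<Sum>j=i..<?n. abs_L2_circle (\<lambda>t. poly (ps ! (j - i)) t * f j t))"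
      by (intro sum.cong) (auto simp: x mult_poly_abs_L2_circle f)
    also have "\<dots> = abs_L2_circle (g i)"
      unfolding g_def by (intro abs_L2_circle_sum sq_integrable_poly_mult f) auto
    finally show ?thesis .
  qed
  have "(block_norm ?n (block_apply ?n (toeplitz ?As) x))\<^sup>2
      = (\<Sum>i<?n. \<integral>t. (cmod (g i t))\<^sup>2 \<partial>circle_measure)"
    unfolding block_norm_power2 by (intro sum.cong) (auto simp: ap power2_norm_abs_L2_circle g)
  also have "\<dots> = (\<integral>t. (\<Sum>i<?n. (cmod (g i t))\<^sup>2) \<partial>circle_measure)"
    using g by (subst Bochner_Integration.integral_sum) (auto simp: sq_integrable_def)
  also have "\<dots> \<le> (\<integral>t. (\<Sum>j<?n. (cmod (f j t))\<^sup>2) \<partial>circle_measure)"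
  proof (rule integral_mono)
    fix t assume "t \<in> space circle_measure"
    then have "cmod t = 1" by (simp add: space_circle_measure)
    then show "(\<Sum>i<?n. (cmod (g i t))\<^sup>2) \<le> (\<Sum>j<?n. (cmod (f j t))\<^sup>2)"
      unfolding g_def by (rule assms)
  qed (use f g in \<open>auto simp: sq_integrable_def\<close>)
  also have "\<dots> = (\<Sum>j<?n. \<integral>t. (cmod (f j t))\<^sup>2 \<partial>circle_measure)"
    using f by (subst Bochner_Integration.integral_sum) (auto simp: sq_integrable_def)
  also have "\<dots> = (block_norm ?n x)\<^sup>2"
    unfolding block_norm_power2 by (intro sum.cong) (auto simp: x power2_norm_abs_L2_circle f)
  finally have "block_norm ?n (block_apply ?n (toeplitz ?As) x) \<le> block_norm ?n x"
    by (rule power2_le_imp_le[OF _ block_norm_nonneg])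
  then show "block_norm (length ?As) (block_apply (length ?As) (toeplitz ?As) x)
      \<le> block_norm (length ?As) x" by simp
qed

lemma norm_mult_poly_le:
  assumes "\<And>t. cmod t = 1 \<Longrightarrow> cmod (poly p t) \<le> C"
  shows "norm (mult_poly p) \<le> C"
proof (rule norm_blinfun_bound)
  show C: "0 \<le> C" using order_trans[OF norm_ge_zero assms[of 1]] by simp
  fix x
  obtain f where f: "sq_integrable f" "x = abs_L2_circle f" by (rule L2_circle_cases)
  have "(norm (blinfun_apply (mult_poly p) x))\<^sup>2 = (\<integral>t. (cmod (poly p t * f t))\<^sup>2 \<partial>circle_measure)"
    by (simp add: f mult_poly_abs_L2_circle power2_norm_abs_L2_circle sq_integrable_poly_mult)
  also have "\<dots> \<le> (\<integral>t. C\<^sup>2 * (cmod (f t))\<^sup>2 \<partial>circle_measure)"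
  proof (rule integral_mono)
    fix t assume "t \<in> space circle_measure"
    then have "cmod t = 1" by (simp add: space_circle_measure)
    then show "(cmod (poly p t * f t))\<^sup>2 \<le> C\<^sup>2 * (cmod (f t))\<^sup>2"
      using assms[of t] by (auto simp: norm_mult power_mult_distrib intro!: mult_right_mono power_mono)
  qed (use f(1) sq_integrable_poly_mult[OF f(1), of p] in \<open>auto simp: sq_integrable_def\<close>)
  also have "\<dots> = (C * norm x)\<^sup>2"
    by (simp add: f power2_norm_abs_L2_circle power_mult_distrib)
  finally show "norm (blinfun_apply (mult_poly p) x) \<le> C * norm x"
    by (rule power2_le_imp_le) (use C in simp)
qed

section \<open>Approximate eigenvectors and pointwise bounds for the symbols\<close>

lemma measure_circle_arc_pos:
  assumes t: "cmod t = 1" and e: "0 < e"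
  shows "0 < measure circle_measure (sphere 0 1 \<inter> ball t e)"
proof -
  interpret finite_measure circle_measure by (rule finite_measure_circle_measure)
  let ?U = "sphere 0 1 \<inter> ball t e"
  have U: "?U \<in> sets circle_measure"
    by (simp add: sets_circle_measure sets_restrict_space)
  define \<theta> where "\<theta> = Arg2pi t"
  have \<theta>: "0 \<le> \<theta>" "\<theta> < 2 * pi" "cis \<theta> = t"
    using Arg2pi[of t] t by (auto simp: \<theta>_def cis_conv_exp is_Arg_def)
  have "isCont cis \<theta>" 
    using continuous_on_cis[OF continuous_on_id, of UNIV] by (simp add: continuous_on_eq_continuous_at)
  then obtain d where d: "d > 0" "\<And>s. \<bar>s - \<theta>\<bar> < d \<Longrightarrow> dist (cis s) (cis \<theta>) < e"
    using e by (auto simp: continuous_at_eps_delta dist_real_def)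
  \<comment> \<open>The angle lies in [0, 2 \<pi>), so there is always room to its right; the second
    term keeps the interval inside [0, 2 \<pi>], where the circle measure is defined.\<close>
  define d' where "d' = min (d / 2) (2 * pi - \<theta>)"
  have d': "0 < d'" "d' < d" "\<theta> + d' \<le> 2 * pi" using d \<theta> by (auto simp: d'_def)
  have sub: "{\<theta>..\<theta> + d'} \<subseteq> {0..2 * pi} \<inter> (cis -` ?U)"
  proof
    fix s assume s: "s \<in> {\<theta>..\<theta> + d'}"
    then have "dist (cis s) (cis \<theta>) < e" using d' by (intro d) auto
    then show "s \<in> {0..2 * pi} \<inter> (cis -` ?U)"
      using s d' \<theta> by (auto simp: dist_commute)
  qed
  have meas: "cis -` ?U \<in> sets borel"
  proof -
    have "cis -` ?U = cis -` ball t e" by auto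
    moreover have "open (cis -` ball t e)"
      by (intro open_vimage continuous_intros) auto
    ultimately show ?thesis by simp
  qed
  have "emeasure lborel {\<theta>..\<theta> + d'} \<le> emeasure lborel ({0..2 * pi} \<inter> (cis -` ?U))"
    using meas sub by (intro emeasure_mono) auto
  then have "0 < emeasure lborel ({0..2 * pi} \<inter> (cis -` ?U))"
    using d' by (simp add: less_le_trans[of 0 "ennreal d'"])
  then have "0 < emeasure lborel ({0..2 * pi} \<inter> (cis -` ?U)) / emeasure lborel {0..2 * pi}"
    by (simp add: ennreal_zero_less_divide)
  also have "\<dots> = emeasure circle_measure ?U"
    using U meas unfolding circle_measure_def
    by (subst emeasure_distr[OF measurable_cis_sphere]) (auto simp: sets_restrict_space)
  finally show ?thesis by (simp add: emeasure_eq_measure)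
qed

text \<open>One sequence serves all polynomials at once, which allows several blocks to be tested on
  the same vectors. On a small arc about t each p is close to p(t), and nothing happens off the
  arc.\<close>

lemma approximate_eigenvectors:
  assumes t: "cmod t = 1"
  obtains h :: "nat \<Rightarrow> L2_circle" where "\<And>n. norm (h n) = 1"
    "\<And>p. (\<lambda>n. blinfun_apply (mult_poly p) (h n) - poly p t *\<^sub>C h n) \<longlonglongrightarrow> 0"
proof -
  interpret finite_measure circle_measure by (rule finite_measure_circle_measure)
  define U where "U = (\<lambda>n. sphere 0 1 \<inter> ball t (1 / real (Suc n)))"
  define m where "m = (\<lambda>n. measure circle_measure (U n))"
  have m: "0 < m n" for n unfolding m_def U_def by (intro measure_circle_arc_pos t) simp
  have U [measurable]: "U n \<in> sets circle_measure" for n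
    by (simp add: U_def sets_circle_measure sets_restrict_space)
  define f where "f = (\<lambda>n s. complex_of_real (1 / sqrt (m n)) * indicator (U n) s)"
  have sqf: "(cmod (f n s))\<^sup>2 = 1 / m n * indicator (U n) s" for n s
    using m[of n] by (simp add: f_def indicator_def norm_mult norm_divide power_divide)
  have int: "integrable circle_measure (\<lambda>s. 1 / m n * indicator (U n) s)" for n
    by (intro integrable_mult_right) (auto simp: integrable_indicator_iff less_top[symmetric])
  have f: "sq_integrable (f n)" for n
    unfolding sq_integrable_def sqf using int[of n] by (auto simp: f_def)
  have intval: "(\<integral>s. 1 / m n * indicator (U n) s \<partial>circle_measure) = 1" for n
    using m[of n] by (simp add: m_def)
  show ?thesis
  proof
    show "norm (abs_L2_circle (f n)) = 1" for n
      using power2_norm_abs_L2_circle[OF f[of n]] by (simp only: sqf intval) (simp add: abs_square_eq_1)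
    fix p
    show "(\<lambda>n. blinfun_apply (mult_poly p) (abs_L2_circle (f n)) - poly p t *\<^sub>C abs_L2_circle (f n)) \<longlonglongrightarrow> 0"
    proof (rule tendstoI)
      fix e :: real assume e: "0 < e"
      have "isCont (poly p) t" by (intro continuous_intros)
      then obtain d where d: "d > 0" "\<And>s. dist s t < d \<Longrightarrow> dist (poly p s) (poly p t) < e / 2"
        using e half_gt_zero[OF e] unfolding continuous_at_eps_delta by blast
      have "(\<lambda>n. 1 / real (Suc n)) \<longlonglongrightarrow> 0" by (rule LIMSEQ_Suc[OF lim_1_over_n])
      then have "\<forall>\<^sub>F n in sequentially. 1 / real (Suc n) < d"
        by (rule order_tendstoD) (use d in simp)
      then show "\<forall>\<^sub>F n in sequentially. dist (blinfun_apply (mult_poly p) (abs_L2_circle (f n))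
          - poly p t *\<^sub>C abs_L2_circle (f n)) 0 < e"
      proof eventually_elim
        case (elim n)
        let ?g = "\<lambda>s. poly p s * f n s - poly p t * f n s"
        have g: "sq_integrable ?g"
          by (intro sq_integrable_diff sq_integrable_poly_mult sq_integrable_cmult f)
        have "blinfun_apply (mult_poly p) (abs_L2_circle (f n)) - poly p t *\<^sub>C abs_L2_circle (f n)
            = abs_L2_circle ?g"
          by (simp add: mult_poly_abs_L2_circle abs_L2_circle_scaleC abs_L2_circle_diff f
              sq_integrable_poly_mult sq_integrable_cmult)
        moreover have "(norm (abs_L2_circle ?g))\<^sup>2 \<le> (e / 2)\<^sup>2"
        proof -
          have "(norm (abs_L2_circle ?g))\<^sup>2 = (\<integral>s. (cmod (?g s))\<^sup>2 \<partial>circle_measure)"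
            by (rule power2_norm_abs_L2_circle[OF g])
          also have "\<dots> \<le> (\<integral>s. (e / 2)\<^sup>2 * (1 / m n * indicator (U n) s) \<partial>circle_measure)"
          proof (rule integral_mono)
            fix s
            have *: "cmod (?g s) = cmod (poly p s - poly p t) * cmod (f n s)"
              by (simp flip: norm_mult left_diff_distrib)
            show "(cmod (?g s))\<^sup>2 \<le> (e / 2)\<^sup>2 * (1 / m n * indicator (U n) s)"
            proof (cases "s \<in> U n")
              case True
              then have "dist s t < d" using elim by (simp add: U_def dist_commute)
              then have "cmod (poly p s - poly p t) \<le> e / 2" using d(2)[of s] by (simp add: dist_norm)
              then show ?thesis
                unfolding * power_mult_distrib sqf
                by (intro mult_right_mono power_mono) (use m[of n] in \<open>auto simp: less_imp_le\<close>)
            next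
              case False
              then show ?thesis by (simp add: f_def)
            qed
          next
            show "integrable circle_measure (\<lambda>s. (cmod (?g s))\<^sup>2)" using g by (simp add: sq_integrable_def)
            show "integrable circle_measure (\<lambda>s. (e / 2)\<^sup>2 * (1 / m n * indicator (U n) s))"
              by (intro integrable_mult_right int)
          qed
          also have "\<dots> = (e / 2)\<^sup>2 * (\<integral>s. 1 / m n * indicator (U n) s \<partial>circle_measure)"
            by (rule integral_mult_right_zero)
          finally show ?thesis by (simp only: intval mult_1_right)
        qed
        then have "norm (abs_L2_circle ?g) \<le> e / 2" by (rule power2_le_imp_le) (use e in simp)
        ultimately show ?case using e by simp
      qed
    qed
  qed
qed

lemma tendsto_norm_approx:
  fixes x y :: "nat \<Rightarrow> 'a :: real_normed_vector"
  assumes "(\<lambda>n. x n - y n) \<longlonglongrightarrow> 0" "\<And>n. norm (y n) = c"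
  shows "(\<lambda>n. norm (x n)) \<longlonglongrightarrow> c"
proof -
  have "(\<lambda>n. norm (x n) - norm (y n)) \<longlonglongrightarrow> 0"
    by (rule Lim_null_comparison[OF _ tendsto_norm_zero[OF assms(1)]])
      (simp add: norm_triangle_ineq3)
  then show ?thesis using assms(2) by (simp add: LIM_zero_iff)
qed

lemma scaleC_diff_right: "c *\<^sub>C (x - y :: 'a :: complex_normed_vector) = c *\<^sub>C x - c *\<^sub>C y"
  by (rule linear_diff[OF bounded_linear.linear[OF bounded_linear_scaleC]])

lemma scaleC_sum_left: "finite I \<Longrightarrow> (\<Sum>i\<in>I. c i) *\<^sub>C (x :: 'a :: complex_normed_vector) = (\<Sum>i\<in>I. c i *\<^sub>C x)"
proof (induction I rule: finite_induct)
  case empty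
  show ?case using scaleC_of_real[of 0 x] by simp
qed (simp add: scaleC_add_left)

text \<open>The block operator is tested on the vectors with entries
  \<open>x j *\<^sub>C h m\<close>, whose norm is that of x. In the limit every block acts as the
  scalar p(t), so the norms of the entries of the image tend to those of the scalar Toeplitz
  product.\<close>

lemma toeplitz_norm_mult_poly_imp_pointwise:
  assumes le: "toeplitz_norm (map mult_poly ps) \<le> 1" and t: "cmod t = 1"
  shows "(\<Sum>i<length ps. (cmod (\<Sum>j=i..<length ps. poly (ps ! (j - i)) t * x j))\<^sup>2)
      \<le> (\<Sum>j<length ps. (cmod (x j))\<^sup>2)"
proof -
  let ?n = "length ps" and ?As = "map mult_poly ps"
  obtain h where h: "\<And>n. norm (h n) = 1"
    and ev: "\<And>p. (\<lambda>n. blinfun_apply (mult_poly p) (h n) - poly p t *\<^sub>C h n) \<longlonglongrightarrow> 0"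
    using approximate_eigenvectors[OF t] by blast
  define s where "s = (\<lambda>i. \<Sum>j=i..<?n. poly (ps ! (j - i)) t * x j)"
  define y where "y = (\<lambda>m i. block_apply ?n (toeplitz ?As) (\<lambda>j. x j *\<^sub>C h m) i)"
  have y: "y m i = (\<Sum>j=i..<?n. x j *\<^sub>C blinfun_apply (mult_poly (ps ! (j - i))) (h m))" if "i < ?n" for m i
  proof -
    have "y m i = (\<Sum>j=i..<?n. blinfun_apply (?As ! (j - i)) (x j *\<^sub>C h m))"
      unfolding y_def using block_apply_toeplitz[of i ?As "\<lambda>j. x j *\<^sub>C h m"] that by simp
    also have "\<dots> = (\<Sum>j=i..<?n. x j *\<^sub>C blinfun_apply (mult_poly (ps ! (j - i))) (h m))"
      by (intro sum.cong) (use clinear_op_mult_poly in \<open>auto simp: clinear_op_def\<close>)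
    finally show ?thesis .
  qed
  have lim: "(\<lambda>m. norm (y m i)) \<longlonglongrightarrow> cmod (s i)" if i: "i < ?n" for i
  proof (rule tendsto_norm_approx)
    show "norm (s i *\<^sub>C h m) = cmod (s i)" for m by (simp add: norm_scaleC h)
    have "y m i - s i *\<^sub>C h m = (\<Sum>j=i..<?n. x j *\<^sub>C (blinfun_apply (mult_poly (ps ! (j - i))) (h m)
        - poly (ps ! (j - i)) t *\<^sub>C h m))" for m
      unfolding y[OF i] s_def
      by (simp add: scaleC_sum_left sum_subtractf scaleC_diff_right scaleC_scaleC mult.commute)
    moreover have "(\<lambda>m. \<Sum>j=i..<?n. x j *\<^sub>C (blinfun_apply (mult_poly (ps ! (j - i))) (h m)
        - poly (ps ! (j - i)) t *\<^sub>C h m)) \<longlonglongrightarrow> (\<Sum>j=i..<?n. 0)"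
      by (intro tendsto_sum bounded_linear.tendsto_zero[OF bounded_linear_scaleC] ev)
    ultimately show "(\<lambda>m. y m i - s i *\<^sub>C h m) \<longlonglongrightarrow> 0" by simp
  qed
  have "(\<Sum>i<?n. (norm (y m i))\<^sup>2) \<le> (\<Sum>j<?n. (cmod (x j))\<^sup>2)" for m
  proof -
    let ?x = "\<lambda>j. x j *\<^sub>C h m"
    have "block_norm ?n (y m) \<le> block_onorm ?n (toeplitz ?As) * block_norm ?n ?x"
      unfolding y_def by (rule block_norm_apply_le)
    also have "\<dots> \<le> 1 * block_norm ?n ?x"
      using le by (intro mult_right_mono block_norm_nonneg) (simp add: toeplitz_norm_def)
    finally have "(block_norm ?n (y m))\<^sup>2 \<le> (block_norm ?n ?x)\<^sup>2"
      by (intro power_mono block_norm_nonneg) simp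
    then show ?thesis by (simp add: block_norm_power2 norm_scaleC h)
  qed
  moreover have "(\<lambda>m. \<Sum>i<?n. (norm (y m i))\<^sup>2) \<longlonglongrightarrow> (\<Sum>i<?n. (cmod (s i))\<^sup>2)"
    by (intro tendsto_intros lim) auto
  ultimately have "(\<Sum>i<?n. (cmod (s i))\<^sup>2) \<le> (\<Sum>j<?n. (cmod (x j))\<^sup>2)"
    by (intro tendsto_upperbound[OF _ always_eventually]) auto
  then show ?thesis by (simp add: s_def)
qed

section \<open>Operator-valued holomorphic functions\<close>

text \<open>The Hermitian inner product that belongs to the real inner product: \<open>y\<close> acts as a
  complex-linear functional.\<close>

definition cdual :: "'h :: {real_inner, complex_normed_vector} \<Rightarrow> 'h \<Rightarrow> complex" where
  "cdual y x = Complex (x \<bullet> y) (- ((\<i> *\<^sub>C x) \<bullet> y))"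

lemma scaleC_eq_scaleR: "c *\<^sub>C (x :: 'a :: complex_normed_vector) = Re c *\<^sub>R x + Im c *\<^sub>R \<i> *\<^sub>C x"
proof -
  have "c *\<^sub>C x = (of_real (Re c) + of_real (Im c) * \<i>) *\<^sub>C x"
    using complex_eq[of c] by (simp only: mult.commute[of \<i>])
  then show ?thesis
    by (simp only: scaleC_add_left scaleC_scaleC[symmetric] scaleC_of_real)
qed

lemma scaleC_i_i: "\<i> *\<^sub>C \<i> *\<^sub>C (x :: 'a :: complex_normed_vector) = - x"
  using scaleC_of_real[of "- 1" x] by (simp add: scaleC_scaleC)

lemma scaleC_scaleR: "c *\<^sub>C (r *\<^sub>R (x :: 'a :: complex_normed_vector)) = r *\<^sub>R (c *\<^sub>C x)"
  by (simp only: scaleC_of_real[symmetric] scaleC_scaleC mult.commute)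

lemma cdual_add: "cdual y (u + v) = cdual y u + cdual y v"
  by (simp add: cdual_def complex_eq_iff scaleC_add_right inner_add_left)

lemma cdual_scaleC: "cdual y (c *\<^sub>C x) = c * cdual y x"
proof -
  have 1: "\<i> *\<^sub>C c *\<^sub>C x = Re c *\<^sub>R \<i> *\<^sub>C x - Im c *\<^sub>R x"
    by (simp add: scaleC_eq_scaleR[of c x] scaleC_add_right scaleC_scaleR scaleC_i_i)
  show ?thesis
    by (simp add: cdual_def 1) (simp add: scaleC_eq_scaleR[of c x] complex_eq_iff algebra_simps)
qed

lemma cdual_diff: "cdual y (u - v) = cdual y u - cdual y v"
  by (simp add: cdual_def complex_eq_iff scaleC_diff_right inner_diff_left)

lemma norm_cdual_le: "cmod (cdual y x) \<le> norm x * norm y"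
proof (cases "cdual y x = 0")
  case False
  \<comment> \<open>A rotation of x makes the value real and nonnegative; the real Cauchy-Schwarz
    inequality then suffices.\<close>
  define u where "u = cnj (cdual y x) / cmod (cdual y x)"
  have u: "cmod u = 1" using False by (simp add: u_def norm_divide)
  have "cdual y (u *\<^sub>C x) = cmod (cdual y x)"
    using False by (simp add: cdual_scaleC u_def complex_norm_square[symmetric] power2_eq_square mult.commute[of "cnj _"])
  then have "cmod (cdual y x) = Re (cdual y (u *\<^sub>C x))" by simp
  also have "\<dots> = (u *\<^sub>C x) \<bullet> y" by (simp add: cdual_def)
  also have "\<dots> \<le> norm (u *\<^sub>C x) * norm y" by (rule norm_cauchy_schwarz)
  finally show ?thesis using u by (simp add: norm_scaleC)
qed simp

lemma bounded_linear_cdual: "bounded_linear (cdual y)"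
proof (rule bounded_linear_intro)
  show "cdual y (r *\<^sub>R x) = r *\<^sub>R cdual y x" for r x
    using cdual_scaleC[of y "of_real r" x] by (simp add: scaleC_of_real scaleR_conv_of_real)
qed (rule cdual_add norm_cdual_le)+

text \<open>The real part already exhausts the Cauchy-Schwarz bound for the modulus, which leaves no
  room for an imaginary part. The link between inner product and complex scalars enters only through
  the norm.\<close>

lemma cdual_self: "cdual y y = of_real ((norm y)\<^sup>2)"
proof -
  have re: "Re (cdual y y) = (norm y)\<^sup>2" by (simp add: cdual_def power2_norm_eq_inner)
  have "(Re (cdual y y))\<^sup>2 + (Im (cdual y y))\<^sup>2 = (cmod (cdual y y))\<^sup>2" by (simp add: cmod_power2)
  also have "\<dots> \<le> ((norm y)\<^sup>2)\<^sup>2"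
    using norm_cdual_le[of y y] by (intro power_mono) (auto simp: power2_eq_square)
  finally have "Im (cdual y y) = 0" by (simp add: re)
  with re show ?thesis by (simp add: complex_eq_iff)
qed

abbreviation matrix_coeff :: "'a \<Rightarrow> 'b \<Rightarrow>
    ('a :: real_normed_vector \<Rightarrow>\<^sub>L 'b :: {real_inner, complex_normed_vector}) \<Rightarrow> complex" where
  "matrix_coeff x y A \<equiv> cdual y (blinfun_apply A x)"

lemma norm_matrix_coeff_le: "cmod (matrix_coeff x y A) \<le> norm A * norm x * norm y"
  using order_trans[OF norm_cdual_le mult_right_mono[OF norm_blinfun norm_ge_zero]] .

lemma matrix_coeff_norming:
  assumes "0 \<le> K" "\<And>x y. cmod (matrix_coeff x y A) \<le> K * norm x * norm y"
  shows "norm A \<le> K"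
proof (rule norm_blinfun_bound[OF assms(1)])
  fix x
  \<comment> \<open>The norming choice y = A x turns the coefficient into the square of the norm of
    A x.\<close>
  let ?y = "blinfun_apply A x"
  have "(norm ?y)\<^sup>2 \<le> K * norm x * norm ?y"
    using assms(2)[of ?y x] by (simp add: cdual_self norm_power)
  then show "norm ?y \<le> K * norm x"
    using assms(1) by (cases "norm ?y = 0") (auto simp: power2_eq_square)
qed

lemma matrix_coeff_has_field_derivative:
  assumes "has_vec_cderiv f D z"
  shows "((\<lambda>w. matrix_coeff x y (f w)) has_field_derivative matrix_coeff x y D) (at z)"
proof -
  have "((\<lambda>w. matrix_coeff x y (inverse (w - z) *\<^sub>C (f w - f z))) \<longlongrightarrow> matrix_coeff x y D) (at z)"
    using assms unfolding has_vec_cderiv_def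
    by (intro bounded_linear.tendsto[OF bounded_linear_cdual] tendsto_intros)
  then show ?thesis
    by (simp add: has_field_derivative_iff scaleC_blinfun.rep_eq cdual_scaleC blinfun.diff_left
        cdual_diff divide_inverse mult.commute)
qed

lemma vec_cderiv_eqI:
  assumes "has_vec_cderiv f D z"
  shows "vec_cderiv f z = D"
  unfolding vec_cderiv_def
proof (rule the_equality)
  show "has_vec_cderiv f D z" by (fact assms)
  fix E assume "has_vec_cderiv f E z"
  with assms show "E = D"
    unfolding has_vec_cderiv_def by (intro tendsto_unique[OF trivial_limit_at])
qed

lemma has_vec_cderiv_vec_cderiv:
  assumes "vec_holomorphic_on f S" "z \<in> S"
  shows "has_vec_cderiv f (vec_cderiv f z) z"
proof -
  obtain D where "has_vec_cderiv f D z" using assms by (auto simp: vec_holomorphic_on_def)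
  then show ?thesis using vec_cderiv_eqI by blast
qed

lemma holomorphic_on_matrix_coeff:
  assumes "vec_holomorphic_on f S"
  shows "(\<lambda>w. matrix_coeff x y (f w)) holomorphic_on S"
  unfolding holomorphic_on_def field_differentiable_def
  using matrix_coeff_has_field_derivative[OF has_vec_cderiv_vec_cderiv[OF assms]]
  by (meson has_field_derivative_at_within)

lemma deriv_matrix_coeff:
  assumes "vec_holomorphic_on f S" "z \<in> S"
  shows "deriv (\<lambda>w. matrix_coeff x y (f w)) z = matrix_coeff x y (vec_cderiv f z)"
  by (rule DERIV_imp_deriv[OF matrix_coeff_has_field_derivative[OF has_vec_cderiv_vec_cderiv[OF assms]]])

text \<open>A closed disc of radius r/3 about a point of the half ball stays in the ball, since 1/2
  + 1/3 < 1.\<close>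

lemma Cauchy_inequality_half_ball:
  assumes f: "f holomorphic_on ball z r" and B: "\<And>w. w \<in> ball z r \<Longrightarrow> cmod (f w) \<le> B"
    and r: "0 < r" and u: "u \<in> ball z (r / 2)"
  shows "cmod ((deriv ^^ n) f u) \<le> fact n * B / (r / 3) ^ n"
proof (rule Cauchy_inequality)
  have sub: "cball u (r / 3) \<subseteq> ball z r"
  proof
    fix v assume "v \<in> cball u (r / 3)"
    then have "dist z v < r / 2 + r / 3" using dist_triangle[of z v u] u by simp
    also have "\<dots> \<le> r" using r by simp
    finally show "v \<in> ball z r" by simp
  qed
  show "f holomorphic_on ball u (r / 3)"
    by (rule holomorphic_on_subset[OF f]) (use sub ball_subset_cball in blast)
  show "continuous_on (cball u (r / 3)) f"
    by (rule continuous_on_subset[OF holomorphic_on_imp_continuous_on[OF f] sub])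
  show "cmod (f v) \<le> B" if "cmod (u - v) = r / 3" for v
    using that sub by (intro B) (auto simp: dist_norm subset_iff)
qed (use r in simp)

text \<open>Taylor's formula of first order. The right side depends on f only through B; for matrix
  coefficients it is therefore uniform over unit vectors.\<close>

lemma difference_quotient_estimate:
  assumes f: "f holomorphic_on ball z r" and B: "\<And>w. w \<in> ball z r \<Longrightarrow> cmod (f w) \<le> B"
    and r: "0 < r" and w: "w \<in> ball z (r / 2)" "w \<noteq> z"
  shows "cmod (inverse (w - z) * (f w - f z) - deriv f z) \<le> 18 / r\<^sup>2 * B * cmod (w - z)"
proof -
  have sub: "ball z (r / 2) \<subseteq> ball z r" using r by (intro subset_ball) simp
  \<comment> \<open>The constant 18 is 2! * 3^2, from Cauchy's inequality for the second derivative
    with radius r/3.\<close>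
  have "cmod ((deriv ^^ 0) f w - (\<Sum>i\<le>1. (deriv ^^ i) f z * (w - z) ^ i / fact i))
      \<le> (18 / r\<^sup>2 * B) * cmod (w - z) ^ Suc 1 / fact 1"
  proof (rule complex_Taylor[where S = "ball z (r / 2)" and f = "\<lambda>i. (deriv ^^ i) f"])
    show "((deriv ^^ i) f has_field_derivative (deriv ^^ Suc i) f u) (at u within ball z (r / 2))"
      if "u \<in> ball z (r / 2)" for i u
    proof (rule has_field_derivative_at_within)
      show "((deriv ^^ i) f has_field_derivative (deriv ^^ Suc i) f u) (at u)"
        using has_field_derivative_higher_deriv[OF f open_ball] that sub by blast
    qed
    show "cmod ((deriv ^^ Suc 1) f u) \<le> 18 / r\<^sup>2 * B" if "u \<in> ball z (r / 2)" for u
      using Cauchy_inequality_half_ball[OF f B r that, of "Suc 1"] r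
      by (simp add: power2_eq_square field_simps)
  qed (use w r in auto)
  then have *: "cmod (f w - f z - deriv f z * (w - z)) \<le> 18 / r\<^sup>2 * B * (cmod (w - z))\<^sup>2"
    by (simp add: power2_eq_square algebra_simps)
  have "inverse (w - z) * (f w - f z) - deriv f z = inverse (w - z) * (f w - f z - deriv f z * (w - z))"
    using w by (simp add: field_simps)
  then have "cmod (inverse (w - z) * (f w - f z) - deriv f z)
      = cmod (f w - f z - deriv f z * (w - z)) / cmod (w - z)"
    by (simp add: norm_mult norm_inverse divide_inverse mult.commute)
  also have "\<dots> \<le> (18 / r\<^sup>2 * B * (cmod (w - z))\<^sup>2) / cmod (w - z)"
    by (rule divide_right_mono[OF *]) simp
  also have "\<dots> = 18 / r\<^sup>2 * B * cmod (w - z)"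
    using w by (simp add: power2_eq_square)
  finally show ?thesis .
qed

text \<open>Weakly holomorphic, locally bounded functions are holomorphic: by Cauchy's estimates, uniform
  over all matrix coefficients, the difference quotients satisfy a Cauchy condition.\<close>

lemma vec_holomorphic_onI_weak:
  fixes f :: "complex \<Rightarrow> 'a :: real_normed_vector \<Rightarrow>\<^sub>L 'b :: {real_inner, complex_normed_vector, banach}"
  assumes S: "open S"
    and bd: "\<And>z. z \<in> S \<Longrightarrow> \<exists>r>0. \<exists>M. \<forall>w\<in>ball z r. norm (f w) \<le> M"
    and hol: "\<And>x y. (\<lambda>w. matrix_coeff x y (f w)) holomorphic_on S"
  shows "vec_holomorphic_on f S"
  unfolding vec_holomorphic_on_def
proof
  fix z assume z: "z \<in> S"
  obtain r1 M where r1: "0 < r1" and M: "\<And>w. w \<in> ball z r1 \<Longrightarrow> norm (f w) \<le> M"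
    using bd[OF z] by blast
  obtain r2 where r2: "0 < r2" "ball z r2 \<subseteq> S" using S z by (auto simp: open_contains_ball)
  define r where "r = min r1 r2"
  have r: "0 < r" "ball z r \<subseteq> S" "\<And>w. w \<in> ball z r \<Longrightarrow> norm (f w) \<le> M"
    using r1 r2 M by (auto simp: r_def)
  have M0: "0 \<le> M" using order_trans[OF norm_ge_zero r(3)[of z]] r(1) by simp
  define K where "K = 18 / r\<^sup>2 * M"
  have K: "0 \<le> K" using M0 by (simp add: K_def)
  define Q where "Q = (\<lambda>w. inverse (w - z) *\<^sub>C (f w - f z))"
  have Qest: "cmod (matrix_coeff x y (Q w) - deriv (\<lambda>w. matrix_coeff x y (f w)) z)
      \<le> K * cmod (w - z) * norm x * norm y" if w: "w \<in> ball z (r / 2)" "w \<noteq> z" for w x y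
  proof -
    have "cmod (matrix_coeff x y (f v)) \<le> M * norm x * norm y" if "v \<in> ball z r" for v
      using norm_matrix_coeff_le[of y "f v" x] r(3)[OF that]
      by (meson mult_right_mono norm_ge_zero order_trans)
    from difference_quotient_estimate[OF holomorphic_on_subset[OF hol r(2)] this r(1) w]
    show ?thesis
      by (simp add: Q_def scaleC_blinfun.rep_eq cdual_scaleC blinfun.diff_left cdual_diff K_def mult_ac)
  qed
  have Qdiff: "norm (Q v - Q w) \<le> K * (cmod (v - z) + cmod (w - z))"
    if "v \<in> ball z (r / 2)" "v \<noteq> z" "w \<in> ball z (r / 2)" "w \<noteq> z" for v w
  proof (rule matrix_coeff_norming)
    show "0 \<le> K * (cmod (v - z) + cmod (w - z))" using K by simp
    fix x y
    let ?d = "deriv (\<lambda>w. matrix_coeff x y (f w)) z"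
    have "cmod (matrix_coeff x y (Q v - Q w))
        = cmod ((matrix_coeff x y (Q v) - ?d) - (matrix_coeff x y (Q w) - ?d))"
      by (simp add: blinfun.diff_left cdual_diff)
    also have "\<dots> \<le> cmod (matrix_coeff x y (Q v) - ?d) + cmod (matrix_coeff x y (Q w) - ?d)"
      by (rule norm_triangle_ineq4)
    also have "\<dots> \<le> K * cmod (v - z) * norm x * norm y + K * cmod (w - z) * norm x * norm y"
      by (intro add_mono Qest that)
    finally show "cmod (matrix_coeff x y (Q v - Q w))
        \<le> K * (cmod (v - z) + cmod (w - z)) * norm x * norm y"
      by (simp add: algebra_simps)
  qed
  \<comment> \<open>Completeness yields a candidate for the derivative along a sequence tending to
    z; the factor r/3 keeps it in the half ball where the estimates hold.\<close>
  define s where "s = (\<lambda>n. z + of_real (r / 3 / real (Suc n)))"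
  have s: "s n \<in> ball z (r / 2)" "s n \<noteq> z" "cmod (s n - z) = r / 3 / real (Suc n)" for n
  proof -
    show eq: "cmod (s n - z) = r / 3 / real (Suc n)"
      using r(1) by (simp add: s_def norm_divide norm_mult del: of_real_divide)
    have "r / 3 / real (Suc n) \<le> r / 3" using r(1) by (simp add: field_simps)
    then show "s n \<in> ball z (r / 2)" using eq r(1) by (simp add: dist_norm norm_minus_commute)
    show "s n \<noteq> z" using eq r(1) by auto
  qed
  have s0: "(\<lambda>n. cmod (s n - z)) \<longlonglongrightarrow> 0"
    unfolding s(3) using tendsto_mult_right_zero[OF LIMSEQ_Suc[OF lim_1_over_n], of "r / 3"] by simp
  have "Cauchy (\<lambda>n. Q (s n))"
  proof (rule metric_CauchyI)
    fix e :: real assume e: "0 < e"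
    have "(\<lambda>n. K * cmod (s n - z)) \<longlonglongrightarrow> 0" by (rule tendsto_mult_right_zero[OF s0])
    then have "\<forall>\<^sub>F n in sequentially. K * cmod (s n - z) < e / 2"
      by (rule order_tendstoD) (use e in simp)
    then obtain N where N: "\<And>n. n \<ge> N \<Longrightarrow> K * cmod (s n - z) < e / 2"
      by (auto simp: eventually_sequentially)
    show "\<exists>N. \<forall>m\<ge>N. \<forall>n\<ge>N. dist (Q (s m)) (Q (s n)) < e"
    proof (intro exI allI impI)
      fix m n assume "N \<le> m" "N \<le> n"
      then have "K * (cmod (s m - z) + cmod (s n - z)) < e" using N[of m] N[of n] by (simp add: distrib_left)
      then show "dist (Q (s m)) (Q (s n)) < e"
        unfolding dist_norm using Qdiff[OF s(1,2) s(1,2), of m n] by linarith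
    qed
  qed
  then obtain D where D: "(\<lambda>n. Q (s n)) \<longlonglongrightarrow> D"
    using Cauchy_convergent by (auto simp: convergent_def)
  \<comment> \<open>With w fixed, v in \<open>Qdiff\<close> runs along the sequence; this gives
    convergence of the quotient from all directions, at a linear rate.\<close>
  have "norm (Q w - D) \<le> K * cmod (w - z)" if w: "w \<in> ball z (r / 2)" "w \<noteq> z" for w
  proof (rule tendsto_le)
    show "(\<lambda>n. norm (Q w - Q (s n))) \<longlonglongrightarrow> norm (Q w - D)" by (intro tendsto_intros D)
    have "(\<lambda>n. K * (cmod (w - z) + cmod (s n - z))) \<longlonglongrightarrow> K * (cmod (w - z) + 0)"
      by (intro tendsto_intros s0)
    then show "(\<lambda>n. K * (cmod (w - z) + cmod (s n - z))) \<longlonglongrightarrow> K * cmod (w - z)" by simp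
    show "\<forall>\<^sub>F n in sequentially. norm (Q w - Q (s n)) \<le> K * (cmod (w - z) + cmod (s n - z))"
      by (intro always_eventually allI Qdiff w s)
  qed simp
  then have "\<forall>\<^sub>F w in at z. norm (Q w - D) \<le> K * cmod (w - z)"
    using r(1) by (auto simp: eventually_at dist_commute intro!: exI[of _ "r / 2"])
  moreover have "((\<lambda>w. K * cmod (w - z)) \<longlongrightarrow> 0) (at z)"
    by (rule tendsto_eq_intros refl | simp)+
  ultimately have "((\<lambda>w. Q w - D) \<longlongrightarrow> 0) (at z)" by (rule Lim_null_comparison)
  then have "(Q \<longlongrightarrow> D) (at z)" by (rule LIM_zero_cancel)
  then show "\<exists>D. has_vec_cderiv f D z" unfolding has_vec_cderiv_def Q_def by blast
qed

text \<open>Convergence of the difference quotients at the single point z bounds them nearby, and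
  hence f. The radius is kept at most 1 so that the factor |w - z| can be estimated by 1.\<close>

lemma has_vec_cderiv_imp_locally_bounded:
  assumes "has_vec_cderiv f D z"
  obtains r M where "0 < r" "\<And>w. w \<in> ball z r \<Longrightarrow> norm (f w) \<le> M"
proof -
  let ?Q = "\<lambda>w. inverse (w - z) *\<^sub>C (f w - f z)"
  have "((\<lambda>w. norm (?Q w)) \<longlongrightarrow> norm D) (at z)"
    using assms unfolding has_vec_cderiv_def by (rule tendsto_norm)
  then have "\<forall>\<^sub>F w in at z. norm (?Q w) < norm D + 1" by (rule order_tendstoD) simp
  then obtain d where d: "0 < d" "\<And>w. w \<noteq> z \<Longrightarrow> dist w z < d \<Longrightarrow> norm (?Q w) < norm D + 1"
    by (auto simp: eventually_at)
  show ?thesis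
  proof
    show "0 < min d 1" using d by simp
    fix w assume w: "w \<in> ball z (min d 1)"
    show "norm (f w) \<le> norm (f z) + (norm D + 1)"
    proof (cases "w = z")
      case False
      then have "norm (f w - f z) = cmod (w - z) * norm (?Q w)"
        by (simp add: norm_scaleC norm_inverse)
      also have "\<dots> \<le> 1 * (norm D + 1)"
        using d(2)[OF False] w by (intro mult_mono) (auto simp: dist_norm norm_minus_commute less_imp_le)
      finally have "norm (f w - f z) \<le> norm D + 1" by simp
      then show ?thesis by (intro order_trans[OF norm_triangle_sub[of "f w" "f z"]] add_left_mono)
    qed simp
  qed
qed

text \<open>This is what permits iterating \<open>vec_cderiv\<close>. The matrix coefficients of the
  derivative are derivatives of matrix coefficients, and Cauchy's inequality for these, uniform in x
  and y, gives local boundedness; the weak criterion then applies.\<close>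

lemma vec_holomorphic_on_vec_cderiv:
  fixes f :: "complex \<Rightarrow> 'a :: real_normed_vector \<Rightarrow>\<^sub>L 'b :: {real_inner, complex_normed_vector, banach}"
  assumes f: "vec_holomorphic_on f S" and S: "open S"
  shows "vec_holomorphic_on (vec_cderiv f) S"
proof (rule vec_holomorphic_onI_weak[OF S])
  fix x :: 'a and y :: 'b
  have "deriv (\<lambda>w. matrix_coeff x y (f w)) holomorphic_on S"
    by (intro holomorphic_deriv holomorphic_on_matrix_coeff f S)
  then show "(\<lambda>w. matrix_coeff x y (vec_cderiv f w)) holomorphic_on S"
    by (rule holomorphic_transform) (rule deriv_matrix_coeff[OF f])
next
  fix z assume z: "z \<in> S"
  obtain r1 M where r1: "0 < r1" and M: "\<And>w. w \<in> ball z r1 \<Longrightarrow> norm (f w) \<le> M"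
    using has_vec_cderiv_imp_locally_bounded[OF has_vec_cderiv_vec_cderiv[OF f z]] by blast
  obtain r2 where r2: "0 < r2" "ball z r2 \<subseteq> S" using S z by (auto simp: open_contains_ball)
  define r where "r = min r1 r2"
  have r: "0 < r" "ball z r \<subseteq> S" "\<And>w. w \<in> ball z r \<Longrightarrow> norm (f w) \<le> M"
    using r1 r2 M by (auto simp: r_def)
  have M0: "0 \<le> M" using order_trans[OF norm_ge_zero r(3)[of z]] r(1) by simp
  have "norm (vec_cderiv f w) \<le> M / (r / 3)" if w: "w \<in> ball z (r / 2)" for w
  proof (rule matrix_coeff_norming)
    show "0 \<le> M / (r / 3)" using M0 r(1) by simp
    fix x :: 'a and y :: 'b
    have B: "cmod (matrix_coeff x y (f v)) \<le> M * norm x * norm y" if "v \<in> ball z r" for v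
      using norm_matrix_coeff_le[of y "f v" x] r(3)[OF that]
      by (meson mult_right_mono norm_ge_zero order_trans)
    have "w \<in> S" using w r by auto
    then show "cmod (matrix_coeff x y (vec_cderiv f w)) \<le> M / (r / 3) * norm x * norm y"
      using Cauchy_inequality_half_ball[OF holomorphic_on_subset[OF holomorphic_on_matrix_coeff[OF f] r(2)] B r(1) w, of 1]
      by (simp add: deriv_matrix_coeff[OF f] mult_ac)
  qed
  then show "\<exists>r>0. \<exists>M. \<forall>w\<in>ball z r. norm (vec_cderiv f w) \<le> M"
    using r(1) by (intro exI[of _ "r / 2"] conjI exI[of _ "M / (r / 3)"] ballI) auto
qed

lemma vec_holomorphic_on_higher_vec_cderiv:
  fixes f :: "complex \<Rightarrow> 'a :: real_normed_vector \<Rightarrow>\<^sub>L 'b :: {real_inner, complex_normed_vector, banach}"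
  assumes "vec_holomorphic_on f S" "open S"
  shows "vec_holomorphic_on ((vec_cderiv ^^ k) f) S"
  by (induction k) (auto intro: assms vec_holomorphic_on_vec_cderiv)

lemma higher_deriv_matrix_coeff:
  fixes f :: "complex \<Rightarrow> 'a :: real_normed_vector \<Rightarrow>\<^sub>L 'b :: {real_inner, complex_normed_vector, banach}"
  assumes f: "vec_holomorphic_on f S" and S: "open S" and z: "z \<in> S"
  shows "(deriv ^^ k) (\<lambda>w. matrix_coeff x y (f w)) z = matrix_coeff x y ((vec_cderiv ^^ k) f z)"
  using z
proof (induction k arbitrary: z)
  case (Suc k)
  have "\<forall>\<^sub>F w in nhds z. (deriv ^^ k) (\<lambda>w. matrix_coeff x y (f w)) w = matrix_coeff x y ((vec_cderiv ^^ k) f w)"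
    using eventually_nhds_in_open[OF S Suc.prems] by eventually_elim (rule Suc.IH)
  then have "deriv ((deriv ^^ k) (\<lambda>w. matrix_coeff x y (f w))) z
      = deriv (\<lambda>w. matrix_coeff x y ((vec_cderiv ^^ k) f w)) z"
    by (rule deriv_cong_ev) simp
  also have "\<dots> = matrix_coeff x y (vec_cderiv ((vec_cderiv ^^ k) f) z)"
    by (rule deriv_matrix_coeff[OF vec_holomorphic_on_higher_vec_cderiv[OF f S] Suc.prems])
  finally show ?case by simp
qed simp

section \<open>The CF class\<close>

text \<open>Cauchy's inequality on circles of radius below 1, as f need not extend continuously to
  the closed disc; the radius then tends to 1.\<close>

lemma taylor_coeff_bound:
  assumes f: "f holomorphic_on ball 0 1" and B: "\<And>z. cmod z < 1 \<Longrightarrow> cmod (f z) \<le> B"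
  shows "cmod ((deriv ^^ n) f 0 / fact n) \<le> B"
proof -
  define r where "r = (\<lambda>m. 1 - 1 / real (Suc (Suc m)))"
  have r: "0 < r m" "r m < 1" for m by (auto simp: r_def)
  have "cmod ((deriv ^^ n) f 0) \<le> fact n * B / r m ^ n" for m
  proof (rule Cauchy_inequality)
    show "f holomorphic_on ball 0 (r m)"
      by (rule holomorphic_on_subset[OF f]) (use r[of m] in auto)
    show "continuous_on (cball 0 (r m)) f"
      by (rule continuous_on_subset[OF holomorphic_on_imp_continuous_on[OF f]]) (use r[of m] in auto)
    show "cmod (f z) \<le> B" if "cmod (0 - z) = r m" for z
      using that r[of m] by (intro B) simp
  qed (rule r)
  moreover have "(\<lambda>m. fact n * B / r m ^ n) \<longlonglongrightarrow> fact n * B / (1 - 0) ^ n"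
    unfolding r_def by (intro tendsto_intros LIMSEQ_Suc[OF LIMSEQ_Suc[OF lim_1_over_n]]) auto
  ultimately have "cmod ((deriv ^^ n) f 0) \<le> fact n * B / (1 - 0) ^ n"
    by (intro tendsto_lowerbound[OF _ always_eventually]) auto
  then show ?thesis by (simp add: norm_divide divide_le_eq mult.commute)
qed

lemma higher_deriv_0_power_series:
  fixes f :: "complex \<Rightarrow> complex"
  assumes "\<And>w. cmod w < 1 \<Longrightarrow> (\<lambda>n. a n * w ^ n) sums f w"
  shows "(deriv ^^ n) f 0 = fact n * a n"
proof -
  have "\<forall>\<^sub>F w in nhds 0. w \<in> ball (0 :: complex) 1"
    by (intro eventually_nhds_in_open) auto
  then have "\<forall>\<^sub>F w in nhds 0. (\<lambda>n. fps_nth (Abs_fps a) n * w ^ n) sums f w"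
    by eventually_elim (simp add: assms)
  then have "f has_fps_expansion Abs_fps a" by (rule has_fps_expansionI)
  from fps_nth_fps_expansion[OF this, of n] show ?thesis by simp
qed

definition contractive_symbols :: "(nat \<Rightarrow> complex poly) \<Rightarrow> bool" where
  "contractive_symbols p \<longleftrightarrow> (\<forall>k\<ge>1. degree (p k) \<le> k) \<and>
     (\<forall>t. cmod t = 1 \<longrightarrow> toeplitz_contraction (\<lambda>k. poly (p (Suc k)) t))"

text \<open>A common multiplication operator has the same approximate eigenvalues, so the symbols
  agree on the circle, and a polynomial vanishing there has zero coefficients. The CF class mentions
  its symbols only through operators; this recovers them.\<close>

lemma mult_poly_inject:
  assumes "mult_poly p = mult_poly q"
  shows "p = q"
proof -
  have "poly p t = poly q t" if t: "cmod t = 1" for t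
  proof -
    obtain h where h: "\<And>n. norm (h n) = 1"
      and ev: "\<And>p. (\<lambda>n. blinfun_apply (mult_poly p) (h n) - poly p t *\<^sub>C h n) \<longlonglongrightarrow> 0"
      using approximate_eigenvectors[OF t] by blast
    have "(poly q t - poly p t) *\<^sub>C x = (y - poly p t *\<^sub>C x) - (y - poly q t *\<^sub>C x)"
      for x y :: L2_circle
      using scaleC_add_left[of "poly q t - poly p t" "poly p t" x] by simp
    then have "(\<lambda>n. (poly q t - poly p t) *\<^sub>C h n) \<longlonglongrightarrow> 0"
      using tendsto_diff[OF ev[of p] ev[of q]] assms by simp
    from tendsto_norm[OF this] have "(\<lambda>n :: nat. cmod (poly q t - poly p t)) \<longlonglongrightarrow> 0"
      by (simp add: norm_scaleC h)
    then show ?thesis by (simp add: LIMSEQ_const_iff)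
  qed
  then have "cmod (coeff (p - q) k) \<le> 0" for k
    by (intro coeff_le_sup_circle) simp
  then show ?thesis by (intro poly_eqI) simp
qed

lemma scaleC_quadratic_inject:
  fixes A1 A2 B1 B2 :: "'a :: complex_normed_vector"
  assumes "(\<lambda>z. z *\<^sub>C A1 + z\<^sup>2 *\<^sub>C A2) = (\<lambda>z. z *\<^sub>C B1 + z\<^sup>2 *\<^sub>C B2)"
  shows "A1 = B1" "A2 = B2"
proof -
  have 1: "A1 + A2 = B1 + B2" using fun_cong[OF assms, of 1] by (simp add: scaleC_one)
  have "- A1 + A2 = - B1 + B2"
    using fun_cong[OF assms, of "- 1"] scaleC_of_real[of "- 1" A1] scaleC_of_real[of "- 1" B1]
    by (simp add: scaleC_one)
  with 1 have "(A1 + A2) - (- A1 + A2) = (B1 + B2) - (- B1 + B2)" by simp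
  then have "2 *\<^sub>R A1 = 2 *\<^sub>R B1" by (simp add: scaleR_2)
  then show "A1 = B1" by simp
  with 1 show "A2 = B2" by simp
qed

text \<open>Along approximate eigenvectors \<open>h\<^sub>n\<close> at \<open>t\<close>, the Taylor coefficients of the scalar functions
  \<open>\<langle>f(z) h\<^sub>n, h\<^sub>n\<rangle>\<close> converge to \<open>p\<^sub>k(t)\<close>.\<close>

lemma holomorphic_contraction_imp_toeplitz_contraction:
  fixes f :: "complex \<Rightarrow> L2_circle \<Rightarrow>\<^sub>L L2_circle"
  assumes hol: "vec_holomorphic_on f unit_disc" and f0: "f 0 = 0"
    and coeffs: "\<And>k. k \<ge> 1 \<Longrightarrow> inverse (fact k) *\<^sub>C (vec_cderiv ^^ k) f 0 = mult_poly (p k)"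
    and le1: "\<And>z. z \<in> unit_disc \<Longrightarrow> norm (f z) \<le> 1" and t: "cmod t = 1"
  shows "toeplitz_contraction (\<lambda>k. poly (p (Suc k)) t)"
proof -
  obtain h where h: "\<And>n. norm (h n) = 1"
    and ev: "\<And>p. (\<lambda>n. blinfun_apply (mult_poly p) (h n) - poly p t *\<^sub>C h n) \<longlonglongrightarrow> 0"
    using approximate_eigenvectors[OF t] by blast
  define G where "G = (\<lambda>n z. matrix_coeff (h n) (h n) (f z))"
  have G: "G n holomorphic_on ball 0 1" for n
    unfolding G_def by (rule holomorphic_on_matrix_coeff[OF hol])
  have Gle: "cmod (G n z) \<le> 1" if "cmod z < 1" for n z
    using norm_matrix_coeff_le[of "h n" "f z" "h n"] le1[of z] that by (simp add: G_def h)
  \<comment> \<open>By \<open>coeffs\<close> these are the Taylor coefficients of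
    \<open>G n\<close>, shifted by one: \<open>c n k\<close> has number k + 1.\<close>
  define c where "c = (\<lambda>n k. matrix_coeff (h n) (h n) (mult_poly (p (Suc k))))"
  have c: "c n k = (deriv ^^ Suc k) (G n) 0 / fact (Suc k)" for n k
  proof -
    have "(deriv ^^ Suc k) (G n) 0 = matrix_coeff (h n) (h n) ((vec_cderiv ^^ Suc k) f 0)"
      unfolding G_def by (intro higher_deriv_matrix_coeff[OF hol]) auto
    moreover have "c n k = inverse (fact (Suc k)) * matrix_coeff (h n) (h n) ((vec_cderiv ^^ Suc k) f 0)"
      unfolding c_def
      by (simp only: coeffs[symmetric] le_add1 Suc_eq_plus1_left scaleC_blinfun.rep_eq cdual_scaleC)
    ultimately show ?thesis by (simp add: field_simps)
  qed
  have "toeplitz_contraction (c n)" for n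
  proof (rule Schur_imp_toeplitz_contraction)
    show "cmod (c n k) \<le> 1" for k unfolding c by (rule taylor_coeff_bound[OF G Gle])
    fix z :: complex assume z: "cmod z < 1"
    define T where "T = (\<lambda>k. (deriv ^^ k) (G n) 0 / fact k * z ^ k)"
    have "T sums G n z"
      using holomorphic_power_series[OF G, of z n] z by (simp add: T_def)
    then have "(\<lambda>k. T (Suc k)) sums (G n z - T 0)"
      by (simp add: sums_Suc_iff)
    then have "(\<lambda>k. c n k * z ^ Suc k) sums (G n z - G n 0)"
      unfolding T_def c by simp
    moreover have "G n 0 = 0" by (simp add: G_def f0 linear_0[OF bounded_linear.linear[OF bounded_linear_cdual]])
    ultimately have "(\<Sum>k. c n k * z ^ Suc k) = G n z" by (simp add: sums_iff)
    then show "cmod (\<Sum>k. c n k * z ^ Suc k) \<le> 1" using Gle[OF z] by simp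
  qed
  then show ?thesis
  proof (intro toeplitz_contraction_limit)
    fix k
    let ?M = "mult_poly (p (Suc k))"
    \<comment> \<open>Since h n is a unit vector, the eigenvalue part contributes exactly
      p_(k+1)(t); the remainder is the eigenvector defect.\<close>
    have "c n k = cdual (h n) (blinfun_apply ?M (h n) - poly (p (Suc k)) t *\<^sub>C h n) + poly (p (Suc k)) t" for n
      by (simp add: c_def cdual_diff cdual_scaleC cdual_self h)
    moreover have "(\<lambda>n. cdual (h n) (blinfun_apply ?M (h n) - poly (p (Suc k)) t *\<^sub>C h n)) \<longlonglongrightarrow> 0"
    proof (rule Lim_null_comparison[OF always_eventually])
      show "\<forall>n. cmod (cdual (h n) (blinfun_apply ?M (h n) - poly (p (Suc k)) t *\<^sub>C h n))
          \<le> norm (blinfun_apply ?M (h n) - poly (p (Suc k)) t *\<^sub>C h n)"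
        using norm_cdual_le[of "h _"] h by (metis mult.right_neutral)
    qed (rule tendsto_norm_zero[OF ev])
    ultimately show "(\<lambda>n. c n k) \<longlonglongrightarrow> poly (p (Suc k)) t"
      using tendsto_add[OF _ tendsto_const] by fastforce
  qed (simp add: toeplitz_contraction_def)
qed

lemma contractive_symbols_norm_le:
  assumes "contractive_symbols p"
  shows "norm (mult_poly (p (Suc k))) \<le> 1"
  using assms unfolding contractive_symbols_def
  by (intro norm_mult_poly_le) (use toeplitz_contraction_bound in blast)

text \<open>The witness is the operator power series with the given coefficients. Its partial sums
  are themselves multiplications by polynomials, so their norms can be bounded pointwise on the
  circle by the scalar criterion.\<close>

lemma contractive_symbols_imp_CF_class:
  assumes p: "contractive_symbols p"
  shows "(\<lambda>z. z *\<^sub>C mult_poly (p 1) + z\<^sup>2 *\<^sub>C mult_poly (p 2)) \<in> CF_class"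
proof -
  define A where "A = (\<lambda>k. mult_poly (p (Suc k)))"
  define f where "f = (\<lambda>z. \<Sum>k. z ^ Suc k *\<^sub>C A k)"
  have A: "norm (A k) \<le> 1" for k
    unfolding A_def by (rule contractive_symbols_norm_le[OF p])
  have sm: "summable (\<lambda>k. z ^ Suc k *\<^sub>C A k)" if z: "cmod z < 1" for z
  proof (rule summable_comparison_test')
    show "summable (\<lambda>k. cmod z ^ k)" using z by (intro summable_geometric) simp
    show "norm (z ^ Suc k *\<^sub>C A k) \<le> cmod z ^ k" for k
    proof -
      have "norm (z ^ Suc k *\<^sub>C A k) = cmod z * (cmod z ^ k * norm (A k))"
        by (simp add: norm_scaleC norm_mult norm_power)
      also have "\<dots> \<le> 1 * (cmod z ^ k * 1)"
        using z A[of k] by (intro mult_mono) (auto intro: less_imp_le)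
      finally show ?thesis by simp
    qed
  qed
  \<comment> \<open>Taylor coefficients of a matrix coefficient of f; the constant term 0 restores
    the usual indexing.\<close>
  define a where "a = (\<lambda>x y k. case k of 0 \<Rightarrow> 0 | Suc k \<Rightarrow> matrix_coeff x y (A k))"
  have sums: "(\<lambda>k. a x y k * z ^ k) sums matrix_coeff x y (f z)" if z: "cmod z < 1" for x y z
  proof -
    have bl: "bounded_linear (matrix_coeff x y :: (L2_circle \<Rightarrow>\<^sub>L L2_circle) \<Rightarrow> complex)"
      by (rule bounded_linear_compose[OF bounded_linear_cdual blinfun.bounded_linear_left])
    have "(\<lambda>k. matrix_coeff x y (z ^ Suc k *\<^sub>C A k)) sums matrix_coeff x y (f z)"
      unfolding f_def by (rule bounded_linear.sums[OF bl summable_sums[OF sm[OF z]]])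
    then have "(\<lambda>k. a x y (Suc k) * z ^ Suc k) sums matrix_coeff x y (f z)"
      by (simp add: scaleC_blinfun.rep_eq cdual_scaleC a_def mult.commute)
    then show ?thesis
      using sums_Suc[of "\<lambda>k. a x y k * z ^ k"] by (simp add: a_def)
  qed
  have le1: "norm (f z) \<le> 1" if z: "z \<in> unit_disc" for z
  proof -
    have z: "cmod z < 1" using that by simp
    \<comment> \<open>The bound 1 holds only in the limit; the excess of the partial sums comes from
      truncating the scalar series at each t.\<close>
    have "norm (\<Sum>k<K. z ^ Suc k *\<^sub>C A k) \<le> 1 + cmod z ^ Suc K / (1 - cmod z)" for K
    proof -
      have "(\<Sum>k<K. z ^ Suc k *\<^sub>C A k) = mult_poly (\<Sum>k<K. Polynomial.smult (z ^ Suc k) (p (Suc k)))"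
        unfolding A_def by (simp only: mult_poly_sum finite_lessThan mult_poly_smult)
      moreover have "norm (mult_poly (\<Sum>k<K. Polynomial.smult (z ^ Suc k) (p (Suc k))))
          \<le> 1 + cmod z ^ Suc K / (1 - cmod z)"
      proof (rule norm_mult_poly_le)
        fix t :: complex assume t: "cmod t = 1"
        let ?c = "\<lambda>k. poly (p (Suc k)) t"
        have c: "toeplitz_contraction ?c" using p t by (simp add: contractive_symbols_def)
        have b: "cmod (?c k) \<le> 1" for k by (rule toeplitz_contraction_bound[OF c])
        have "cmod (\<Sum>k. ?c k * z ^ Suc k) \<le> 1"
        proof -
          have "summable (\<lambda>k. ?c k * z ^ k)"
            by (rule summable_norm_cancel[OF summable_bounded_powser[OF b z]])
          from suminf_mult[OF this, of z] have "(\<Sum>k. ?c k * z ^ Suc k) = z * (\<Sum>k. ?c k * z ^ k)"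
            by (simp add: mult_ac)
          then show ?thesis
            using toeplitz_contraction_imp_Schur[OF c z] z by (simp add: norm_mult mult_le_one)
        qed
        from Schur_partial_sum_le[of ?c, OF b z this, of K]
        show "cmod (poly (\<Sum>k<K. Polynomial.smult (z ^ Suc k) (p (Suc k))) t)
            \<le> 1 + cmod z ^ Suc K / (1 - cmod z)"
          by (simp add: poly_sum mult.commute)
      qed
      ultimately show ?thesis by simp
    qed
    moreover have "(\<lambda>K. norm (\<Sum>k<K. z ^ Suc k *\<^sub>C A k)) \<longlonglongrightarrow> norm (f z)"
      unfolding f_def by (intro tendsto_norm summable_LIMSEQ sm z)
    moreover have "(\<lambda>K. 1 + cmod z ^ Suc K / (1 - cmod z)) \<longlonglongrightarrow> 1 + 0 / (1 - cmod z)"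
      using z by (intro tendsto_intros LIMSEQ_Suc[OF LIMSEQ_power_zero]) auto
    ultimately show ?thesis
      by (intro tendsto_le[OF _ _ _ always_eventually, of sequentially "\<lambda>K. 1 + cmod z ^ Suc K / (1 - cmod z)"]) auto
  qed
  have hol: "vec_holomorphic_on f unit_disc"
  proof (rule vec_holomorphic_onI_weak)
    show "\<exists>r>0. \<exists>M. \<forall>w\<in>ball z r. norm (f w) \<le> M" if "z \<in> unit_disc" for z
    proof -
      have "ball z (1 - cmod z) \<subseteq> unit_disc"
        by (auto simp: dist_norm) (smt (verit) norm_triangle_sub norm_minus_commute)
      then show ?thesis using that le1 by (intro exI[of _ "1 - cmod z"] conjI exI[of _ 1] ballI) auto
    qed
    show "(\<lambda>w. matrix_coeff x y (f w)) holomorphic_on unit_disc" for x y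
      by (rule power_series_holomorphic[where a = "a x y"]) (simp add: sums)
  qed simp
  have clin: "clinear_op (f z)" if z: "z \<in> unit_disc" for z
    unfolding clinear_op_def
  proof (intro allI)
    fix c x
    have S: "(\<lambda>k. blinfun_apply (z ^ Suc k *\<^sub>C A k) x) sums blinfun_apply (f z) x" for x
      unfolding f_def using z
      by (intro bounded_linear.sums[OF blinfun.bounded_linear_left] summable_sums sm) simp
    have "(\<lambda>k. c *\<^sub>C blinfun_apply (z ^ Suc k *\<^sub>C A k) x) sums (c *\<^sub>C blinfun_apply (f z) x)"
      by (rule bounded_linear.sums[OF bounded_linear_scaleC S])
    moreover have "c *\<^sub>C blinfun_apply (z ^ Suc k *\<^sub>C A k) x = blinfun_apply (z ^ Suc k *\<^sub>C A k) (c *\<^sub>C x)" for k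
      using clinear_op_mult_poly[of "p (Suc k)"]
      by (simp add: clinear_op_def A_def scaleC_blinfun.rep_eq scaleC_scaleC mult.commute)
    ultimately show "blinfun_apply (f z) (c *\<^sub>C x) = c *\<^sub>C blinfun_apply (f z) x"
      using sums_unique2[OF S[of "c *\<^sub>C x"]] by simp
  qed
  have derivs: "inverse (fact k) *\<^sub>C (vec_cderiv ^^ k) f 0 = mult_poly (p k)" if k: "k \<ge> 1" for k
  proof -
    let ?D = "inverse (fact k) *\<^sub>C (vec_cderiv ^^ k) f 0"
    have "matrix_coeff x y ?D = matrix_coeff x y (mult_poly (p k))" for x y
    proof -
      have "fact k * a x y k = matrix_coeff x y ((vec_cderiv ^^ k) f 0)"
        using higher_deriv_0_power_series[OF sums[of _ x y], of k] higher_deriv_matrix_coeff[OF hol, of 0 k y x]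
        by simp
      moreover have "a x y k = matrix_coeff x y (mult_poly (p k))"
        using k by (cases k) (auto simp: a_def A_def)
      ultimately show ?thesis by (simp add: scaleC_blinfun.rep_eq cdual_scaleC field_simps)
    qed
    \<comment> \<open>Matrix coefficients separate operators: the norming lemma with K = 0.\<close>
    then have "norm (?D - mult_poly (p k)) \<le> 0"
      by (intro matrix_coeff_norming) (simp_all add: blinfun.diff_left cdual_diff)
    then show ?thesis by simp
  qed
  have "f 0 = 0"
  proof -
    have "0 *\<^sub>C X = 0" for X :: "L2_circle \<Rightarrow>\<^sub>L L2_circle" using scaleC_of_real[of 0 X] by simp
    then show ?thesis by (simp add: f_def)
  qed
  then show ?thesis
    unfolding CF_class_def
    using p clin hol derivs le1 by (intro CollectI exI[of _ p] exI[of _ f]) (auto simp: contractive_symbols_def)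
qed

lemma CF_class_iff_contractive_symbols:
  "(\<lambda>z. z *\<^sub>C mult_poly p1 + z\<^sup>2 *\<^sub>C mult_poly p2) \<in> CF_class
     \<longleftrightarrow> (\<exists>p. contractive_symbols p \<and> p 1 = p1 \<and> p 2 = p2)"
proof
  assume "(\<lambda>z. z *\<^sub>C mult_poly p1 + z\<^sup>2 *\<^sub>C mult_poly p2) \<in> CF_class"
  then obtain p f where deg: "\<forall>k\<ge>1. degree (p k) \<le> k"
    and eq: "(\<lambda>z. z *\<^sub>C mult_poly p1 + z\<^sup>2 *\<^sub>C mult_poly p2)
        = (\<lambda>z. z *\<^sub>C mult_poly (p 1) + z\<^sup>2 *\<^sub>C mult_poly (p 2))"
    and f: "vec_holomorphic_on f unit_disc" "f 0 = 0"
      "\<forall>k\<ge>1. inverse (fact k) *\<^sub>C (vec_cderiv ^^ k) f 0 = mult_poly (p k)"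
      "\<forall>z\<in>unit_disc. norm (f z) \<le> 1"
    unfolding CF_class_def by blast
  have "contractive_symbols p"
    unfolding contractive_symbols_def
    using deg holomorphic_contraction_imp_toeplitz_contraction[of f p] f by blast
  moreover have "p 1 = p1" "p 2 = p2"
    using scaleC_quadratic_inject[OF eq] mult_poly_inject by metis+
  ultimately show "\<exists>p. contractive_symbols p \<and> p 1 = p1 \<and> p 2 = p2" by blast
qed (auto dest: contractive_symbols_imp_CF_class)

section \<open>Polynomial extendibility\<close>

lemma toeplitz_norm_le_1_iff:
  "toeplitz_norm (map mult_poly ps) \<le> 1 \<longleftrightarrow>
     (\<forall>t. cmod t = 1 \<longrightarrow> toeplitz_contraction_upto (length ps) (\<lambda>k. poly (ps ! k) t))"
  unfolding toeplitz_contraction_upto_def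
  using toeplitz_norm_mult_poly_imp_pointwise toeplitz_norm_mult_poly_le_1 by blast

lemma toeplitz_contraction_upto_cong:
  assumes "\<And>k. k < n \<Longrightarrow> c k = d k"
  shows "toeplitz_contraction_upto n c = toeplitz_contraction_upto n d"
proof -
  have "(\<Sum>j=i..<n. c (j - i) * x j) = (\<Sum>j=i..<n. d (j - i) * x j)" if "i < n" for i and x :: "nat \<Rightarrow> complex"
    using that by (intro sum.cong) (auto simp: assms)
  then show ?thesis by (simp add: toeplitz_contraction_upto_def)
qed

lemma contractive_symbols_imp_completely_poly_extendible:
  assumes p: "contractive_symbols p"
  shows "completely_poly_extendible [p 1, p 2]"
  unfolding completely_poly_extendible_def poly_extendible_def
proof (intro allI impI conjI)
  have norm: "toeplitz_norm (map mult_poly (map (\<lambda>k. p (Suc k)) [0..<m])) \<le> 1" for m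
    unfolding toeplitz_norm_le_1_iff
  proof (intro allI impI)
    fix t :: complex assume "cmod t = 1"
    then have "toeplitz_contraction_upto m (\<lambda>k. poly (p (Suc k)) t)"
      using p by (simp add: contractive_symbols_def toeplitz_contraction_def)
    also have "toeplitz_contraction_upto m (\<lambda>k. poly (p (Suc k)) t)
        = toeplitz_contraction_upto m (\<lambda>k. poly (map (\<lambda>k. p (Suc k)) [0..<m] ! k) t)"
      by (rule toeplitz_contraction_upto_cong) simp
    finally show "toeplitz_contraction_upto (length (map (\<lambda>k. p (Suc k)) [0..<m]))
        (\<lambda>k. poly (map (\<lambda>k. p (Suc k)) [0..<m] ! k) t)"
      by simp
  qed
  have split: "map (\<lambda>k. p (Suc k)) [0..<m] = [p 1, p 2] @ map (\<lambda>k. p (Suc k)) [2..<m]" if "2 \<le> m" for m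
    using that by (simp add: upt_conv_Cons numeral_2_eq_2)
  show "toeplitz_norm (map mult_poly [p 1, p 2]) \<le> 1"
    using norm[of 2] by (simp add: split)
  fix m assume m: "length [p 1, p 2] \<le> m"
  then have s: "[p 1, p 2] @ map (\<lambda>k. p (Suc k)) [2..<m] = map (\<lambda>k. p (Suc k)) [0..<m]"
    by (intro split[symmetric]) simp
  show "\<exists>qs. length ([p 1, p 2] @ qs) = m \<and> (\<forall>l<m. degree (([p 1, p 2] @ qs) ! l) \<le> l + 1)
      \<and> toeplitz_norm (map mult_poly ([p 1, p 2] @ qs)) \<le> 1"
    using p by (intro exI[of _ "map (\<lambda>k. p (Suc k)) [2..<m]"], unfold s)
      (auto simp: norm contractive_symbols_def simp del: map_map)
qed

text \<open>The extensions for different \<open>m\<close> need not be compatible; a diagonal subsequence of their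
  coefficients converges to a single sequence of symbols.\<close>

lemma completely_poly_extendible_imp_contractive_symbols:
  assumes ext: "completely_poly_extendible [p1, p2]"
  shows "\<exists>p. contractive_symbols p \<and> p 1 = p1 \<and> p 2 = p2"
proof -
  have "\<exists>ps. length ps = m \<and> ps ! 0 = p1 \<and> ps ! 1 = p2 \<and> (\<forall>l<m. degree (ps ! l) \<le> l + 1) \<and>
      toeplitz_norm (map mult_poly ps) \<le> 1" if "2 \<le> m" for m
  proof -
    have "poly_extendible m [p1, p2]"
      using ext that by (simp add: completely_poly_extendible_def)
    then obtain qs where "length ([p1, p2] @ qs) = m"
      "\<forall>l<m. degree (([p1, p2] @ qs) ! l) \<le> l + 1" "toeplitz_norm (map mult_poly ([p1, p2] @ qs)) \<le> 1"
      unfolding poly_extendible_def by blast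
    then show ?thesis by (intro exI[of _ "[p1, p2] @ qs"]) auto
  qed
  \<comment> \<open>The shift by 2 lets m range over all natural numbers, with no side condition on
    the choice of extensions.\<close>
  then have "\<exists>L. \<forall>m. length (L m) = m + 2 \<and> L m ! 0 = p1 \<and> L m ! 1 = p2 \<and>
      (\<forall>l<m + 2. degree (L m ! l) \<le> l + 1) \<and> toeplitz_norm (map mult_poly (L m)) \<le> 1"
    by (intro choice) simp
  then obtain L where len: "\<And>m. length (L m) = m + 2"
    and L12: "\<And>m. L m ! 0 = p1" "\<And>m. L m ! 1 = p2"
    and deg: "\<And>m l. l < m + 2 \<Longrightarrow> degree (L m ! l) \<le> l + 1"
    and L: "\<And>m t. cmod t = 1 \<Longrightarrow> toeplitz_contraction_upto (m + 2) (\<lambda>k. poly (L m ! k) t)"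
    unfolding toeplitz_norm_le_1_iff by metis
  \<comment> \<open>Missing list entries are replaced by 0, so that F m is defined for all indices.
    All values lie in the unit disc, since a polynomial that is bounded by 1 on the circle has
    coefficients bounded by 1.\<close>
  define F where "F = (\<lambda>m (k, j). if k < m + 2 then coeff (L m ! k) j else 0)"
  have F_le: "cmod (F m x) \<le> 1" if "x \<in> UNIV" for m x
    using toeplitz_contraction_upto_bound[OF L] by (auto simp: F_def split: prod.split intro!: coeff_le_sup_circle)
  then obtain r where r: "strict_mono (r :: nat \<Rightarrow> nat)" and conv: "\<And>x. x \<in> UNIV \<Longrightarrow> \<exists>l. (\<lambda>n. F (r n) x) \<longlonglongrightarrow> l"
    using function_convergent_subsequence[of UNIV F 1, OF countableI_type F_le] by blast
  from conv[OF UNIV_I] obtain l where l: "\<And>x. (\<lambda>n. F (r n) x) \<longlonglongrightarrow> l x" by metis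
  \<comment> \<open>List position k - 1 belongs to p_k. The bound on the degrees makes finitely many
    coefficients per symbol enough, so their limits give the limit of the symbol.\<close>
  define p where "p = (\<lambda>k. \<Sum>j\<le>k. monom (l (k - 1, j)) j)"
  have cp: "coeff (p k) j = (if j \<le> k then l (k - 1, j) else 0)" for k j
    by (simp add: p_def coeff_sum if_distrib cong: if_cong)
  have lim: "(\<lambda>n. poly (L (r n) ! k) t) \<longlonglongrightarrow> poly (p (Suc k)) t" for k t
  proof (rule Lim_transform_eventually)
    show "(\<lambda>n. \<Sum>j\<le>Suc k. F (r n) (k, j) * t ^ j) \<longlonglongrightarrow> poly (p (Suc k)) t"
      unfolding p_def poly_sum poly_monom by (auto intro!: tendsto_intros l)
    show "\<forall>\<^sub>F n in sequentially. (\<Sum>j\<le>Suc k. F (r n) (k, j) * t ^ j) = poly (L (r n) ! k) t"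
      using eventually_ge_at_top[of k]
    proof eventually_elim
      case (elim n)
      then have k: "k < r n + 2" using strict_mono_imp_increasing[OF r, of n] by linarith
      have "poly (L (r n) ! k) t = (\<Sum>j\<le>Suc k. coeff (L (r n) ! k) j * t ^ j)"
        unfolding poly_altdef using deg[OF k] by (intro sum.mono_neutral_left) (auto simp: coeff_eq_0)
      then show ?case using k by (simp add: F_def)
    qed
  qed
  have "toeplitz_contraction (\<lambda>k. poly (p (Suc k)) t)" if t: "cmod t = 1" for t
  proof (rule toeplitz_contraction_limit[OF _ lim])
    fix n
    show "\<forall>\<^sub>F m in sequentially. toeplitz_contraction_upto n (\<lambda>k. poly (L (r m) ! k) t)"
      using eventually_ge_at_top[of n]
    proof eventually_elim
      case (elim m)
      then have "n \<le> r m + 2" using strict_mono_imp_increasing[OF r, of m] by linarith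
      with L[OF t] show ?case by (rule toeplitz_contraction_upto_mono)
    qed
  qed
  moreover have "degree (p k) \<le> k" for k by (rule degree_le) (simp add: cp)
  ultimately have "contractive_symbols p" by (simp add: contractive_symbols_def)
  \<comment> \<open>The first two symbols are the same in every extension; their coefficients are
    constant along the sequence and survive in the limit.\<close>
  moreover have "p (Suc k) = q" if q: "\<And>m. L m ! k = q" and k: "k < 2" for k q
  proof (rule poly_eqI)
    fix j
    have F: "F m (k, j) = coeff q j" for m j using k by (simp add: F_def q)
    have "(\<lambda>n :: nat. coeff q j) \<longlonglongrightarrow> l (k, j)" using l[of "(k, j)"] by (simp only: F)
    then have "l (k, j) = coeff q j" by (simp add: LIMSEQ_const_iff)
    moreover have "degree q \<le> Suc k" using deg[of k 0] k q by simp
    ultimately show "coeff (p (Suc k)) j = coeff q j"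
      by (auto simp: cp coeff_eq_0)
  qed
  from this[OF L12(1)] this[OF L12(2)] have "p 1 = p1" "p 2 = p2"
    by (simp_all add: numeral_2_eq_2)
  ultimately show ?thesis by blast
qed

lemma completely_poly_extendible_iff_contractive_symbols:
  "completely_poly_extendible [p1, p2] \<longleftrightarrow> (\<exists>p. contractive_symbols p \<and> p 1 = p1 \<and> p 2 = p2)"
  using completely_poly_extendible_imp_contractive_symbols contractive_symbols_imp_completely_poly_extendible
  by blast

section \<open>Power series on the bidisc\<close>

text \<open>Unconditional summation over all pairs, so that the same series can be resummed by rows,
  by columns and by total degree.\<close>

definition bipower_expansion :: "(nat \<Rightarrow> nat \<Rightarrow> complex) \<Rightarrow> (complex \<times> complex \<Rightarrow> complex) \<Rightarrow> bool" where
  "bipower_expansion c q \<longleftrightarrow> (\<forall>z w. cmod z < 1 \<longrightarrow> cmod w < 1 \<longrightarrow>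
     ((\<lambda>(i, j). c i j * z ^ i * w ^ j) has_sum q (z, w)) (UNIV \<times> UNIV))"

lemma bipower_abs_summable:
  fixes c :: "nat \<Rightarrow> nat \<Rightarrow> complex"
  assumes c: "\<And>i j. cmod (c i j) \<le> B" and z: "cmod z < 1" and w: "cmod w < 1"
  shows "(\<lambda>x. cmod (case x of (i, j) \<Rightarrow> c i j * z ^ i * w ^ j)) summable_on (UNIV \<times> UNIV)"
proof -
  have geo: "((\<lambda>n. x ^ n) has_sum (1 / (1 - x))) UNIV" if "0 \<le> x" "x < 1" for x :: real
    using that by (intro norm_summable_imp_has_sum geometric_sums) (auto simp: abs_of_nonneg power_abs intro: summable_geometric)
  have "(\<lambda>(i, j). B * cmod z ^ i * cmod w ^ j) summable_on (UNIV \<times> UNIV)"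
  proof (rule summable_on_SigmaI)
    show "((\<lambda>j. case (i, j) of (i, j) \<Rightarrow> B * cmod z ^ i * cmod w ^ j)
        has_sum (B * cmod z ^ i * (1 / (1 - cmod w)))) UNIV" for i
      using has_sum_cmult_right[OF geo[of "cmod w"]] w by simp
    show "(\<lambda>i. B * cmod z ^ i * (1 / (1 - cmod w))) summable_on UNIV"
      by (rule has_sum_imp_summable[OF has_sum_cmult_left[OF has_sum_cmult_right[OF geo]]]) (use z in auto)
    show "0 \<le> (case (i, j) of (i, j) \<Rightarrow> B * cmod z ^ i * cmod w ^ j)" for i j
      using order_trans[OF norm_ge_zero c[of 0 0]] by simp
  qed
  then show ?thesis
  proof (rule summable_on_comparison_test)
    fix ij :: "nat \<times> nat"
    obtain i j where "ij = (i, j)" by (cases ij)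
    then show "norm (case ij of (i, j) \<Rightarrow> c i j * z ^ i * w ^ j) \<le> (case ij of (i, j) \<Rightarrow> B * cmod z ^ i * cmod w ^ j)"
      by (auto simp: norm_mult norm_power intro!: mult_right_mono c)
  qed auto
qed

lemma bipower_expansion_infsum:
  assumes "\<And>i j. cmod (c i j) \<le> B"
  shows "bipower_expansion c (\<lambda>(z, w). \<Sum>\<^sub>\<infinity>(i, j)\<in>UNIV \<times> UNIV. c i j * z ^ i * w ^ j)"
  unfolding bipower_expansion_def prod.case
proof (intro allI impI has_sum_infsum)
  fix z w :: complex assume "cmod z < 1" "cmod w < 1"
  then show "(\<lambda>(i, j). c i j * z ^ i * w ^ j) summable_on UNIV \<times> UNIV"
    by (rule abs_summable_summable[OF bipower_abs_summable[OF assms]])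
qed

lemma bipower_expansion_add:
  assumes "bipower_expansion c q" "bipower_expansion d r"
  shows "bipower_expansion (\<lambda>i j. c i j + d i j) (\<lambda>z. q z + r z)"
  unfolding bipower_expansion_def
proof (intro allI impI)
  fix z w :: complex assume "cmod z < 1" "cmod w < 1"
  then have "((\<lambda>x. (case x of (i, j) \<Rightarrow> c i j * z ^ i * w ^ j) + (case x of (i, j) \<Rightarrow> d i j * z ^ i * w ^ j))
      has_sum (q (z, w) + r (z, w))) (UNIV \<times> UNIV)"
    using assms unfolding bipower_expansion_def by (intro has_sum_add) auto
  then show "((\<lambda>(i, j). (c i j + d i j) * z ^ i * w ^ j) has_sum (q (z, w) + r (z, w))) (UNIV \<times> UNIV)"
    by (rule has_sum_cong[THEN iffD1, rotated]) (auto simp: algebra_simps)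
qed

lemma bounded_powser_sums:
  fixes a :: "nat \<Rightarrow> complex"
  assumes "\<And>k. cmod (a k) \<le> B" "cmod z < 1"
  shows "(\<lambda>k. a k * z ^ k) sums (\<Sum>k. a k * z ^ k)"
  by (rule summable_sums[OF summable_norm_cancel[OF summable_bounded_powser[of a B z, OF assms]]])

lemma bipower_expansion_rows:
  assumes q: "bipower_expansion c q" and c: "\<And>i j. cmod (c i j) \<le> B"
    and z: "cmod z < 1" and w: "cmod w < 1"
  shows "(\<lambda>i. (\<Sum>j. c i j * w ^ j) * z ^ i) sums q (z, w)"
proof (rule has_sum_imp_sums)
  show "((\<lambda>i. (\<Sum>j. c i j * w ^ j) * z ^ i) has_sum q (z, w)) UNIV"
  proof (rule has_sum_SigmaD)
    show "((\<lambda>(i, j). c i j * z ^ i * w ^ j) has_sum q (z, w)) (UNIV \<times> UNIV)"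
      using q z w by (simp add: bipower_expansion_def)
    fix i
    have "((\<lambda>j. c i j * w ^ j) has_sum (\<Sum>j. c i j * w ^ j)) UNIV"
      by (rule norm_summable_imp_has_sum[OF summable_bounded_powser[of "c i", OF c w] bounded_powser_sums[of "c i", OF c w]])
    from has_sum_cmult_left[OF this, of "z ^ i"]
    show "((\<lambda>j. case (i, j) of (i, j) \<Rightarrow> c i j * z ^ i * w ^ j) has_sum (\<Sum>j. c i j * w ^ j) * z ^ i) UNIV"
      by (simp add: mult_ac)
  qed
qed

lemma bipower_expansion_swap:
  "bipower_expansion c q \<Longrightarrow> bipower_expansion (\<lambda>i j. c j i) (\<lambda>(z, w). q (w, z))"
  unfolding bipower_expansion_def
proof (intro allI impI)
  fix z w :: complex
  assume "\<forall>z w. cmod z < 1 \<longrightarrow> cmod w < 1 \<longrightarrow>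
      ((\<lambda>(i, j). c i j * z ^ i * w ^ j) has_sum q (z, w)) (UNIV \<times> UNIV)" "cmod z < 1" "cmod w < 1"
  then have "((\<lambda>(i, j). c i j * w ^ i * z ^ j) has_sum q (w, z)) (UNIV \<times> UNIV)" by blast
  then show "((\<lambda>(i, j). c j i * z ^ i * w ^ j) has_sum (case (z, w) of (z, w) \<Rightarrow> q (w, z))) (UNIV \<times> UNIV)"
    by (subst (asm) has_sum_swap) (simp add: mult.assoc mult.commute[of "w ^ _"])
qed

lemma bipower_expansion_columns:
  assumes q: "bipower_expansion c q" and c: "\<And>i j. cmod (c i j) \<le> B"
    and z: "cmod z < 1" and w: "cmod w < 1"
  shows "(\<lambda>j. (\<Sum>i. c i j * z ^ i) * w ^ j) sums q (z, w)"
  using bipower_expansion_rows[OF bipower_expansion_swap[OF q] c w z] by simp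

text \<open>The dehomogenised part of degree k: at (z, t z) the homogeneous part is z^k times the
  value of this polynomial at t.\<close>

definition homogeneous_symbol :: "(nat \<Rightarrow> nat \<Rightarrow> complex) \<Rightarrow> nat \<Rightarrow> complex poly" where
  "homogeneous_symbol c k = (\<Sum>j\<le>k. monom (c (k - j) j) j)"

lemma poly_homogeneous_symbol: "poly (homogeneous_symbol c k) t = (\<Sum>j\<le>k. c (k - j) j * t ^ j)"
  by (simp add: homogeneous_symbol_def poly_sum poly_monom)

lemma coeff_homogeneous_symbol: "coeff (homogeneous_symbol c k) j = (if j \<le> k then c (k - j) j else 0)"
  by (simp add: homogeneous_symbol_def coeff_sum if_distrib cong: if_cong)

lemma degree_homogeneous_symbol: "degree (homogeneous_symbol c k) \<le> k"
  by (rule degree_le) (simp add: coeff_homogeneous_symbol)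

lemma bipower_expansion_diagonals:
  assumes q: "bipower_expansion c q" and z: "cmod z < 1" and t: "cmod t = 1"
  shows "(\<lambda>k. poly (homogeneous_symbol c k) t * z ^ k) sums q (z, t * z)"
proof (rule has_sum_imp_sums)
  let ?w = "t * z"
  have w: "cmod ?w < 1" using z t by (simp add: norm_mult)
  have "((\<lambda>(i, j). c i j * z ^ i * ?w ^ j) has_sum q (z, ?w)) (UNIV \<times> UNIV)"
    using q z w unfolding bipower_expansion_def by blast
  \<comment> \<open>The pair (i, j) becomes (i + j, j): summation by total degree, where the factor
    w^j splits into t^j and z^j.\<close>
  also have "?this \<longleftrightarrow> ((\<lambda>(k, j). c (k - j) j * t ^ j * z ^ k) has_sum q (z, ?w)) (SIGMA k:UNIV. {..k})"
    by (rule has_sum_reindex_bij_witness[where i = "\<lambda>(k, j). (k - j, j)" and j = "\<lambda>(i, j). (i + j, j)"])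
      (auto simp: power_mult_distrib power_add)
  finally show "((\<lambda>k. poly (homogeneous_symbol c k) t * z ^ k) has_sum q (z, ?w)) UNIV"
  proof (rule has_sum_SigmaD)
    show "((\<lambda>j. case (k, j) of (k, j) \<Rightarrow> c (k - j) j * t ^ j * z ^ k)
        has_sum poly (homogeneous_symbol c k) t * z ^ k) {..k}" for k
      by (simp add: has_sum_finiteI poly_homogeneous_symbol sum_distrib_right)
  qed
qed

lemma bipower_expansion_holomorphic_fst:
  assumes "bipower_expansion c q" "\<And>i j. cmod (c i j) \<le> B" "cmod w < 1"
  shows "(\<lambda>z. q (z, w)) holomorphic_on ball 0 1"
  by (rule power_series_holomorphic[where a = "\<lambda>i. \<Sum>j. c i j * w ^ j"])
    (use bipower_expansion_rows[OF assms(1,2) _ assms(3)] in simp)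

lemma bipower_expansion_holomorphic_snd:
  assumes "bipower_expansion c q" "\<And>i j. cmod (c i j) \<le> B" "cmod z < 1"
  shows "(\<lambda>w. q (z, w)) holomorphic_on ball 0 1"
  using bipower_expansion_holomorphic_fst[OF bipower_expansion_swap[OF assms(1)] assms(2,3)] by simp

lemma bounded_powser_le:
  fixes a :: "nat \<Rightarrow> complex"
  assumes a: "\<And>k. cmod (a k) \<le> B" and z: "cmod z \<le> r" and r: "r < 1"
  shows "cmod (\<Sum>k. a k * z ^ k) \<le> B / (1 - r)"
proof -
  have r0: "0 \<le> r" using norm_ge_zero[of z] z by linarith
  have B: "0 \<le> B" using order_trans[OF norm_ge_zero a] .
  have "cmod (\<Sum>k. a k * z ^ k) \<le> (\<Sum>k. B * r ^ k)"
  proof (rule norm_suminf_le)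
    show "cmod (a k * z ^ k) \<le> B * r ^ k" for k
      unfolding norm_mult norm_power using a[of k] z r0 B by (intro mult_mono power_mono) auto
    show "summable (\<lambda>k. B * r ^ k)" using r0 r by (intro summable_mult summable_geometric) auto
  qed
  also have "\<dots> = B / (1 - r)"
    using r0 r by (subst suminf_mult) (auto simp: suminf_geometric intro!: summable_geometric)
  finally show ?thesis .
qed

text \<open>Both partial derivatives exist, and the second one is jointly continuous by the
  Weierstrass test.\<close>

lemma bipower_expansion_holomorphic2_on:
  assumes q: "bipower_expansion c q" and c: "\<And>i j. cmod (c i j) \<le> B"
  shows "holomorphic2_on q (unit_disc \<times> unit_disc)"
  unfolding holomorphic2_on_def
proof
  fix p :: "complex \<times> complex" assume "p \<in> unit_disc \<times> unit_disc"
  then obtain z w where p: "p = (z, w)" and zw: "cmod z < 1" "cmod w < 1" by auto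
  \<comment> \<open>Column sums: q (x, y) is the power series in y with coefficients
    \<open>b j x\<close>, and D is its derivative in y.\<close>
  define b where "b = (\<lambda>j x. \<Sum>i. c i j * x ^ i)"
  define D where "D = (\<lambda>x. \<Sum>j. diffs (\<lambda>j. b j (fst x)) j * snd x ^ j)"
  \<comment> \<open>The midpoint between the larger modulus and 1: the bidisc of radius r contains
    the point and leaves room for uniform estimates.\<close>
  define r where "r = (1 + max (cmod z) (cmod w)) / 2"
  have r: "cmod z < r" "cmod w < r" "r < 1" "0 < r"
    using zw by (auto simp: r_def max_def add_pos_nonneg)
  let ?X = "ball (0 :: complex) r"
  have X: "cmod x < 1" if "x \<in> ?X" for x using that r by simp
  have b_le: "cmod (b j x) \<le> B / (1 - r)" if "x \<in> ?X" for j x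
    unfolding b_def using that r by (intro bounded_powser_le[of "\<lambda>i. c i j"] c) auto
  have b_hol: "b j holomorphic_on ?X" for j
    unfolding b_def
    by (rule holomorphic_on_subset[where s = "ball 0 1"], rule power_series_holomorphic[where a = "\<lambda>i. c i j"])
      (use bounded_powser_sums[of "\<lambda>i. c i j" B, OF c] r in auto)
  have "uniform_limit (?X \<times> ?X) (\<lambda>n x. \<Sum>j<n. diffs (\<lambda>j. b j (fst x)) j * snd x ^ j)
      (\<lambda>x. \<Sum>j. diffs (\<lambda>j. b j (fst x)) j * snd x ^ j) sequentially"
  proof (rule Weierstrass_m_test)
    show "summable (\<lambda>j. B / (1 - r) * (of_nat (Suc j) * r ^ j))"
      using geometric_deriv_sums[of r] r by (intro summable_mult) (auto simp: sums_iff)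
    fix j and x :: "complex \<times> complex" assume x: "x \<in> ?X \<times> ?X"
    have "norm (diffs (\<lambda>j. b j (fst x)) j * snd x ^ j)
        = cmod (b (Suc j) (fst x)) * (of_nat (Suc j) * cmod (snd x) ^ j)"
      by (simp add: diffs_def norm_mult norm_power del: of_nat_Suc)
    also have "\<dots> \<le> B / (1 - r) * (of_nat (Suc j) * r ^ j)"
      using x r order_trans[OF norm_ge_zero b_le[of "fst x" "Suc j"]]
      by (intro mult_mono power_mono b_le) auto
    finally show "norm (diffs (\<lambda>j. b j (fst x)) j * snd x ^ j) \<le> B / (1 - r) * (of_nat (Suc j) * r ^ j)" .
  qed
  then have "uniform_limit (?X \<times> ?X) (\<lambda>n x. \<Sum>j<n. diffs (\<lambda>j. b j (fst x)) j * snd x ^ j) D sequentially"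
    by (simp add: D_def)
  then have "continuous_on (?X \<times> ?X) D"
  proof (rule uniform_limit_theorem[rotated])
    have "continuous_on (?X \<times> ?X) (\<lambda>x. b j (fst x))" for j
      by (rule continuous_on_compose2[OF holomorphic_on_imp_continuous_on[OF b_hol]]) 
        (auto intro: continuous_on_fst continuous_on_id)
    then show "\<forall>\<^sub>F n in sequentially. continuous_on (?X \<times> ?X) (\<lambda>x. \<Sum>j<n. diffs (\<lambda>j. b j (fst x)) j * snd x ^ j)"
      unfolding diffs_def by (intro always_eventually allI continuous_intros)
  qed simp
  then have cont: "continuous_on (?X \<times> ?X) (\<lambda>x. blinfun_mult_right (D x))"
    by (rule bounded_linear.continuous_on[OF bounded_linear_blinfun_mult_right])
  obtain a where a: "((\<lambda>x. q (x, w)) has_field_derivative a) (at z)"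
    using bipower_expansion_holomorphic_fst[OF q c zw(2)] zw(1)
    unfolding holomorphic_on_open[OF open_ball] by (metis dist_0_norm mem_ball)
  have fy: "((\<lambda>y. q (x, y)) has_field_derivative D (x, y)) (at y)" if x: "x \<in> ?X" and y: "y \<in> ?X" for x y
  proof -
    have "((\<lambda>y. \<Sum>j. b j x * y ^ j) has_field_derivative D (x, y)) (at y)"
      unfolding D_def fst_conv snd_conv
    proof (rule termdiffs_strong)
      show "summable (\<lambda>j. b j x * of_real r ^ j)"
        by (rule summable_norm_cancel[OF summable_bounded_powser[of "\<lambda>j. b j x", OF b_le[OF x]]]) (use r in simp)
      show "cmod y < cmod (of_real r)" using y r by simp
    qed
    then show ?thesis
    proof (rule has_field_derivative_transform_within_open[where S = "?X"])
      show "(\<Sum>j. b j x * v ^ j) = q (x, v)" if "v \<in> ?X" for v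
        using bipower_expansion_columns[OF q c X[OF x] X[OF that]] by (simp add: sums_iff b_def)
    qed (use y in auto)
  qed
  \<comment> \<open>Total differentiability needs the first partial derivative only at the point
    itself, but the second one near it and continuous at it.\<close>
  have "((\<lambda>(x, y). q (x, y)) has_derivative (\<lambda>(tx, ty). a * tx + blinfun_apply (blinfun_mult_right (D (z, w))) ty))
      (at (z, w) within ?X \<times> ?X)"
  proof (rule has_derivative_partialsI[where fy = "\<lambda>x y. blinfun_mult_right (D (x, y))"])
    show "((\<lambda>x. q (x, w)) has_derivative (*) a) (at z within ?X)"
      using a by (simp add: has_field_derivative_def has_derivative_at_withinI)
    show "((\<lambda>y. q (x, y)) has_derivative blinfun_apply (blinfun_mult_right (D (x, y)))) (at y within ?X)"
      if "x \<in> ?X" "y \<in> ?X" for x y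
      using fy[OF that] by (simp add: has_field_derivative_def has_derivative_at_withinI)
    show "continuous (at (z, w) within ?X \<times> ?X) (\<lambda>(x, y). blinfun_mult_right (D (x, y)))"
    proof -
      have "(\<lambda>(x, y). blinfun_mult_right (D (x, y))) = (\<lambda>x. blinfun_mult_right (D x))" by auto
      then show ?thesis using cont r by (simp add: continuous_on_eq_continuous_within)
    qed
  qed (use r in auto)
  moreover have "at (z, w) within ?X \<times> ?X = at (z, w)"
    by (rule at_within_open) (use r in \<open>auto intro: open_Times\<close>)
  ultimately show "\<exists>a b. (q has_derivative (\<lambda>(h, k). a * h + b * k)) (at p)"
    by (auto simp: p)
qed

lemma higher_partial2: "(partial2 ^^ j) q (z, w) = (deriv ^^ j) (\<lambda>u. q (z, u)) w"
  by (induction j arbitrary: w) (simp_all add: partial2_def)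

lemma higher_partial1: "(partial1 ^^ j) q (z, w) = (deriv ^^ j) (\<lambda>u. q (u, w)) z"
  by (induction j arbitrary: z) (simp_all add: partial1_def)

text \<open>The derivatives in w at 0 single out a column of coefficients, for every z in the disc;
  what remains is a power series in z.\<close>

lemma bipower_expansion_partials:
  assumes q: "bipower_expansion c q" and c: "\<And>i j. cmod (c i j) \<le> B"
  shows "(partial1 ^^ i) ((partial2 ^^ j) q) (0, 0) = fact i * fact j * c i j"
proof -
  have inner: "(deriv ^^ j) (\<lambda>u. q (z, u)) 0 = fact j * (\<Sum>i. c i j * z ^ i)" if z: "cmod z < 1" for z
    by (rule higher_deriv_0_power_series) (rule bipower_expansion_columns[OF q c z])
  have "(deriv ^^ i) (\<lambda>z. (deriv ^^ j) (\<lambda>u. q (z, u)) 0) 0 = fact i * (fact j * c i j)"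
  proof (rule higher_deriv_0_power_series)
    fix z :: complex assume z: "cmod z < 1"
    from sums_mult[OF bounded_powser_sums[of "\<lambda>i. c i j", OF c z], of "fact j"]
    show "(\<lambda>i. fact j * c i j * z ^ i) sums (deriv ^^ j) (\<lambda>u. q (z, u)) 0"
      by (simp add: inner[OF z] mult.assoc)
  qed
  then show ?thesis by (simp add: higher_partial1 higher_partial2)
qed


section \<open>Power series expansion of bounded holomorphic functions on the bidisc\<close>

lemma holomorphic2_on_holomorphic_fst:
  assumes q: "holomorphic2_on q (unit_disc \<times> unit_disc)" and w: "cmod w < 1"
  shows "(\<lambda>z. q (z, w)) holomorphic_on ball 0 1"
  unfolding holomorphic_on_open[OF open_ball]
proof
  fix z :: complex assume z: "z \<in> ball 0 1"
  with q w obtain a b where "(q has_derivative (\<lambda>(h, k). a * h + b * k)) (at (z, w))"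
    unfolding holomorphic2_on_def by (metis SigmaI dist_0_norm mem_ball)
  then have "(q has_derivative (\<lambda>(h, k). a * h + b * k)) (at (z, w) within (\<lambda>x. (x, w)) ` UNIV)"
    by (rule has_derivative_at_withinI)
  moreover have "((\<lambda>x. (x, w)) has_derivative (\<lambda>h. (h, 0))) (at z)"
    by (intro has_derivative_Pair has_derivative_const has_derivative_ident)
  ultimately have "((\<lambda>x. q (x, w)) has_derivative (\<lambda>h. a * h)) (at z)"
    using has_derivative_in_compose[of "\<lambda>x. (x, w)" "\<lambda>h. (h, 0)" z UNIV q "\<lambda>(h, k). a * h + b * k"] by simp
  then show "\<exists>f'. ((\<lambda>z. q (z, w)) has_field_derivative f') (at z)"
    by (auto simp: has_field_derivative_def)
qed

lemma holomorphic2_on_holomorphic_snd: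
  assumes q: "holomorphic2_on q (unit_disc \<times> unit_disc)" and z: "cmod z < 1"
  shows "(\<lambda>w. q (z, w)) holomorphic_on ball 0 1"
  unfolding holomorphic_on_open[OF open_ball]
proof
  fix w :: complex assume w: "w \<in> ball 0 1"
  with q z obtain a b where "(q has_derivative (\<lambda>(h, k). a * h + b * k)) (at (z, w))"
    unfolding holomorphic2_on_def by (metis SigmaI dist_0_norm mem_ball)
  then have "(q has_derivative (\<lambda>(h, k). a * h + b * k)) (at (z, w) within (\<lambda>x. (z, x)) ` UNIV)"
    by (rule has_derivative_at_withinI)
  moreover have "((\<lambda>x. (z, x)) has_derivative (\<lambda>k. (0, k))) (at w)"
    by (intro has_derivative_Pair has_derivative_const has_derivative_ident)
  ultimately have "((\<lambda>x. q (z, x)) has_derivative (\<lambda>k. b * k)) (at w)"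
    using has_derivative_in_compose[of "\<lambda>x. (z, x)" "\<lambda>k. (0, k)" w UNIV q "\<lambda>(h, k). a * h + b * k"] by simp
  then show "\<exists>f'. ((\<lambda>w. q (z, w)) has_field_derivative f') (at w)"
    by (auto simp: has_field_derivative_def)
qed

text \<open>By induction on \<open>j\<close>: after subtraction of the earlier terms of the expansion in \<open>w\<close> and division by
  \<open>w\<^sup>j\<close>, the \<open>j\<close>-th coefficient is a locally uniform limit of holomorphic functions of \<open>z\<close> as
  \<open>w \<rightarrow> 0\<close>.\<close>

lemma column_coefficients_holomorphic:
  assumes q: "holomorphic2_on q (unit_disc \<times> unit_disc)"
    and B: "\<And>z w. cmod z < 1 \<Longrightarrow> cmod w < 1 \<Longrightarrow> cmod (q (z, w)) \<le> B"
  shows "(\<lambda>z. (deriv ^^ j) (\<lambda>u. q (z, u)) 0 / fact j) holomorphic_on ball 0 1"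
proof (induction j rule: less_induct)
  case (less J)
  define b where "b = (\<lambda>j z. (deriv ^^ j) (\<lambda>u. q (z, u)) 0 / fact j)"
  have b_le: "cmod (b j z) \<le> B" if z: "cmod z < 1" for j z
    unfolding b_def by (rule taylor_coeff_bound[OF holomorphic2_on_holomorphic_snd[OF q z] B[OF z]])
  have b_sums: "(\<lambda>j. b j z * w ^ j) sums q (z, w)" if "cmod z < 1" "cmod w < 1" for z w
    using holomorphic_power_series[OF holomorphic2_on_holomorphic_snd[OF q], of z w] that
    by (simp add: b_def)
  define s where "s = (\<lambda>n. 1 / real (Suc (Suc n)))"
  have s: "0 < s n" "s n < 1" for n by (auto simp: s_def)
  have s0: "s \<longlonglongrightarrow> 0" unfolding s_def by (intro LIMSEQ_Suc[OF LIMSEQ_Suc[OF lim_1_over_n]])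
  \<comment> \<open>The Taylor remainder of order J in w, divided by w^J, at the real points w =
    \<open>s n\<close>. It is holomorphic in z by the induction hypothesis, and its distance from
    \<open>b J z\<close> is at most |w| B / (1 - |w|), uniformly in z.\<close>
  define g where "g = (\<lambda>n z. (q (z, of_real (s n)) - (\<Sum>j<J. b j z * of_real (s n) ^ j)) / of_real (s n) ^ J)"
  have est: "norm (g n z - b J z) \<le> s n * (B / (1 - s n))" if z: "cmod z < 1" for n z
  proof -
    let ?w = "complex_of_real (s n)"
    have w: "cmod ?w = s n" "?w \<noteq> 0" using s[of n] by auto
    have "(\<lambda>j. b (j + J) z * ?w ^ (j + J)) sums (q (z, ?w) - (\<Sum>j<J. b j z * ?w ^ j))"
      using b_sums[OF z, of ?w] w s[of n] by (subst sums_iff_shift) simp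
    from sums_divide[OF this, of "?w ^ J"]
    have "(\<lambda>j. b (j + J) z * ?w ^ j) sums g n z"
      using w by (simp add: g_def power_add)
    then have "(\<lambda>j. b (Suc j + J) z * ?w ^ Suc j) sums (g n z - b J z)"
      by (subst sums_Suc_iff[of "\<lambda>j. b (j + J) z * ?w ^ j"]) simp
    moreover have "(\<lambda>j. b (Suc j + J) z * ?w ^ Suc j) sums (?w * (\<Sum>j. b (Suc j + J) z * ?w ^ j))"
      using sums_mult[OF bounded_powser_sums[of "\<lambda>j. b (Suc j + J) z" B ?w, OF b_le[OF z]], of ?w] w s[of n]
      by (simp add: mult_ac)
    ultimately have "g n z - b J z = ?w * (\<Sum>j. b (Suc j + J) z * ?w ^ j)" by (rule sums_unique2)
    also have "norm \<dots> \<le> s n * (B / (1 - s n))"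
      unfolding norm_mult w(1) using s[of n] w
      by (intro mult_left_mono bounded_powser_le[of "\<lambda>j. b (Suc j + J) z", OF b_le[OF z]]) auto
    finally show ?thesis .
  qed
  have "b J holomorphic_on ball 0 1"
  proof (rule holomorphic_uniform_sequence)
    show "g n holomorphic_on ball 0 1" for n
      unfolding g_def
    proof (intro holomorphic_intros)
      show "(\<lambda>z. q (z, of_real (s n))) holomorphic_on ball 0 1"
        by (rule holomorphic2_on_holomorphic_fst[OF q]) (use s[of n] in simp)
      show "b j holomorphic_on ball 0 1" if "j \<in> {..<J}" for j
        using less.IH[of j] that unfolding b_def by simp
    qed (use s[of n] in auto)
    fix x :: complex assume "x \<in> ball 0 1"
    then obtain d where d: "0 < d" "cball x d \<subseteq> ball 0 1"
      using open_ball open_contains_cball by blast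
    have "(\<lambda>n. s n * (B / (1 - s n))) \<longlonglongrightarrow> 0 * (B / (1 - 0))"
      by (intro tendsto_intros s0) auto
    then have lim: "(\<lambda>n. s n * (B / (1 - s n))) \<longlonglongrightarrow> 0" by simp
    have "uniform_limit (cball x d) g (b J) sequentially"
    proof (rule uniform_limitI)
      fix e :: real assume "0 < e"
      then have "\<forall>\<^sub>F n in sequentially. s n * (B / (1 - s n)) < e" by (rule order_tendstoD[OF lim])
      then show "\<forall>\<^sub>F n in sequentially. \<forall>z\<in>cball x d. dist (g n z) (b J z) < e"
      proof eventually_elim
        case (elim n)
        show ?case
        proof
          fix z assume "z \<in> cball x d"
          then have "cmod z < 1" using d by auto
          from est[OF this, of n] elim show "dist (g n z) (b J z) < e" by (simp add: dist_norm)
        qed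
      qed
    qed
    with d show "\<exists>d>0. cball x d \<subseteq> ball 0 1 \<and> uniform_limit (cball x d) g (b J) sequentially" by blast
  qed simp
  then show ?case by (simp add: b_def)
qed

text \<open>Cauchy's inequality in each variable in turn bounds the iterated Taylor coefficients by
  B, so the double series converges unconditionally. Summing it by columns gives the iterated Taylor
  expansion of q, which identifies its value.\<close>

lemma holomorphic2_on_bipower_expansion:
  assumes q: "holomorphic2_on q (unit_disc \<times> unit_disc)"
    and B: "\<And>z w. cmod z < 1 \<Longrightarrow> cmod w < 1 \<Longrightarrow> cmod (q (z, w)) \<le> B"
  obtains c where "bipower_expansion c q" "\<And>i j. cmod (c i j) \<le> B"
proof
  define b where "b = (\<lambda>j z. (deriv ^^ j) (\<lambda>u. q (z, u)) 0 / fact j)"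
  define c where "c = (\<lambda>i j. (deriv ^^ i) (b j) 0 / fact i)"
  have b_hol: "b j holomorphic_on ball 0 1" for j
    unfolding b_def by (rule column_coefficients_holomorphic[OF q B])
  have b_le: "cmod (b j z) \<le> B" if z: "cmod z < 1" for j z
    unfolding b_def by (rule taylor_coeff_bound[OF holomorphic2_on_holomorphic_snd[OF q z] B[OF z]])
  show c_le: "cmod (c i j) \<le> B" for i j
    unfolding c_def by (rule taylor_coeff_bound[OF b_hol b_le])
  show "bipower_expansion c q"
    unfolding bipower_expansion_def
  proof (intro allI impI)
    fix z w :: complex assume z: "cmod z < 1" and w: "cmod w < 1"
    define S where "S = (\<Sum>\<^sub>\<infinity>(i, j)\<in>UNIV \<times> UNIV. c i j * z ^ i * w ^ j)"
    have exp: "bipower_expansion c (\<lambda>(z, w). \<Sum>\<^sub>\<infinity>(i, j)\<in>UNIV \<times> UNIV. c i j * z ^ i * w ^ j)"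
      by (rule bipower_expansion_infsum[OF c_le])
    have "(\<Sum>i. c i j * z ^ i) = b j z" for j
      using holomorphic_power_series[OF b_hol, of z j] z by (simp add: c_def sums_iff)
    then have "(\<lambda>j. b j z * w ^ j) sums S"
      using bipower_expansion_columns[OF exp c_le z w] by (simp add: S_def)
    moreover have "(\<lambda>j. b j z * w ^ j) sums q (z, w)"
      using holomorphic_power_series[OF holomorphic2_on_holomorphic_snd[OF q z], of w] w
      by (simp add: b_def)
    ultimately have "S = q (z, w)" by (rule sums_unique2)
    moreover have "((\<lambda>(i, j). c i j * z ^ i * w ^ j) has_sum S) (UNIV \<times> UNIV)"
      using exp z w unfolding bipower_expansion_def prod.case S_def by blast
    ultimately show "((\<lambda>(i, j). c i j * z ^ i * w ^ j) has_sum q (z, w)) (UNIV \<times> UNIV)"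
      by (simp only:)
  qed
qed

section \<open>Functions bounded by 1 on the bidisc and their homogeneous symbols\<close>

lemma contractive_symbols_cong:
  assumes "contractive_symbols p" "\<And>k. k \<ge> 1 \<Longrightarrow> p k = q k"
  shows "contractive_symbols q"
  using assms by (simp add: contractive_symbols_def)

lemma bounded_imp_contractive_homogeneous_symbol:
  assumes g: "bipower_expansion c g" and c0: "c 0 0 = 0"
    and le1: "\<And>z w. cmod z < 1 \<Longrightarrow> cmod w < 1 \<Longrightarrow> cmod (g (z, w)) \<le> 1"
  shows "contractive_symbols (homogeneous_symbol c)"
  unfolding contractive_symbols_def
proof (intro conjI allI impI)
  fix t :: complex assume t: "cmod t = 1"
  let ?a = "\<lambda>k. poly (homogeneous_symbol c k) t"
  have sums: "(\<lambda>k. ?a k * z ^ k) sums g (z, t * z)" if "cmod z < 1" for z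
    by (rule bipower_expansion_diagonals[OF g that t])
  have gle: "cmod (g (z, t * z)) \<le> 1" if "cmod z < 1" for z
    using that t by (intro le1) (auto simp: norm_mult)
  have hol: "(\<lambda>z. g (z, t * z)) holomorphic_on ball 0 1"
    by (rule power_series_holomorphic[where a = ?a]) (simp add: sums)
  show "toeplitz_contraction (\<lambda>k. ?a (Suc k))"
  proof (rule Schur_imp_toeplitz_contraction)
    have "cmod (?a k) \<le> 1" for k
      using taylor_coeff_bound[OF hol gle, of k] by (simp add: higher_deriv_0_power_series[OF sums])
    then show "cmod (?a (Suc k)) \<le> 1" for k .
    fix z :: complex assume z: "cmod z < 1"
    \<comment> \<open>As the slice vanishes at 0, the series shifted by one still represents all of
      it.\<close>
    have "?a 0 = 0" by (simp add: poly_homogeneous_symbol c0)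
    moreover have "(\<lambda>k. ?a (Suc k) * z ^ Suc k) sums (g (z, t * z) - ?a 0 * z ^ 0)"
      using sums[OF z] by (subst sums_Suc_iff[of "\<lambda>k. ?a k * z ^ k"]) simp
    ultimately have "(\<Sum>k. ?a (Suc k) * z ^ Suc k) = g (z, t * z)" by (simp add: sums_iff)
    with gle[OF z] show "cmod (\<Sum>k. ?a (Suc k) * z ^ Suc k) \<le> 1" by simp
  qed
qed (rule degree_homogeneous_symbol)

text \<open>On \<open>\<bar>z\<bar> = \<bar>w\<bar> = r\<close> the bound comes from the symbols; the maximum principle in each variable
  extends it to the bidisc.\<close>

lemma contractive_homogeneous_symbol_imp_bounded:
  assumes g: "bipower_expansion c g" and c: "\<And>i j. cmod (c i j) \<le> B" and c0: "c 0 0 = 0"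
    and contr: "contractive_symbols (homogeneous_symbol c)"
    and zw: "cmod z < 1" "cmod w < 1"
  shows "cmod (g (z, w)) \<le> 1"
proof -
  define r where "r = (1 + max (cmod z) (cmod w)) / 2"
  have r: "cmod z < r" "cmod w < r" "r < 1" "0 < r"
    using zw by (auto simp: r_def max_def add_pos_nonneg)
  have torus: "cmod (g (u, v)) \<le> 1" if u: "cmod u = r" and v: "cmod v = r" for u v
  proof -
    \<comment> \<open>Every point of the torus of radius r lies on one of the slices, since both
      coordinates have the same modulus.\<close>
    define t where "t = v / u"
    have t: "cmod t = 1" "v = t * u" using u v r by (auto simp: t_def norm_divide)
    let ?a = "\<lambda>k. poly (homogeneous_symbol c k) t"
    have u1: "cmod u < 1" using u r by simp
    have T: "toeplitz_contraction (\<lambda>k. ?a (Suc k))"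
      using contr t(1) by (simp add: contractive_symbols_def)
    have "(\<lambda>k. ?a (Suc k) * u ^ k) sums (\<Sum>k. ?a (Suc k) * u ^ k)"
      by (rule bounded_powser_sums[of "\<lambda>k. ?a (Suc k)", OF toeplitz_contraction_bound[OF T] u1])
    from sums_mult[OF this, of u]
    have "(\<lambda>k. ?a (Suc k) * u ^ Suc k) sums (u * (\<Sum>k. ?a (Suc k) * u ^ k))"
      by (simp add: mult_ac)
    moreover have "?a 0 = 0" by (simp add: poly_homogeneous_symbol c0)
    then have "(\<lambda>k. ?a (Suc k) * u ^ Suc k) sums g (u, t * u)"
      using bipower_expansion_diagonals[OF g u1 t(1)]
      by (subst sums_Suc_iff[of "\<lambda>k. ?a k * u ^ k"]) simp
    ultimately have "g (u, v) = u * (\<Sum>k. ?a (Suc k) * u ^ k)"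
      using t(2) sums_unique2 by simp
    then show ?thesis
      using toeplitz_contraction_imp_Schur[OF T u1] u1 by (simp add: norm_mult mult_le_one)
  qed
  have sub: "cball (0 :: complex) r \<subseteq> ball 0 1" "ball (0 :: complex) r \<subseteq> ball 0 1" using r by auto
  have max: "cmod (f x) \<le> 1"
    if f: "f holomorphic_on ball 0 1" and le: "\<And>x. cmod x = r \<Longrightarrow> cmod (f x) \<le> 1" and x: "cmod x < r" for f x
  proof (rule maximum_modulus_frontier[where f = f and S = "cball 0 r"])
    show "f holomorphic_on interior (cball 0 r)"
      using holomorphic_on_subset[OF f sub(2)] by (simp add: interior_cball)
    show "continuous_on (closure (cball 0 r)) f"
      using continuous_on_subset[OF holomorphic_on_imp_continuous_on[OF f] sub(1)] by simp
    show "cmod (f y) \<le> 1" if "y \<in> frontier (cball 0 r)" for y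
      using that r(4) by (intro le) (simp add: frontier_cball)
    show "x \<in> cball 0 r" using x by simp
  qed simp
  \<comment> \<open>The second variable moves inside while the first stays on the circle of radius
    r; then the first one moves with w fixed.\<close>
  have "cmod (g (u, w)) \<le> 1" if u: "cmod u = r" for u
    by (rule max[OF bipower_expansion_holomorphic_snd[OF g c] torus[OF u] r(2)]) (use u r in simp)
  then show ?thesis
    by (rule max[OF bipower_expansion_holomorphic_fst[OF g c zw(2)] _ r(1)])
qed

text \<open>The Taylor coefficients of p regained from its symbols: the monomial with exponents i, j
  takes coefficient j of p_(i+j).\<close>

definition quadratic_coeff :: "complex poly \<Rightarrow> complex poly \<Rightarrow> nat \<Rightarrow> nat \<Rightarrow> complex" where
  "quadratic_coeff p1 p2 i j =
     (if i + j = 1 then coeff p1 j else if i + j = 2 then coeff p2 j else 0)"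

lemma bipower_expansion_quadratic:
  "bipower_expansion (quadratic_coeff [:a10, a01:] [:a20, a11, a02:])
     (\<lambda>(z1, z2). a10 * z1 + a01 * z2 + a20 * z1\<^sup>2 + a11 * z1 * z2 + a02 * z2\<^sup>2)"
  unfolding bipower_expansion_def
proof (intro allI impI)
  fix z w :: complex
  let ?c = "quadratic_coeff [:a10, a01:] [:a20, a11, a02:]"
  let ?S = "{(1, 0), (0, 1), (2, 0), (1, 1), (0, 2)} :: (nat \<times> nat) set"
  have "(i, j) \<in> ?S" if "i + j = 1 \<or> i + j = 2" for i j :: nat
  proof -
    from that have "i = 1 \<and> j = 0 \<or> i = 0 \<and> j = 1 \<or> i = 2 \<and> j = 0 \<or> i = 1 \<and> j = 1 \<or> i = 0 \<and> j = 2"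
      by arith
    then show ?thesis by auto
  qed
  then have c0: "?c i j = 0" if "(i, j) \<notin> ?S" for i j
    using that unfolding quadratic_coeff_def by auto
  have c: "?c 1 0 = a10" "?c 0 1 = a01" "?c 2 0 = a20" "?c 1 1 = a11" "?c 0 2 = a02"
    by (simp_all add: quadratic_coeff_def numeral_2_eq_2)
  show "((\<lambda>(i, j). ?c i j * z ^ i * w ^ j) has_sum
      (case (z, w) of (z1, z2) \<Rightarrow> a10 * z1 + a01 * z2 + a20 * z1\<^sup>2 + a11 * z1 * z2 + a02 * z2\<^sup>2)) (UNIV \<times> UNIV)"
  proof (rule has_sum_finite_neutralI[where B = ?S])
    fix x assume "x \<in> UNIV \<times> UNIV - ?S"
    then show "(case x of (i, j) \<Rightarrow> ?c i j * z ^ i * w ^ j) = 0"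
      using c0[of "fst x" "snd x"] by (simp add: case_prod_beta)
  next
    show "(case (z, w) of (z1, z2) \<Rightarrow> a10 * z1 + a01 * z2 + a20 * z1\<^sup>2 + a11 * z1 * z2 + a02 * z2\<^sup>2)
        = (\<Sum>x\<in>?S. case x of (i, j) \<Rightarrow> ?c i j * z ^ i * w ^ j)"
      using c by simp
  qed auto
qed

text \<open>Symbols and coefficient arrays determine each other degree by degree. That q vanishes to
  order 2 means that the symbols of p + q of degree 1 and 2 are those of p; conversely q collects
  the terms of degree at least 3 prescribed by the symbols.\<close>

lemma bidisc_extension_iff_contractive_symbols:
  fixes a10 a01 a20 a11 a02 :: complex
  defines "p \<equiv> (\<lambda>(z1, z2). a10 * z1 + a01 * z2 + a20 * z1\<^sup>2 + a11 * z1 * z2 + a02 * z2\<^sup>2)"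
    and "p1 \<equiv> [:a10, a01:]"
    and "p2 \<equiv> [:a20, a11, a02:]"
  shows "(\<exists>q. holomorphic2_on q (unit_disc \<times> unit_disc) \<and>
            (\<forall>i1 i2. i1 + i2 \<le> 2 \<longrightarrow> (partial1 ^^ i1) ((partial2 ^^ i2) q) (0, 0) = 0) \<and>
            (\<forall>z \<in> unit_disc \<times> unit_disc. cmod (p z + q z) \<le> 1))
      \<longleftrightarrow> (\<exists>s. contractive_symbols s \<and> s 1 = p1 \<and> s 2 = p2)"
proof
  define a where "a = quadratic_coeff p1 p2"
  have p: "bipower_expansion a p"
    unfolding a_def p_def p1_def p2_def by (rule bipower_expansion_quadratic)
  {
    assume "\<exists>q. holomorphic2_on q (unit_disc \<times> unit_disc) \<and>
            (\<forall>i1 i2. i1 + i2 \<le> 2 \<longrightarrow> (partial1 ^^ i1) ((partial2 ^^ i2) q) (0, 0) = 0) \<and>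
            (\<forall>z \<in> unit_disc \<times> unit_disc. cmod (p z + q z) \<le> 1)"
    then obtain q where q: "holomorphic2_on q (unit_disc \<times> unit_disc)"
      and q0: "\<And>i j. i + j \<le> 2 \<Longrightarrow> (partial1 ^^ i) ((partial2 ^^ j) q) (0, 0) = 0"
      and le1: "\<And>z w. cmod z < 1 \<Longrightarrow> cmod w < 1 \<Longrightarrow> cmod (p (z, w) + q (z, w)) \<le> 1"
      by auto
    \<comment> \<open>Bounds |p| on the bidisc; together with |p + q| \<le> 1 it bounds q, as its
      expansion requires.\<close>
    define A where "A = cmod a10 + cmod a01 + cmod a20 + cmod a11 + cmod a02"
    have qB: "cmod (q (z, w)) \<le> 1 + A" if zw: "cmod z < 1" "cmod w < 1" for z w
    proof -
      have m: "cmod (x * y) \<le> cmod x" if "cmod y \<le> 1" for x y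
        using that by (simp add: norm_mult mult_left_le)
      have "cmod (p (z, w)) \<le> cmod (a10 * z) + cmod (a01 * w) + cmod (a20 * z\<^sup>2) + cmod (a11 * (z * w)) + cmod (a02 * w\<^sup>2)"
        unfolding p_def prod.case mult.assoc by (intro norm_triangle_mono order_refl)
      also have "\<dots> \<le> A"
        unfolding A_def using zw by (intro add_mono m) (auto simp: norm_mult norm_power power_le_one mult_le_one)
      finally have "cmod (p (z, w)) \<le> A" .
      then show ?thesis
        using le1[OF zw] norm_triangle_ineq4[of "p (z, w) + q (z, w)" "p (z, w)"] by simp
    qed
    obtain d where d: "bipower_expansion d q" "\<And>i j. cmod (d i j) \<le> 1 + A"
      using holomorphic2_on_bipower_expansion[OF q qB] by blast
    have d0: "d i j = 0" if "i + j \<le> 2" for i j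
      using bipower_expansion_partials[OF d, of i j] q0[OF that] by simp
    let ?c = "\<lambda>i j. a i j + d i j"
    have "contractive_symbols (homogeneous_symbol ?c)"
      by (rule bounded_imp_contractive_homogeneous_symbol[OF bipower_expansion_add[OF p d(1)] _ le1])
        (simp_all add: d0 a_def quadratic_coeff_def)
    moreover have "homogeneous_symbol ?c 1 = p1" "homogeneous_symbol ?c 2 = p2"
      by (rule poly_eqI; simp add: coeff_homogeneous_symbol d0 a_def quadratic_coeff_def p1_def p2_def coeff_eq_0)+
    ultimately show "\<exists>s. contractive_symbols s \<and> s 1 = p1 \<and> s 2 = p2" by blast
  }
  assume "\<exists>s. contractive_symbols s \<and> s 1 = p1 \<and> s 2 = p2"
  then obtain s where s: "contractive_symbols s" "s 1 = p1" "s 2 = p2" by blast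
  \<comment> \<open>The symbols read as homogeneous parts; p supplies total degrees 1 and 2, and
    \<open>d\<close> below supplies the rest.\<close>
  define c where "c = (\<lambda>i j. if i + j = 0 then 0 else coeff (s (i + j)) j)"
  define d where "d = (\<lambda>i j. if i + j \<le> 2 then 0 else c i j)"
  have c: "cmod (c i j) \<le> 1" for i j
  proof (cases "i + j")
    case (Suc k)
    have "cmod (coeff (s (Suc k)) j) \<le> 1"
      using s(1) by (intro coeff_le_sup_circle) (auto simp: contractive_symbols_def intro: toeplitz_contraction_bound)
    then show ?thesis by (simp add: c_def Suc)
  qed (simp add: c_def)
  then have d: "cmod (d i j) \<le> 1" for i j by (simp add: d_def)
  define q where "q = (\<lambda>(z, w). \<Sum>\<^sub>\<infinity>(i, j)\<in>UNIV \<times> UNIV. d i j * z ^ i * w ^ j)"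
  have q: "bipower_expansion d q" unfolding q_def by (rule bipower_expansion_infsum[OF d])
  have "a i j + d i j = c i j" for i j
  proof -
    consider "i + j = 0" | "i + j = 1" | "i + j = 2" | "2 < i + j" by linarith
    then show ?thesis
      by cases (auto simp: a_def d_def c_def quadratic_coeff_def s(2,3)[symmetric])
  qed
  then have g: "bipower_expansion c (\<lambda>z. p z + q z)"
    using bipower_expansion_add[OF p q] by simp
  \<comment> \<open>The two families agree from index 1 on, by the degree bounds; at 0 the array was
    set to 0, whatever \<open>s 0\<close> is.\<close>
  have "contractive_symbols (homogeneous_symbol c)"
  proof (rule contractive_symbols_cong[OF s(1)])
    fix k :: nat assume "k \<ge> 1"
    then have "degree (s k) \<le> k" using s(1) by (simp add: contractive_symbols_def)
    then show "s k = homogeneous_symbol c k"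
      using \<open>k \<ge> 1\<close> by (intro poly_eqI) (auto simp: coeff_homogeneous_symbol c_def coeff_eq_0)
  qed
  then have "cmod (p (z, w) + q (z, w)) \<le> 1" if "cmod z < 1" "cmod w < 1" for z w
    using contractive_homogeneous_symbol_imp_bounded[OF g c _ _ that] by (simp add: c_def)
  moreover have "holomorphic2_on q (unit_disc \<times> unit_disc)"
    by (rule bipower_expansion_holomorphic2_on[OF q d])
  moreover have "(partial1 ^^ i) ((partial2 ^^ j) q) (0, 0) = 0" if "i + j \<le> 2" for i j
    using that by (simp add: bipower_expansion_partials[OF q d] d_def)
  ultimately show "\<exists>q. holomorphic2_on q (unit_disc \<times> unit_disc) \<and>
            (\<forall>i1 i2. i1 + i2 \<le> 2 \<longrightarrow> (partial1 ^^ i1) ((partial2 ^^ i2) q) (0, 0) = 0) \<and>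
            (\<forall>z \<in> unit_disc \<times> unit_disc. cmod (p z + q z) \<le> 1)"
    by (intro exI[of _ q]) auto
qed

theorem theorem3p4:
  fixes a10 a01 a20 a11 a02 :: complex
    and p :: "complex \<times> complex \<Rightarrow> complex"
    and p1 p2 :: "complex poly"
    and P :: "complex \<Rightarrow> (L2_circle \<Rightarrow>\<^sub>L L2_circle)"
  defines "p \<equiv> (\<lambda>(z1, z2). a10 * z1 + a01 * z2 + a20 * z1\<^sup>2 + a11 * z1 * z2 + a02 * z2\<^sup>2)"
    and "p1 \<equiv> [:a10, a01:]"
    and "p2 \<equiv> [:a20, a11, a02:]"
    and "P \<equiv> (\<lambda>z. z *\<^sub>C mult_poly p1 + z\<^sup>2 *\<^sub>C mult_poly p2)"
  shows "((\<exists>q. holomorphic2_on q (unit_disc \<times> unit_disc) \<and>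
            (\<forall>i1 i2. i1 + i2 \<le> 2 \<longrightarrow> (partial1 ^^ i1) ((partial2 ^^ i2) q) (0, 0) = 0) \<and>
            (\<forall>z \<in> unit_disc \<times> unit_disc. cmod (p z + q z) \<le> 1))
          \<longleftrightarrow> P \<in> CF_class)
       \<and> (P \<in> CF_class \<longleftrightarrow> completely_poly_extendible [p1, p2])"
  unfolding p_def p1_def p2_def P_def bidisc_extension_iff_contractive_symbols
    CF_class_iff_contractive_symbols completely_poly_extendible_iff_contractive_symbols
  by blast

end
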